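(* Let $p$ be a prime and let $G$ be a finite group with a Sylow $p$-subgroup $P$ of maximal class. Suppose that $\mathrm{O}_{p'}(G)=1$ and $\mathrm{O}^{p'}(G)=G$. Then one of the following holds: (i) There exists $x\in P$ such that $|\mathrm{C}_G(x)|_p=p^2$. (ii) $G$ is quasisimple and $|\mathrm{Z}(G)|\le p$.
   Context: A $p$-group of order $p^n$ has maximal class if its nilpotency class is $n-1$; this includes the groups of order $p^2$. $n_p$ denotes the $p$-part of a positive integer $n$. $\mathrm{O}_{p'}(G)$ is the largest normal subgroup of $G$ of order prime to $p$, and $\mathrm{O}^{p'}(G)$ is the smallest normal subgroup of $G$ whose index is prime to $p$. A group $G$ is quasisimple if $G$ is perfect and $G/\mathrm{Z}(G)$ is a non-abelian simple group. *)

theory Defs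
  imports "HOL-Algebra.SimpleGroups" "HOL-Algebra.SndIsomorphismGrp" "HOL-Algebra.Generated_Groups"
begin

definition p_part :: "nat \<Rightarrow> nat \<Rightarrow> nat"
  where "p_part p n = p ^ multiplicity p n"

definition sylow_subgroup :: "nat \<Rightarrow> 'a set \<Rightarrow> ('a, 'b) monoid_scheme \<Rightarrow> bool"
  where "sylow_subgroup p P G \<longleftrightarrow> subgroup P G \<and> card P = p_part p (order G)"

definition centralizer :: "('a, 'b) monoid_scheme \<Rightarrow> 'a \<Rightarrow> 'a set"
  where "centralizer G x = {g \<in> carrier G. g \<otimes>\<^bsub>G\<^esub> x = x \<otimes>\<^bsub>G\<^esub> g}"

definition center :: "('a, 'b) monoid_scheme \<Rightarrow> 'a set"
  where "center G = {z \<in> carrier G. \<forall>g \<in> carrier G. g \<otimes>\<^bsub>G\<^esub> z = z \<otimes>\<^bsub>G\<^esub> g}"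

definition commutator_subgroup :: "('a, 'b) monoid_scheme \<Rightarrow> 'a set \<Rightarrow> 'a set \<Rightarrow> 'a set"
  where "commutator_subgroup G H K =
    generate G {h \<otimes>\<^bsub>G\<^esub> k \<otimes>\<^bsub>G\<^esub> inv\<^bsub>G\<^esub> h \<otimes>\<^bsub>G\<^esub> inv\<^bsub>G\<^esub> k | h k. h \<in> H \<and> k \<in> K}"

text \<open>The lower central series is indexed from 0, so that the nilpotency class is the
  least index at which it is trivial.\<close>

primrec lower_central :: "('a, 'b) monoid_scheme \<Rightarrow> nat \<Rightarrow> 'a set"
  where
    "lower_central G 0 = carrier G"
  | "lower_central G (Suc i) = commutator_subgroup G (lower_central G i) (carrier G)"

definition nilpotent :: "('a, 'b) monoid_scheme \<Rightarrow> bool"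
  where "nilpotent G \<longleftrightarrow> (\<exists>c. lower_central G c = {\<one>\<^bsub>G\<^esub>})"

definition nilpotency_class :: "('a, 'b) monoid_scheme \<Rightarrow> nat"
  where "nilpotency_class G = (LEAST c. lower_central G c = {\<one>\<^bsub>G\<^esub>})"

text \<open>Writing \<open>n = c + 1\<close> instead of \<open>c = n - 1\<close> avoids truncated subtraction, which
  would admit the trivial group.\<close>

definition maximal_class :: "nat \<Rightarrow> ('a, 'b) monoid_scheme \<Rightarrow> bool"
  where "maximal_class p G \<longleftrightarrow>
    nilpotent G \<and> (\<exists>n. order G = p ^ n \<and> n = nilpotency_class G + 1)"

text \<open>The next two definitions select the greatest, respectively least, set with respect to
  inclusion; that these exist in a finite group is shown below.\<close>

definition p'_core :: "nat \<Rightarrow> ('a, 'b) monoid_scheme \<Rightarrow> 'a set"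
  where "p'_core p G = (GREATEST N. N \<lhd> G \<and> coprime p (card N))"

definition p'_residual :: "nat \<Rightarrow> ('a, 'b) monoid_scheme \<Rightarrow> 'a set"
  where "p'_residual p G = (LEAST N. N \<lhd> G \<and> coprime p (card (rcosets\<^bsub>G\<^esub> N)))"

lemma (in group) card_set_mult_normal:
  assumes "finite (carrier G)" "N \<lhd> G" "M \<lhd> G"
  obtains k where "card (N <#> M) = card N * k" "card M = card (N \<inter> M) * k"
proof -
  interpret second_isomorphism_grp N G M
    using assms by (simp add: second_isomorphism_grp_def second_isomorphism_grp_axioms_def
        normal_imp_subgroup)
  let ?NM = "N <#> M"
  have sub: "subgroup ?NM G" "N \<subseteq> ?NM" "subgroup N G"
    using normal_set_mult_subgroup H_contained_in_set_mult assms normal_imp_subgroup by auto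
  have 1: "subgroup N (G\<lparr>carrier := ?NM\<rparr>)" "subgroup (N \<inter> M) (G\<lparr>carrier := M\<rparr>)"
    using sub subgroup_incl normal_imp_subgroup[OF normal_subgrp_intersection_normal]
    by (auto simp: Int_commute)
  have "card (carrier (G\<lparr>carrier := M\<rparr> Mod (N \<inter> M))) =
        card (carrier (G\<lparr>carrier := ?NM\<rparr> Mod N))"
    using normal_intersection_quotient_isom unfolding iso_def by (auto intro: bij_betw_same_card)
  then have eq: "card (rcosets\<^bsub>G\<lparr>carrier := M\<rparr>\<^esub> (N \<inter> M)) = card (rcosets\<^bsub>G\<lparr>carrier := ?NM\<rparr>\<^esub> N)"
    by (simp add: FactGroup_def)
  have "card (rcosets\<^bsub>G\<lparr>carrier := ?NM\<rparr>\<^esub> N) * card N = card ?NM"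
    using group.lagrange[OF subgroup_imp_group[OF sub(1)] 1(1)] by (simp add: order_def)
  moreover have "card (rcosets\<^bsub>G\<lparr>carrier := M\<rparr>\<^esub> (N \<inter> M)) * card (N \<inter> M) = card M"
    using group.lagrange[OF subgroup_imp_group[OF subgrpS] 1(2)] by (simp add: order_def)
  ultimately show thesis using that eq by (metis mult.commute)
qed

lemma (in group) p'_core_greatest:
  assumes fin: "finite (carrier G)"
  shows "p'_core p G \<lhd> G" "coprime p (card (p'_core p G))"
    "\<And>N. \<lbrakk>N \<lhd> G; coprime p (card N)\<rbrakk> \<Longrightarrow> N \<subseteq> p'_core p G"
proof -
  let ?P = "\<lambda>N. N \<lhd> G \<and> coprime p (card N)"
  have "finite (Collect ?P)"
    by (rule finite_subset[of _ "Pow (carrier G)"])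
      (auto simp: fin dest: normal_imp_subgroup subgroup.subset)
  moreover have "{\<one>} \<in> Collect ?P" by (simp add: one_is_normal)
  ultimately obtain M where M: "?P M" and max: "\<And>N. ?P N \<Longrightarrow> M \<subseteq> N \<Longrightarrow> N = M"
    using finite_has_maximal[of "Collect ?P"] by (metis (no_types, lifting) empty_iff mem_Collect_eq)
  have great: "N \<subseteq> M" if N: "?P N" for N
  proof -
    obtain k where k: "card (N <#> M) = card N * k" "card M = card (N \<inter> M) * k"
      using card_set_mult_normal[OF fin] N M by metis
    have "coprime p k" using M k(2) by auto
    then have prod: "?P (N <#> M)"
      using N M k(1) by (auto intro: normal_subgroup_set_mult_closed)
    interpret second_isomorphism_grp N G M
      using N M by (simp add: second_isomorphism_grp_def second_isomorphism_grp_axioms_def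
          normal_imp_subgroup)
    show ?thesis
      using prod max S_contained_in_set_mult H_contained_in_set_mult by metis
  qed
  have "p'_core p G = M" unfolding p'_core_def
    by (rule Greatest_equality) (use M great in auto)
  then show "p'_core p G \<lhd> G" "coprime p (card (p'_core p G))"
    "\<And>N. \<lbrakk>N \<lhd> G; coprime p (card N)\<rbrakk> \<Longrightarrow> N \<subseteq> p'_core p G"
    using M great by auto
qed

lemma (in group) p'_residual_least:
  assumes fin: "finite (carrier G)"
  shows "p'_residual p G \<lhd> G" "coprime p (card (rcosets (p'_residual p G)))"
    "\<And>N. \<lbrakk>N \<lhd> G; coprime p (card (rcosets N))\<rbrakk> \<Longrightarrow> p'_residual p G \<subseteq> N"
proof -
  let ?P = "\<lambda>N. N \<lhd> G \<and> coprime p (card (rcosets N))"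
  have "finite (Collect ?P)"
    by (rule finite_subset[of _ "Pow (carrier G)"])
      (auto simp: fin dest: normal_imp_subgroup subgroup.subset)
  moreover have "carrier G \<in> Collect ?P"
  proof -
    have "card (rcosets (carrier G)) * order G = order G"
      using lagrange[OF subgroup_self] by (simp add: order_def)
    then have "card (rcosets (carrier G)) = 1"
      using fin order_gt_0_iff_finite by simp
    then show ?thesis by (simp add: normal_self)
  qed
  ultimately obtain M where M: "?P M" and min: "\<And>N. ?P N \<Longrightarrow> N \<subseteq> M \<Longrightarrow> N = M"
    using finite_has_minimal[of "Collect ?P"] by (metis (no_types, lifting) empty_iff mem_Collect_eq)
  have least: "M \<subseteq> N" if N: "?P N" for N
  proof -
    obtain k where k: "card (N <#> M) = card N * k" "card M = card (N \<inter> M) * k"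
      using card_set_mult_normal[OF fin] N M by metis
    have nml: "N <#> M \<lhd> G" "N \<inter> M \<lhd> G"
      using N M normal_subgroup_set_mult_closed normal_subgroup_intersect by auto
    have lag: "card (rcosets K) * card K = order G" "card K > 0" if "K \<lhd> G" for K
    proof -
      show "card (rcosets K) * card K = order G"
        using that lagrange normal_imp_subgroup by blast
      then show "card K > 0"
        using fin order_gt_0_iff_finite by (metis mult_0_right neq0_conv)
    qed
    have "card (rcosets (N <#> M)) * k * card N = card (rcosets N) * card N"
      using lag[OF nml(1)] lag[of N] N k(1) by (simp add: ac_simps)
    then have "card (rcosets N) = card (rcosets (N <#> M)) * k"
      using lag(2)[of N] N by simp
    then have "coprime p k" using N by auto
    have "card (rcosets (N \<inter> M)) * card (N \<inter> M) = card (rcosets M) * k * card (N \<inter> M)"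
      using lag[OF nml(2)] lag[of M] M k(2) by (simp add: ac_simps)
    then have "card (rcosets (N \<inter> M)) = card (rcosets M) * k"
      using lag(2)[OF nml(2)] by simp
    with \<open>coprime p k\<close> M nml have "?P (N \<inter> M)" by simp
    then show ?thesis using min by blast
  qed
  have "p'_residual p G = M" unfolding p'_residual_def
    by (rule Least_equality) (use M least in auto)
  then show "p'_residual p G \<lhd> G" "coprime p (card (rcosets (p'_residual p G)))"
    "\<And>N. \<lbrakk>N \<lhd> G; coprime p (card (rcosets N))\<rbrakk> \<Longrightarrow> p'_residual p G \<subseteq> N"
    using M least by auto
qed

definition perfect :: "('a, 'b) monoid_scheme \<Rightarrow> bool"
  where "perfect G \<longleftrightarrow> derived G (carrier G) = carrier G"

definition quasisimple :: "('a, 'b) monoid_scheme \<Rightarrow> bool"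
  where "quasisimple G \<longleftrightarrow>
    perfect G \<and> simple_group (G Mod center G) \<and> \<not> comm_group (G Mod center G)"

end

theory Submission
  imports Defs "HOL-Algebra.Group_Action" "HOL-Algebra.Sylow" "HOL-Algebra.Zassenhaus"
    "HOL-Algebra.Multiplicative_Group" "HOL-Number_Theory.Cong"
begin

text \<open>If \<open>P\<close> has order \<open>p\<^sup>2\<close>, then \<open>x = 1\<close> satisfies (i). Otherwise let \<open>P\<close> have lower central
  terms \<open>P = \<gamma>\<^sub>1 > \<gamma>\<^sub>2 > \<dots> > \<gamma>\<^sub>n = 1\<close>, and call \<open>x \<in> P - \<gamma>\<^sub>2\<close> uniform if it lies in none of the two-step
  centralizers \<open>C\<^sub>P(\<gamma>\<^sub>d/\<gamma>\<^sub>d\<^sub>+\<^sub>2)\<close>, so that \<open>|C\<^sub>P(x)| = p\<^sup>2\<close>. These centralizers are maximal subgroups of \<open>P\<close>,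
  and by a weak form of a theorem of Blackburn there are so few of them that uniform elements exist
  outside any given maximal subgroup: if the first centralizer that differs from the previous ones has
  index \<open>m\<close>, then Jacobi identities show \<open>m = n - 2\<close> or \<open>2p \<le> m\<close>, and the latter is excluded by comparing
  \<open>p\<close>-th powers.

  If \<open>G\<close> has a normal subgroup \<open>M\<close> with \<open>|P : P \<inter> M| = p\<close>, take \<open>x\<close> uniform outside \<open>M\<close>. Fusion of \<open>x\<close> stays
  outside \<open>M\<close>, and an argument like that of Alperin's fusion theorem shows that all conjugates of \<open>x\<close> in
  \<open>P\<close> are uniform, which is (i). Otherwise every proper normal subgroup \<open>M\<close> satisfies \<open>P \<inter> M \<le> \<gamma>\<^sub>2\<close>, and
  Tate's theorem makes it a \<open>p\<close>-group. If such an \<open>M\<close> is not central, then \<open>C\<^sub>G(M)\<close> is a \<open>p\<close>-group as well;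
  a \<open>p\<close>-element commuting with a uniform \<open>x\<close> normalizes all \<open>M \<inter> \<gamma>\<^sub>d\<close>, and the stabilizer of this
  chain has \<open>P\<close> as a normal subgroup, so that again (i) holds. If all proper normal subgroups are
  central, then \<open>G\<close> is quasisimple.\<close>

section \<open>Commutators\<close>

text \<open>Everything rests on one property of a uniform \<open>x\<close>: taking the commutator
  with \<open>x\<close> raises each weight from 2 to \<open>n - 2\<close> by exactly one. Hence the
  weight of an element \<open>y\<close> of \<open>gam 2\<close> can be read off from that of
  \<open>[x, y]\<close>, which is why a \<open>p\<close>-element commuting with \<open>x\<close>
  respects weights. Uniformity depends only on the maximal subgroup of \<open>P\<close> containing
  \<open>x\<close>: outside \<open>gam 2\<close> two maximal subgroups never meet, and there are
  \<open>p + 1\<close> of them. For \<open>p = 2\<close> only two can be avoided at once, so there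
  all two-step centralizers must be shown to coincide. The obstacle in (i) is that a Sylow subgroup
  of the centralizer of \<open>x\<close> may lie in another Sylow subgroup of \<open>G\<close>,
  where \<open>x\<close> looks different. What controls this is that every proper subgroup of
  \<open>P\<close> containing \<open>x\<close> is trapped in the maximal subgroup containing
  \<open>x\<close>, because \<open>gam 2\<close> consists of nongenerators. Homomorphisms to a group
  of order \<open>p\<close> are kept as integer-valued functions that are additive modulo
  \<open>p\<close>, so that Jacobi identities and transfers become ordinary sums.\<close>

context group
begin

definition commutator :: "'a \<Rightarrow> 'a \<Rightarrow> 'a"
  where "commutator x y = x \<otimes> y \<otimes> inv x \<otimes> inv y"

lemma inv_cancel_left:
  assumes "x \<in> carrier G" "y \<in> carrier G"
  shows "inv x \<otimes> (x \<otimes> y) = y" "x \<otimes> (inv x \<otimes> y) = y"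
  using assms by (simp_all flip: m_assoc)

lemmas group_simps = m_assoc inv_mult_group inv_cancel_left

lemma commutator_closed [simp, intro]:
  "x \<in> carrier G \<Longrightarrow> y \<in> carrier G \<Longrightarrow> commutator x y \<in> carrier G"
  by (simp add: commutator_def)

lemma commutator_mult_left:
  assumes "x \<in> carrier G" "y \<in> carrier G" "z \<in> carrier G"
  shows "commutator (x \<otimes> y) z = x \<otimes> commutator y z \<otimes> inv x \<otimes> commutator x z"
  using assms by (simp add: commutator_def group_simps)

lemma commutator_mult_right:
  assumes "x \<in> carrier G" "y \<in> carrier G" "z \<in> carrier G"
  shows "commutator x (y \<otimes> z) = commutator x y \<otimes> (y \<otimes> commutator x z \<otimes> inv y)"
  using assms by (simp add: commutator_def group_simps)

lemma inv_commutator: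
  assumes "x \<in> carrier G" "y \<in> carrier G"
  shows "inv (commutator x y) = commutator y x"
  using assms by (simp add: commutator_def group_simps)

lemma commutator_inv_right:
  assumes "x \<in> carrier G" "y \<in> carrier G"
  shows "commutator x (inv y) = inv y \<otimes> inv (commutator x y) \<otimes> y"
  using assms by (simp add: commutator_def group_simps)

lemma conj_commutator:
  assumes "x \<in> carrier G" "y \<in> carrier G" "g \<in> carrier G"
  shows "g \<otimes> commutator x y \<otimes> inv g = commutator (g \<otimes> x \<otimes> inv g) (g \<otimes> y \<otimes> inv g)"
  using assms by (simp add: commutator_def group_simps)

lemma conj_eq_commutator:
  assumes "x \<in> carrier G" "g \<in> carrier G"
  shows "g \<otimes> x \<otimes> inv g = commutator g x \<otimes> x"
  using assms by (simp add: commutator_def group_simps)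

lemma commutator_eq_one_iff:
  assumes "x \<in> carrier G" "y \<in> carrier G"
  shows "commutator x y = \<one> \<longleftrightarrow> x \<otimes> y = y \<otimes> x"
proof -
  have "commutator x y = (x \<otimes> y) \<otimes> inv (y \<otimes> x)"
    using assms by (simp add: commutator_def group_simps)
  then show ?thesis
    using assms by (metis inv_closed inv_equality inv_inv m_closed r_inv)
qed

lemma commutator_self: "x \<in> carrier G \<Longrightarrow> commutator x x = \<one>"
  by (simp add: commutator_eq_one_iff)

text \<open>Modulo terms of higher weight the conjugations disappear, and what is left is the Jacobi
  identity of the graded Lie ring of the lower central series.\<close>

lemma hall_witt:
  assumes "x \<in> carrier G" "y \<in> carrier G" "z \<in> carrier G"
  shows "commutator (commutator x y) (y \<otimes> z \<otimes> inv y) \<otimes>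
    (commutator (commutator y z) (z \<otimes> x \<otimes> inv z) \<otimes>
     commutator (commutator z x) (x \<otimes> y \<otimes> inv x)) = \<one>"
  using assms by (simp add: commutator_def group_simps)

lemma normal_conj:
  assumes "N \<lhd> G" "x \<in> N" "g \<in> carrier G"
  shows "g \<otimes> x \<otimes> inv g \<in> N" "inv g \<otimes> x \<otimes> g \<in> N"
  by (rule normal.inv_op_closed2[OF assms(1,3,2)]) (rule normal.inv_op_closed1[OF assms(1,3,2)])

lemma normal_closed:
  assumes "N \<lhd> G"
  shows "\<one> \<in> N" "x \<in> N \<Longrightarrow> y \<in> N \<Longrightarrow> x \<otimes> y \<in> N" "x \<in> N \<Longrightarrow> inv x \<in> N" "x \<in> N \<Longrightarrow> x \<in> carrier G"
proof -
  interpret N: subgroup N G by (rule normal_imp_subgroup[OF assms])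
  show "\<one> \<in> N" "x \<in> N \<Longrightarrow> y \<in> N \<Longrightarrow> x \<otimes> y \<in> N" "x \<in> N \<Longrightarrow> inv x \<in> N" "x \<in> N \<Longrightarrow> x \<in> carrier G"
    by simp_all
qed

lemma normal_commutator:
  assumes "N \<lhd> G" "x \<in> N" "g \<in> carrier G"
  shows "commutator x g \<in> N" "commutator g x \<in> N"
proof -
  note c = normal_closed[OF assms(1)]
  have x: "x \<in> carrier G" by (rule c(4)[OF assms(2)])
  have "x \<otimes> (g \<otimes> inv x \<otimes> inv g) \<in> N"
    by (intro c(2) c(3) normal_conj(1) assms)
  moreover have "commutator x g = x \<otimes> (g \<otimes> inv x \<otimes> inv g)"
    using assms(3) x by (simp add: commutator_def group_simps)
  ultimately show 1: "commutator x g \<in> N" by simp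
  show "commutator g x \<in> N"
    using c(3)[OF 1] x assms(3) by (simp add: inv_commutator)
qed

text \<open>The centralizer of \<open>A\<close> modulo \<open>N\<close>. Closure uses normality of
  \<open>N\<close>, because commutators are multiplicative only up to conjugation. With
  \<open>N\<close> trivial or a lower central term this yields ordinary centralizers, the center and
  the two-step centralizers.\<close>

lemma subgroup_commutator_in:
  assumes N: "N \<lhd> G" and A: "A \<subseteq> carrier G"
  shows "subgroup {g \<in> carrier G. \<forall>a\<in>A. commutator a g \<in> N} G"
proof (rule subgroupI)
  note c = normal_closed[OF N]
  let ?S = "{g \<in> carrier G. \<forall>a\<in>A. commutator a g \<in> N}"
  have A': "a \<in> carrier G" if "a \<in> A" for a using A that by blast
  have "\<one> \<in> ?S" using A' c(1) by (simp add: commutator_def)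
  then show "?S \<noteq> {}" by blast
  show "inv g \<in> ?S" if g: "g \<in> ?S" for g
    using g A' by (simp add: commutator_inv_right normal_conj(2)[OF N] c(3))
  show "g \<otimes> h \<in> ?S" if "g \<in> ?S" "h \<in> ?S" for g h
    using that A' by (simp add: commutator_mult_right normal_conj(1)[OF N] c(2))
qed auto

lemma commutator_subgroup_eq_generate:
  "commutator_subgroup G H K = generate G {commutator h k | h k. h \<in> H \<and> k \<in> K}"
  unfolding commutator_subgroup_def commutator_def ..

lemma commutator_subgroup_minimal:
  assumes "subgroup N G" "\<And>h k. h \<in> H \<Longrightarrow> k \<in> K \<Longrightarrow> commutator h k \<in> N"
  shows "commutator_subgroup G H K \<subseteq> N"
  unfolding commutator_subgroup_eq_generate
  by (rule generate_subgroup_incl) (use assms in auto)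

lemma commutator_in_commutator_subgroup:
  "h \<in> H \<Longrightarrow> k \<in> K \<Longrightarrow> commutator h k \<in> commutator_subgroup G H K"
  unfolding commutator_subgroup_eq_generate by (auto intro: generate.incl)

lemma commutator_subgroup_normal:
  assumes "H \<lhd> G"
  shows "commutator_subgroup G H (carrier G) \<lhd> G"
  unfolding commutator_subgroup_eq_generate
proof (rule normal_generateI)
  show "{commutator h k |h k. h \<in> H \<and> k \<in> carrier G} \<subseteq> carrier G"
    using normal_closed[OF assms] by auto
next
  fix x g assume "x \<in> {commutator h k |h k. h \<in> H \<and> k \<in> carrier G}" and g: "g \<in> carrier G"
  then obtain h k where "x = commutator h k" "h \<in> H" "k \<in> carrier G" by auto
  then show "g \<otimes> x \<otimes> inv g \<in> {commutator h k |h k. h \<in> H \<and> k \<in> carrier G}"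
    using g conj_commutator[of h k g] normal_closed(4)[OF assms] normal_conj(1)[OF assms, of h g]
    by auto
qed

lemma lower_central_normal: "lower_central G i \<lhd> G"
  by (induction i) (simp_all add: normal_self commutator_subgroup_normal)

lemma lower_central_Suc_subset: "lower_central G (Suc i) \<subseteq> lower_central G i"
  unfolding lower_central.simps
  by (rule commutator_subgroup_minimal[OF normal_imp_subgroup[OF lower_central_normal]])
    (rule normal_commutator(1)[OF lower_central_normal])

end

section \<open>Finite p-groups and Sylow's theorems\<close>

context group
begin

lemma card_subgroup_dvd:
  assumes "subgroup A G" "subgroup B G" "A \<subseteq> B"
  shows "card A dvd card B"
proof -
  have "subgroup A (G\<lparr>carrier := B\<rparr>)" using assms subgroup_incl by blast
  then have "card (rcosets\<^bsub>G\<lparr>carrier := B\<rparr>\<^esub> A) * card A = card B"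
    using group.lagrange[OF subgroup_imp_group[OF assms(2)]] by (simp add: order_def)
  then show ?thesis by (metis dvd_triv_right)
qed

lemma finite_subgroup: "finite (carrier G) \<Longrightarrow> subgroup A G \<Longrightarrow> finite A"
  using finite_subset subgroup.subset by blast

lemma card_subgroup_pos: "finite (carrier G) \<Longrightarrow> subgroup A G \<Longrightarrow> card A > 0"
  using finite_subgroup subgroup.one_closed card_gt_0_iff by blast

lemma card_subgroup_prime_power:
  assumes "Factorial_Ring.prime p" "subgroup A G" "subgroup B G" "A \<subseteq> B" "card B = p ^ k"
  obtains i where "i \<le> k" "card A = p ^ i"
  using card_subgroup_dvd[OF assms(2-4)] assms(1,5) divides_primepow_nat by metis

lemma subgroup_between_prime_index:
  assumes "Factorial_Ring.prime p" "finite (carrier G)"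
    and "subgroup A G" "subgroup B G" "subgroup C G" "A \<subseteq> C" "C \<subseteq> B" "card B = p * card A"
  shows "C = A \<or> C = B"
proof -
  obtain k where k: "card C = card A * k"
    using card_subgroup_dvd[OF assms(3,5,6)] by (auto elim: dvdE)
  have "card A > 0" using card_subgroup_pos assms by blast
  moreover have "card C dvd card B" using card_subgroup_dvd assms by blast
  ultimately have "k dvd p" using k assms(8) by (simp add: mult.commute)
  then have "k = 1 \<or> k = p" using assms(1) prime_nat_iff by blast
  then have "card C = card A \<or> card C = card B" using k assms(8) by auto
  then show ?thesis
    using assms(6,7) finite_subgroup[OF assms(2)] assms(4,5) card_subset_eq by metis
qed

text \<open>\<open>e\<close> is a discrete logarithm to a generator \<open>w\<close>. Its values
  stay integers and only congruences are asserted, so that sums over finite sets, signs and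
  divisibility by a prime can be handled in \<open>int\<close>.\<close>

lemma prime_order_log:
  assumes "Factorial_Ring.prime p" "order G = p"
  obtains e :: "'a \<Rightarrow> int"
  where "\<And>x y. x \<in> carrier G \<Longrightarrow> y \<in> carrier G \<Longrightarrow> [e (x \<otimes> y) = e x + e y] (mod int p)"
    and "\<And>x. x \<in> carrier G \<Longrightarrow> int p dvd e x \<longleftrightarrow> x = \<one>"
proof -
  have fin: "finite (carrier G)"
    using assms order_gt_0_iff_finite prime_gt_0_nat by metis
  have "order G \<noteq> 1" using assms prime_gt_1_nat by fastforce
  then have "carrier G \<noteq> {\<one>}" by (auto simp: order_def)
  then obtain w where w: "w \<in> carrier G" "w \<noteq> \<one>" using one_closed by blast
  have "ord w dvd p" using ord_dvd_group_order[OF w(1)] assms(2) by simp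
  then have ordw: "ord w = p"
    using assms(1) ord_eq_1[OF w(1)] w(2) prime_nat_iff by blast
  have "generate G {w} \<subseteq> carrier G" using w generate_in_carrier by blast
  moreover have "card (generate G {w}) = card (carrier G)"
    using generate_pow_card[OF w(1)] ordw assms(2) by (simp add: order_def)
  ultimately have "generate G {w} = carrier G" using fin card_subset_eq by blast
  then have ex: "\<exists>i::int. x = w [^] i" if "x \<in> carrier G" for x
    using that generate_pow[OF w(1)] by auto
  define e where "e x = (SOME i::int. x = w [^] i)" for x
  have e: "x = w [^] e x" if "x \<in> carrier G" for x
    unfolding e_def using someI_ex[OF ex[OF that]] .
  have "[e (x \<otimes> y) = e x + e y] (mod int p)" if "x \<in> carrier G" "y \<in> carrier G" for x y
  proof -
    have "w [^] e (x \<otimes> y) = w [^] (e x + e y)"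
      using e[OF that(1)] e[OF that(2)] e[of "x \<otimes> y"] that w by (simp add: int_pow_mult)
    then show ?thesis
      using int_pow_eq[OF w(1)] ordw by (simp add: cong_iff_dvd_diff cong_sym_eq dvd_diff_commute)
  qed
  moreover have "int p dvd e x \<longleftrightarrow> x = \<one>" if "x \<in> carrier G" for x
    using int_pow_eq_id[OF w(1), of "e x"] e[OF that] ordw by simp
  ultimately show thesis using that by blast
qed

lemma prime_index_log:
  assumes "Factorial_Ring.prime p" "finite (carrier G)"
    and "A \<lhd> G\<lparr>carrier := B\<rparr>" "subgroup B G" "card B = p * card A"
  obtains e :: "'a \<Rightarrow> int"
  where "\<And>x y. x \<in> B \<Longrightarrow> y \<in> B \<Longrightarrow> [e (x \<otimes> y) = e x + e y] (mod int p)"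
    and "\<And>x. x \<in> B \<Longrightarrow> int p dvd e x \<longleftrightarrow> x \<in> A"
proof -
  interpret B: group "G\<lparr>carrier := B\<rparr>" using subgroup_imp_group[OF assms(4)] .
  interpret A: normal A "G\<lparr>carrier := B\<rparr>" by (rule assms(3))
  let ?Q = "G\<lparr>carrier := B\<rparr> Mod A"
  interpret Q: group ?Q by (rule A.factorgroup_is_group)
  have "A \<subseteq> B" using A.subset by simp
  have finB: "finite B" by (rule finite_subgroup[OF assms(2,4)])
  then have "finite A" using \<open>A \<subseteq> B\<close> finite_subset by blast
  then have "card A > 0" using A.one_closed card_gt_0_iff by blast
  moreover have "order ?Q * card A = card B"
    using B.lagrange[OF A.is_subgroup] by (simp add: order_def FactGroup_def)
  ultimately have ord: "order ?Q = p" using assms(5) by simp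
  obtain e :: "'a set \<Rightarrow> int"
    where e: "\<And>x y. x \<in> carrier ?Q \<Longrightarrow> y \<in> carrier ?Q \<Longrightarrow> [e (x \<otimes>\<^bsub>?Q\<^esub> y) = e x + e y] (mod int p)"
      "\<And>x. x \<in> carrier ?Q \<Longrightarrow> int p dvd e x \<longleftrightarrow> x = \<one>\<^bsub>?Q\<^esub>"
    using Q.prime_order_log[OF assms(1) ord] by blast
  let ?c = "\<lambda>x. A #>\<^bsub>G\<lparr>carrier := B\<rparr>\<^esub> x"
  have c: "?c x \<in> carrier ?Q" if "x \<in> B" for x using that by (auto simp: carrier_FactGroup)
  have "[e (?c (x \<otimes> y)) = e (?c x) + e (?c y)] (mod int p)" if "x \<in> B" "y \<in> B" for x y
    using e(1)[OF c[OF that(1)] c[OF that(2)]] A.rcos_sum[of x y] that by simp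
  moreover have "int p dvd e (?c x) \<longleftrightarrow> x \<in> A" if "x \<in> B" for x
  proof -
    have "?c x = A \<longleftrightarrow> x \<in> A"
      using B.coset_join1[OF _ _ A.is_subgroup, of x] B.coset_join2[OF _ A.is_subgroup, of x] that
      by auto
    then show ?thesis using e(2)[OF c[OF that]] by simp
  qed
  ultimately show thesis using that[of "\<lambda>x. e (?c x)"] by blast
qed

lemma log_subgroup:
  fixes f :: "'a \<Rightarrow> int"
  assumes "subgroup C G"
    and hom: "\<And>x y. x \<in> C \<Longrightarrow> y \<in> C \<Longrightarrow> [f (x \<otimes> y) = f x + f y] (mod int p)"
  shows "subgroup {x \<in> C. int p dvd f x} G"
    and "x \<in> C \<Longrightarrow> [f (inv x) = - f x] (mod int p)"
    and "int p dvd f \<one>"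
    and "x \<in> C \<Longrightarrow> [f (x [^] (k::nat)) = int k * f x] (mod int p)"
proof -
  interpret C: subgroup C G by (rule assms(1))
  have one: "int p dvd f \<one>" using hom[of \<one> \<one>] by (simp add: cong_iff_dvd_diff)
  then show "int p dvd f \<one>" .
  show inv: "[f (inv x) = - f x] (mod int p)" if "x \<in> C" for x
  proof -
    have "[f \<one> = f x + f (inv x)] (mod int p)" using hom[of x "inv x"] that by simp
    then have "int p dvd f \<one> - (f x + f (inv x))" by (simp add: cong_iff_dvd_diff)
    then have "int p dvd f \<one> - (f \<one> - (f x + f (inv x)))" using one by (rule dvd_diff[rotated])
    then show ?thesis by (simp add: cong_iff_dvd_diff add.commute)
  qed
  have dvd: "int p dvd f x" if "[f x = a] (mod int p)" "int p dvd a" for x a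
    using cong_dvd_iff[OF that(1)] that(2) by simp
  show "subgroup {x \<in> C. int p dvd f x} G"
  proof (rule subgroupI)
    show "{x \<in> C. int p dvd f x} \<noteq> {}" using one C.one_closed by blast
    show "inv x \<in> {x \<in> C. int p dvd f x}" if "x \<in> {x \<in> C. int p dvd f x}" for x
      using that dvd[OF inv] by simp
    show "x \<otimes> y \<in> {x \<in> C. int p dvd f x}" if "x \<in> {x \<in> C. int p dvd f x}" "y \<in> {x \<in> C. int p dvd f x}" for x y
      using that dvd[OF hom] by simp
  qed (use C.subset in auto)
  show "[f (x [^] (k::nat)) = int k * f x] (mod int p)" if x: "x \<in> C" for k x
  proof (induction k)
    case 0
    then show ?case using one by (simp add: cong_0_iff)
  next
    case (Suc k)
    have "x [^] k \<in> C" using x C.subset subgroup_int_pow_closed[OF assms(1), of x "int k"] by (simp add: int_pow_int)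
    then have "[f (x [^] Suc k) = f (x [^] k) + f x] (mod int p)" using hom x by simp
    also have "[f (x [^] k) + f x = int k * f x + f x] (mod int p)" using Suc by (rule cong_add) simp
    finally show ?case by (simp add: algebra_simps)
  qed
qed

lemma card_le_log_kernel:
  fixes f :: "'a \<Rightarrow> int"
  assumes "p > 0" "finite (carrier G)" "subgroup C G"
    and hom: "\<And>x y. x \<in> C \<Longrightarrow> y \<in> C \<Longrightarrow> [f (x \<otimes> y) = f x + f y] (mod int p)"
  shows "card C \<le> p * card {x \<in> C. int p dvd f x}"
proof -
  let ?K = "{x \<in> C. int p dvd f x}"
  interpret C: group "G\<lparr>carrier := C\<rparr>" using subgroup_imp_group[OF assms(3)] .
  have K1: "subgroup ?K G" by (rule log_subgroup(1)[OF assms(3)]) (rule hom)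
  have K2: "[f (inv x) = - f x] (mod int p)" if "x \<in> C" for x
    by (rule log_subgroup(2)[OF assms(3) _ that]) (rule hom)
  have KC: "subgroup ?K (G\<lparr>carrier := C\<rparr>)" using K1 subgroup_incl assms(3) by blast
  \<comment> \<open>The residue of \<open>f\<close> at an arbitrary representative separates the
    cosets of the kernel, so there are at most \<open>p\<close> of them.\<close>
  have "inj_on (\<lambda>X. f (SOME x. x \<in> X) mod int p) (rcosets\<^bsub>G\<lparr>carrier := C\<rparr>\<^esub> ?K)"
  proof (rule inj_onI)
    fix X Y assume X: "X \<in> rcosets\<^bsub>G\<lparr>carrier := C\<rparr>\<^esub> ?K" and Y: "Y \<in> rcosets\<^bsub>G\<lparr>carrier := C\<rparr>\<^esub> ?K"
      and eq: "f (SOME x. x \<in> X) mod int p = f (SOME x. x \<in> Y) mod int p"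
    define x y where "x = (SOME x. x \<in> X)" and "y = (SOME x. x \<in> Y)"
    have nonempty: "X \<noteq> {}" "Y \<noteq> {}" using subgroup.rcosets_non_empty[OF KC] X Y by auto
    have x: "x \<in> X" and y: "y \<in> Y"
      unfolding x_def y_def using nonempty by (simp_all add: some_in_eq)
    have xyC: "x \<in> C" "y \<in> C"
      using subgroup.rcosets_carrier[OF KC C.is_group X] subgroup.rcosets_carrier[OF KC C.is_group Y] x y
      by auto
    have "[f (x \<otimes> inv y) = f x + f (inv y)] (mod int p)"
      using hom[of x "inv y"] xyC subgroup.m_inv_closed[OF assms(3)] by simp
    also have "[f x + f (inv y) = f x + - f y] (mod int p)"
      using K2[OF xyC(2)] by (intro cong_add) auto
    finally have "int p dvd f (x \<otimes> inv y)"
      using cong_dvd_iff[of "f (x \<otimes> inv y)" "f x - f y" "int p"] eq[folded x_def y_def] mod_eq_dvd_iff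
      by (metis add_uminus_conv_diff)
    then have "x \<otimes> inv y \<in> ?K"
      using xyC subgroup.m_inv_closed[OF assms(3)] subgroup.m_closed[OF assms(3)] by simp
    then have "x \<in> ?K #>\<^bsub>G\<lparr>carrier := C\<rparr>\<^esub> y"
      using subgroup.rcos_module_rev[OF KC C.is_group, of y x] xyC assms(3) by simp
    moreover have "?K #>\<^bsub>G\<lparr>carrier := C\<rparr>\<^esub> y = Y"
    proof -
      obtain g where g: "g \<in> C" "Y = ?K #>\<^bsub>G\<lparr>carrier := C\<rparr>\<^esub> g"
        using Y unfolding RCOSETS_def by auto
      then show ?thesis using C.repr_independence[OF _ _ KC, of y g] y by simp
    qed
    ultimately have "x \<in> Y" by simp
    then show "X = Y"
      using pairwiseD[OF C.rcos_disjoint[OF KC] X Y] x by (auto simp: disjnt_iff)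
  qed
  moreover have "(\<lambda>X. f (SOME x. x \<in> X) mod int p) ` (rcosets\<^bsub>G\<lparr>carrier := C\<rparr>\<^esub> ?K) \<subseteq> {0..<int p}"
    using assms(1) by auto
  ultimately have le: "card (rcosets\<^bsub>G\<lparr>carrier := C\<rparr>\<^esub> ?K) \<le> p"
    using card_inj_on_le[OF _ _ finite_atLeastLessThan_int] by fastforce
  have "card (rcosets\<^bsub>G\<lparr>carrier := C\<rparr>\<^esub> ?K) * card ?K = card C"
    using C.lagrange[OF KC] by (simp add: order_def)
  then show ?thesis using mult_le_mono1[OF le, of "card ?K"] by simp
qed

end

section \<open>Counting fixed points modulo p\<close>

lemma (in group_action) card_cong_fixed_points:
  assumes "Factorial_Ring.prime p" "order G = p ^ k" "finite E"
  shows "[card E = card {x \<in> E. \<forall>g\<in>carrier G. \<phi> g x = x}] (mod p)"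
proof -
  let ?F = "{x \<in> E. \<forall>g\<in>carrier G. \<phi> g x = x}"
  \<comment> \<open>\<open>?f\<close> marks the points that are moved, so its sum over an orbit is 0
    or the length of a nontrivial orbit, a multiple of \<open>p\<close>.\<close>
  let ?f = "\<lambda>x. if x \<in> ?F then 0 else 1::nat"
  have orb: "p dvd (\<Sum>x\<in>orb. ?f x)" if orb: "orb \<in> orbits G E \<phi>" for orb
  proof -
    obtain x where x: "x \<in> E" "orb = orbit G \<phi> x" using orb unfolding orbits_def by blast
    show ?thesis
    proof (cases "x \<in> ?F")
      case True
      then have "orb \<subseteq> {x}" unfolding x(2) orbit_def by auto
      with True show ?thesis by (intro dvd_sum) auto
    next
      case False
      have nf: "y \<notin> ?F" if "y \<in> orb" for y
      proof
        assume y: "y \<in> ?F"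
        have "x \<in> orbit G \<phi> y" using orbit_sym[of x y] that x y by blast
        then have "x = y" using y unfolding orbit_def by auto
        then show False using False y by blast
      qed
      have "(\<Sum>x\<in>orb. ?f x) = (\<Sum>x\<in>orb. 1)" by (rule sum.cong) (use nf in auto)
      then have "(\<Sum>x\<in>orb. ?f x) = card orb" by simp
      moreover have "p dvd card orb"
      proof -
        have "card orb dvd p ^ k"
          using orbit_stabilizer_theorem[OF x(1)] assms(2) x(2) by (metis dvd_triv_left)
        then obtain i where i: "card orb = p ^ i" using assms(1) divides_primepow_nat by metis
        have "i \<noteq> 0"
        proof
          assume "i = 0"
          then obtain y where "orb = {y}" using i card_1_singletonE by auto
          moreover have "x \<in> orb" using orbit_refl x by simp
          ultimately have "orb = {x}" by blast
          then have "\<phi> g x = x" if "g \<in> carrier G" for g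
            using that x(2) unfolding orbit_def by blast
          then show False using False x(1) by blast
        qed
        then show ?thesis using i by simp
      qed
      ultimately show ?thesis by simp
    qed
  qed
  have "card E = card ?F + card (E - ?F)"
    using assms(3) by (subst card_Un_disjoint[symmetric]) (auto intro: arg_cong[where f = card])
  moreover have "card (E - ?F) = (\<Sum>x\<in>E. ?f x)"
  proof -
    have "(\<Sum>x\<in>E. ?f x) = (\<Sum>x\<in>E - ?F. ?f x)"
      using assms(3) by (intro sum.mono_neutral_right) auto
    also have "\<dots> = (\<Sum>x\<in>E - ?F. 1)" by (rule sum.cong) auto
    finally show ?thesis by simp
  qed
  moreover have "(\<Sum>x\<in>E. ?f x) = (\<Sum>orb\<in>orbits G E \<phi>. \<Sum>x\<in>orb. ?f x)"
    by (rule disjoint_sum[OF assms(3), symmetric])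
  moreover have "p dvd (\<Sum>orb\<in>orbits G E \<phi>. \<Sum>x\<in>orb. ?f x)"
    using orb by (rule dvd_sum)
  ultimately have "p dvd card (E - ?F)" by simp
  with \<open>card E = card ?F + card (E - ?F)\<close> show ?thesis by (auto simp: cong_def elim!: dvdE)
qed

lemma p_part_cofactor:
  assumes "Factorial_Ring.prime p" "n > 0" "n = m * p_part p n"
  shows "\<not> p dvd m"
proof -
  have "m = n div p ^ multiplicity p n"
    using assms prime_gt_0_nat[OF assms(1)] unfolding p_part_def
    by (metis nonzero_mult_div_cancel_right power_not_zero less_numeral_extra(3))
  then show ?thesis
    using multiplicity_decompose[of n p] assms(1,2) prime_gt_1_nat[OF assms(1)] by auto
qed

section \<open>Actions on cosets, conjugation and Sylow subgroups\<close>

context group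
begin

text \<open>The inverse turns multiplication on the right into a left action; the restriction is
  forced by \<open>Bij\<close>, whose members are extensional.\<close>

lemma right_coset_action:
  assumes "subgroup H G" "subgroup Q G"
  shows "group_action (G\<lparr>carrier := Q\<rparr>) (rcosets H) (\<lambda>q. \<lambda>X\<in>rcosets H. X #> inv q)"
proof -
  interpret Q: group "G\<lparr>carrier := Q\<rparr>" using subgroup_imp_group[OF assms(2)] .
  interpret H: subgroup H G by (rule assms(1))
  have Qc: "q \<in> carrier G" if "q \<in> Q" for q using subgroup.mem_carrier[OF assms(2) that] .
  have mem: "X #> g \<in> rcosets H" if "X \<in> rcosets H" "g \<in> carrier G" for X g
  proof -
    obtain a where "a \<in> carrier G" "X = H #> a" using \<open>X \<in> rcosets H\<close> unfolding RCOSETS_def by auto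
    then show ?thesis using coset_mult_assoc[OF H.subset] that(2) rcosetsI[OF H.subset] by simp
  qed
  have sub: "X \<subseteq> carrier G" if "X \<in> rcosets H" for X
    using rcosets_part_G[OF assms(1)] that by blast
  let ?f = "\<lambda>q. \<lambda>X\<in>rcosets H. X #> inv q"
  have comp: "compose (rcosets H) (?f q) (?f r) = ?f (q \<otimes> r)" if "q \<in> Q" "r \<in> Q" for q r
    using Qc[OF that(1)] Qc[OF that(2)] mem sub
    by (auto simp: compose_def fun_eq_iff restrict_def coset_mult_assoc inv_mult_group)
  have one: "?f \<one> = (\<lambda>X\<in>rcosets H. X)"
    using sub by (auto simp: fun_eq_iff restrict_def)
  have bij: "?f q \<in> Bij (rcosets H)" if "q \<in> Q" for q
  proof -
    have q': "inv q \<in> Q" using that subgroup.m_inv_closed[OF assms(2)] by blast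
    have "bij_betw (?f q) (rcosets H) (rcosets H)"
    proof (rule bij_betw_byWitness[where f' = "?f (inv q)"])
      show "\<forall>X\<in>rcosets H. ?f (inv q) (?f q X) = X"
        using mem sub Qc[OF that] by (simp add: coset_mult_assoc)
      show "\<forall>X\<in>rcosets H. ?f q (?f (inv q) X) = X"
        using mem sub Qc[OF that] by (simp add: coset_mult_assoc)
    qed (use mem Qc[OF that] in auto)
    then show ?thesis by (simp add: Bij_def)
  qed
  have "?f \<in> hom (G\<lparr>carrier := Q\<rparr>) (BijGroup (rcosets H))"
    using bij comp by (auto simp: hom_def BijGroup_def)
  then show ?thesis
    unfolding group_action_def group_hom_def group_hom_axioms_def
    using Q.is_group group_BijGroup by blast
qed

lemma fixed_right_coset:
  assumes "subgroup H G" "g \<in> carrier G" "q \<in> carrier G" "H #> g #> inv q = H #> g"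
  shows "g \<otimes> q \<otimes> inv g \<in> H"
proof -
  have "g \<in> H #> (g \<otimes> inv q)"
    using assms rcos_self[OF assms(2,1)] subgroup.subset[OF assms(1)] by (simp add: coset_mult_assoc)
  then have "g \<otimes> inv (g \<otimes> inv q) \<in> H"
    using subgroup.rcos_module_imp[OF assms(1) is_group, of "g \<otimes> inv q" g] assms by simp
  then show ?thesis using assms by (simp add: inv_mult_group m_assoc)
qed

definition conj_set :: "'a \<Rightarrow> 'a set \<Rightarrow> 'a set"
  where "conj_set g A = (\<lambda>x. g \<otimes> x \<otimes> inv g) ` A"

lemma conj_inv_cancel:
  assumes "g \<in> carrier G" "x \<in> carrier G"
  shows "inv g \<otimes> (g \<otimes> x \<otimes> inv g) \<otimes> g = x" "g \<otimes> (inv g \<otimes> x \<otimes> g) \<otimes> inv g = x"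
  using assms by (simp_all add: group_simps)

lemma conj_mult:
  assumes "g \<in> carrier G" "x \<in> carrier G" "y \<in> carrier G"
  shows "g \<otimes> (x \<otimes> y) \<otimes> inv g = (g \<otimes> x \<otimes> inv g) \<otimes> (g \<otimes> y \<otimes> inv g)"
  using assms by (simp add: group_simps)

lemma mem_conj_set_iff:
  assumes "g \<in> carrier G" "A \<subseteq> carrier G" "x \<in> carrier G"
  shows "x \<in> conj_set g A \<longleftrightarrow> inv g \<otimes> x \<otimes> g \<in> A"
proof
  assume "x \<in> conj_set g A"
  then show "inv g \<otimes> x \<otimes> g \<in> A"
    unfolding conj_set_def using assms conj_inv_cancel(1)[OF assms(1)] by auto
next
  assume "inv g \<otimes> x \<otimes> g \<in> A"
  then show "x \<in> conj_set g A"
    unfolding conj_set_def using conj_inv_cancel(2)[OF assms(1,3)] by (metis image_eqI)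
qed

lemma inj_on_conj: "g \<in> carrier G \<Longrightarrow> A \<subseteq> carrier G \<Longrightarrow> inj_on (\<lambda>x. g \<otimes> x \<otimes> inv g) A"
  using conj_inv_cancel(1) by (intro inj_onI) (metis subsetD)

lemma card_conj_set: "g \<in> carrier G \<Longrightarrow> A \<subseteq> carrier G \<Longrightarrow> card (conj_set g A) = card A"
  unfolding conj_set_def by (rule card_image) (rule inj_on_conj)

lemma conj_set_subgroup:
  assumes "g \<in> carrier G" "subgroup A G"
  shows "subgroup (conj_set g A) G"
proof -
  have "(\<lambda>x. g \<otimes> x \<otimes> inv g) \<in> hom G G" using assms(1) by (auto simp: hom_def conj_mult)
  then show ?thesis unfolding conj_set_def
    using group_hom.subgroup_img_is_subgroup[of G G _ A] assms(2) is_group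
    by (simp add: group_hom_def group_hom_axioms_def)
qed

lemma conj_set_conj_set:
  assumes "g \<in> carrier G" "h \<in> carrier G" "A \<subseteq> carrier G"
  shows "conj_set g (conj_set h A) = conj_set (g \<otimes> h) A"
  unfolding conj_set_def image_image
  using assms by (intro image_cong) (auto simp: group_simps subset_iff)

lemma conj_set_one: "A \<subseteq> carrier G \<Longrightarrow> conj_set \<one> A = A"
  unfolding conj_set_def by (auto simp: subset_iff image_iff)

lemma conj_set_inv_swap:
  assumes "g \<in> carrier G" "A \<subseteq> carrier G"
  shows "conj_set (inv g) (conj_set g A) = A"
  using assms by (simp add: conj_set_conj_set conj_set_one)

lemma conj_set_mono: "A \<subseteq> B \<Longrightarrow> conj_set g A \<subseteq> conj_set g B"
  unfolding conj_set_def by (rule image_mono)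

text \<open>\<open>Q\<close> acts on the cosets of \<open>S\<close>, whose number is prime to
  \<open>p\<close>. A fixed coset \<open>S #> g\<close> means that \<open>g\<close> conjugates
  \<open>Q\<close> into \<open>S\<close>.\<close>

lemma sylow_conjugate:
  assumes "Factorial_Ring.prime p" "finite (carrier G)"
    and "subgroup S G" "card S = p_part p (order G)"
    and "subgroup Q G" "card Q = p ^ k"
  obtains g where "g \<in> carrier G" "conj_set g Q \<subseteq> S"
proof -
  interpret group_action "G\<lparr>carrier := Q\<rparr>" "rcosets S" "\<lambda>q. \<lambda>X\<in>rcosets S. X #> inv q"
    by (rule right_coset_action[OF assms(3,5)])
  have pos: "order G > 0" using assms(2) order_gt_0_iff_finite by blast
  have "order G = card (rcosets S) * p ^ multiplicity p (order G)"
    using lagrange[OF assms(3)] assms(4) by (simp add: p_part_def)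
  then have "\<not> p dvd card (rcosets S)"
    using p_part_cofactor[OF assms(1) pos] by (simp add: p_part_def)
  moreover have "[card (rcosets S) = card {X \<in> rcosets S. \<forall>q\<in>carrier (G\<lparr>carrier := Q\<rparr>). (\<lambda>X\<in>rcosets S. X #> inv q) X = X}] (mod p)"
    by (rule card_cong_fixed_points[OF assms(1), of k])
      (use assms rcosets_part_G[OF assms(3)] in \<open>auto simp: order_def intro: finite_UnionD\<close>)
  ultimately have "{X \<in> rcosets S. \<forall>q\<in>carrier (G\<lparr>carrier := Q\<rparr>). (\<lambda>X\<in>rcosets S. X #> inv q) X = X} \<noteq> {}"
    by (metis card.empty cong_0_iff)
  then obtain X where X: "X \<in> rcosets S" "\<forall>q\<in>Q. X #> inv q = X" by auto
  then obtain g where g: "g \<in> carrier G" "X = S #> g" unfolding RCOSETS_def by auto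
  have "g \<otimes> q \<otimes> inv g \<in> S" if "q \<in> Q" for q
    using fixed_right_coset[OF assms(3) g(1)] X(2) g(2) that subgroup.mem_carrier[OF assms(5) that] by blast
  then show thesis using that[OF g(1)] unfolding conj_set_def by blast
qed

text \<open>\<open>D\<close> acts on its own cosets in \<open>R\<close>. Their number is divisible
  by \<open>p\<close> and the coset \<open>D\<close> is fixed, so another coset
  \<open>D #> g\<close> is fixed as well, and such a \<open>g\<close> normalizes
  \<open>D\<close>.\<close>

lemma normalizer_grows:
  assumes "Factorial_Ring.prime p" "finite (carrier G)"
    and "subgroup D G" "subgroup R G" "D \<subset> R" "card R = p ^ k"
  obtains g where "g \<in> R" "g \<notin> D" "conj_set g D = D"
proof -
  interpret R: group "G\<lparr>carrier := R\<rparr>" using subgroup_imp_group[OF assms(4)] .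
  have DR: "subgroup D (G\<lparr>carrier := R\<rparr>)" using subgroup_incl assms(3-5) by blast
  interpret group_action "G\<lparr>carrier := R\<rparr>\<lparr>carrier := D\<rparr>" "rcosets\<^bsub>G\<lparr>carrier := R\<rparr>\<^esub> D"
    "\<lambda>q. \<lambda>X\<in>rcosets\<^bsub>G\<lparr>carrier := R\<rparr>\<^esub> D. X #>\<^bsub>G\<lparr>carrier := R\<rparr>\<^esub> inv\<^bsub>G\<lparr>carrier := R\<rparr>\<^esub> q"
    by (rule R.right_coset_action[OF DR DR])
  let ?C = "rcosets\<^bsub>G\<lparr>carrier := R\<rparr>\<^esub> D"
  let ?F = "{X \<in> ?C. \<forall>q\<in>carrier (G\<lparr>carrier := R\<rparr>\<lparr>carrier := D\<rparr>).
     (\<lambda>X\<in>?C. X #>\<^bsub>G\<lparr>carrier := R\<rparr>\<^esub> inv\<^bsub>G\<lparr>carrier := R\<rparr>\<^esub> q) X = X}"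
  have finR: "finite R" by (rule finite_subgroup[OF assms(2,4)])
  obtain i where i: "i \<le> k" "card D = p ^ i"
    using card_subgroup_prime_power[OF assms(1,3,4) _ assms(6)] assms(5) by blast
  have "card D < card R" using psubset_card_mono[OF finR assms(5)] .
  then have "i < k" using i assms(6) by (metis le_neq_implies_less nat_less_le)
  have "card ?C * p ^ i = p ^ k" using R.lagrange[OF DR] i assms(6) by (simp add: order_def)
  also have "p ^ k = p ^ (k - i) * p ^ i" using \<open>i < k\<close> by (simp flip: power_add)
  finally have "card ?C = p ^ (k - i)" using prime_gt_0_nat[OF assms(1)] by simp
  then have "p dvd card ?C" using \<open>i < k\<close> by simp
  moreover have finC: "finite ?C"
    using finR R.rcosets_part_G[OF DR] by (intro finite_UnionD) simp
  have "[card ?C = card ?F] (mod p)"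
    by (rule card_cong_fixed_points[OF assms(1), of i, OF _ finC]) (simp add: order_def i)
  ultimately have "p dvd card ?F" using cong_dvd_iff by blast
  moreover have DF: "D \<in> ?F"
  proof -
    have "D \<in> ?C" using subgroup.subgroup_in_rcosets[OF DR R.is_group] .
    moreover have "D #>\<^bsub>G\<lparr>carrier := R\<rparr>\<^esub> inv\<^bsub>G\<lparr>carrier := R\<rparr>\<^esub> q = D" if "q \<in> D" for q
      using R.coset_join2[OF _ DR, of "inv\<^bsub>G\<lparr>carrier := R\<rparr>\<^esub> q"] subgroup.m_inv_closed[OF DR that] subgroup.mem_carrier[OF DR]
      by blast
    ultimately show ?thesis by simp
  qed
  ultimately have "card ?F \<noteq> 1" using prime_gt_1_nat[OF assms(1)] by (metis nat_dvd_1_iff_1 less_irrefl)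
  then have "?F \<noteq> {D}" by (metis is_singletonI is_singleton_altdef)
  then obtain X where "X \<in> ?F" "X \<noteq> D" using DF by blast
  then have X: "X \<in> ?C" "X \<noteq> D" "\<And>q. q \<in> D \<Longrightarrow> X #>\<^bsub>G\<lparr>carrier := R\<rparr>\<^esub> inv\<^bsub>G\<lparr>carrier := R\<rparr>\<^esub> q = X" by auto
  then obtain g where g: "g \<in> R" "X = D #>\<^bsub>G\<lparr>carrier := R\<rparr>\<^esub> g" unfolding RCOSETS_def by auto
  have gD: "g \<notin> D" using X(2) g R.coset_join2[OF _ DR, of g] by auto
  have gc: "g \<in> carrier G" by (rule subgroup.mem_carrier[OF assms(4) g(1)])
  have "g \<otimes> q \<otimes> inv g \<in> D" if "q \<in> D" for q
    using R.fixed_right_coset[OF DR, of g q] X(3)[OF that] g(1) subgroup.mem_carrier[OF DR that]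
      m_inv_consistent[OF assms(4) g(1)] unfolding g(2) by simp
  then have "conj_set g D \<subseteq> D" unfolding conj_set_def by blast
  then have "conj_set g D = D"
    using card_conj_set[OF gc subgroup.subset[OF assms(3)]] finite_subgroup[OF assms(2,3)] card_subset_eq by blast
  then show thesis using that g gD by blast
qed

lemma sylow_exists:
  assumes "Factorial_Ring.prime p" "finite (carrier G)" "subgroup H G"
  obtains S where "subgroup S G" "S \<subseteq> H" "card S = p_part p (card H)"
proof -
  interpret H: group "G\<lparr>carrier := H\<rparr>" using subgroup_imp_group[OF assms(3)] .
  have "p ^ multiplicity p (card H) dvd card H" by (rule multiplicity_dvd)
  then obtain m where "card H = p ^ multiplicity p (card H) * m" by (elim dvdE)
  then obtain S where S: "subgroup S (G\<lparr>carrier := H\<rparr>)" "card S = p ^ multiplicity p (card H)"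
    using sylow_thm[OF assms(1) H.is_group, of "multiplicity p (card H)" m] finite_subgroup[OF assms(2,3)]
    by (auto simp: order_def)
  then show thesis using that incl_subgroup[OF assms(3) S(1)] subgroup.subset[OF S(1)]
    by (simp add: p_part_def)
qed

text \<open>A form of Cauchy's theorem: a Sylow subgroup for a prime \<open>q\<close> other than
  \<open>p\<close> consists of elements killed by an exponent prime to \<open>p\<close>, so it is
  trivial here.\<close>

lemma prime_power_if_no_coprime_order:
  assumes "Factorial_Ring.prime p" "finite (carrier G)" "subgroup H G"
    and triv: "\<And>x k. x \<in> H \<Longrightarrow> coprime k p \<Longrightarrow> x [^] (k::nat) = \<one> \<Longrightarrow> x = \<one>"
  obtains a where "card H = p ^ a"
proof -
  have "q = p" if q: "Factorial_Ring.prime q" "q dvd card H" for q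
  proof (rule ccontr)
    assume "q \<noteq> p"
    obtain S where S: "subgroup S G" "S \<subseteq> H" "card S = p_part q (card H)"
      using sylow_exists[OF q(1) assms(2,3)] .
    interpret S: group "G\<lparr>carrier := S\<rparr>" using subgroup_imp_group[OF S(1)] .
    have "x = \<one>" if x: "x \<in> S" for x
    proof -
      have "x [^] (q ^ multiplicity q (card H)) = \<one>"
        using S.pow_order_eq_1[of x] x S(3) nat_pow_consistent[of x _ S] by (simp add: order_def p_part_def)
      moreover have "coprime (q ^ multiplicity q (card H)) p"
        using primes_coprime[OF q(1) assms(1) \<open>q \<noteq> p\<close>] by simp
      ultimately show ?thesis using triv x S(2) by blast
    qed
    then have "S = {\<one>}" using subgroup.one_closed[OF S(1)] by blast
    then have "q ^ multiplicity q (card H) = 1" using S(3) by (simp add: p_part_def)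
    then have "multiplicity q (card H) = 0" using prime_gt_1_nat[OF q(1)] by simp
    moreover have "card H \<noteq> 0" using card_subgroup_pos[OF assms(2,3)] by simp
    ultimately show False using q prime_elem_multiplicity_eq_zero_iff[of q "card H"] by auto
  qed
  moreover obtain m where m: "card H = m * p_part p (card H)"
    using multiplicity_dvd[of p "card H"] by (metis p_part_def dvdE mult.commute)
  moreover have "\<not> p dvd m" using p_part_cofactor[OF assms(1) card_subgroup_pos[OF assms(2,3)] m] .
  ultimately have "m = 1" using prime_factor_nat[of m] by (metis dvd_mult2)
  then have "card H = p ^ multiplicity p (card H)" using m by (simp add: p_part_def)
  then show thesis using that by blast
qed

end

section \<open>The lower central series\<close>

context group
begin

text \<open>In contrast to \<^const>\<open>lower_central\<close>, the terms are indexed by their weight, so that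
  commutators add indices; index 0 is a duplicate of the whole group.\<close>

definition gam :: "nat \<Rightarrow> 'a set"
  where "gam d = lower_central G (d - 1)"

lemma gam_normal: "gam d \<lhd> G"
  unfolding gam_def by (rule lower_central_normal)

lemmas gam_subgroup = normal_imp_subgroup[OF gam_normal]
lemmas gam_closed = normal_closed[OF gam_normal]

lemma gam_0 [simp]: "gam 0 = carrier G"
  and gam_1 [simp]: "gam (Suc 0) = carrier G"
  by (simp_all add: gam_def)

lemma gam_Suc: "d > 0 \<Longrightarrow> gam (Suc d) = commutator_subgroup G (gam d) (carrier G)"
  by (cases d) (simp_all add: gam_def)

lemma gam_Suc_subset: "gam (Suc d) \<subseteq> gam d"
proof (cases d)
  case 0
  then show ?thesis by simp
next
  case (Suc e)
  then show ?thesis using lower_central_Suc_subset[of e] by (simp add: gam_def)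
qed

lemma gam_antimono: "d \<le> e \<Longrightarrow> gam e \<subseteq> gam d"
  using gam_Suc_subset by (rule lift_Suc_antimono_le)

lemma commutator_in_gam_Suc:
  assumes "x \<in> gam d" "g \<in> carrier G"
  shows "commutator x g \<in> gam (Suc d)" "commutator g x \<in> gam (Suc d)"
proof -
  have x: "x \<in> carrier G" by (rule gam_closed(4)[OF assms(1)])
  show 1: "commutator x g \<in> gam (Suc d)"
  proof (cases "d = 0")
    case True
    then show ?thesis using x assms(2) by simp
  next
    case False
    then show ?thesis using assms by (simp add: gam_Suc commutator_in_commutator_subgroup)
  qed
  show "commutator g x \<in> gam (Suc d)"
    using gam_closed(3)[OF 1] x assms(2) by (simp add: inv_commutator)
qed

text \<open>The three subgroups lemma, by induction on \<open>j\<close>: the elements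
  \<open>y\<close> for which every \<open>commutator x y\<close> has the desired weight form a
  subgroup, and Hall-Witt puts the generators of \<open>gam (Suc j)\<close> into it.\<close>

lemma commutator_in_gam_add:
  "x \<in> gam i \<Longrightarrow> y \<in> gam j \<Longrightarrow> commutator x y \<in> gam (i + j)"
proof (induction j arbitrary: i x y)
  case 0
  then show ?case using normal_commutator(1)[OF gam_normal, of x i y] by simp
next
  case (Suc j)
  show ?case
  proof (cases "j = 0")
    case True
    then show ?thesis using Suc commutator_in_gam_Suc(1)[of x i y] by simp
  next
    case False
    let ?T = "{y \<in> carrier G. \<forall>x\<in>gam i. commutator x y \<in> gam (i + Suc j)}"
    have T: "subgroup ?T G"
      by (rule subgroup_commutator_in[OF gam_normal]) (use gam_closed(4) in blast)
    have "commutator a b \<in> ?T" if ab: "a \<in> gam j" "b \<in> carrier G" for a b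
    proof -
      have a: "a \<in> carrier G" by (rule gam_closed(4)[OF ab(1)])
      have "commutator x (commutator a b) \<in> gam (i + Suc j)" if x: "x \<in> gam i" for x
      proof -
        \<comment> \<open>Conjugating \<open>x\<close> back by \<open>b\<close> makes the first
          factor of Hall-Witt equal to \<open>commutator (commutator a b) x\<close> itself.\<close>
        define z where "z = inv b \<otimes> x \<otimes> b"
        have xc: "x \<in> carrier G" by (rule gam_closed(4)[OF x])
        have z: "z \<in> gam i" unfolding z_def by (rule normal_conj(2)[OF gam_normal x ab(2)])
        have zc: "z \<in> carrier G" by (rule gam_closed(4)[OF z])
        have xz: "b \<otimes> z \<otimes> inv b = x"
          unfolding z_def using conj_inv_cancel(2)[OF ab(2) xc] .
        have 1: "commutator (commutator b z) (z \<otimes> a \<otimes> inv z) \<in> gam (i + Suc j)"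
          using Suc.IH[OF commutator_in_gam_Suc(2)[OF z ab(2)] normal_conj(1)[OF gam_normal ab(1) zc]]
          by simp
        have 2: "commutator (commutator z a) (a \<otimes> b \<otimes> inv a) \<in> gam (i + Suc j)"
          using commutator_in_gam_Suc(1)[OF Suc.IH[OF z ab(1)], of "a \<otimes> b \<otimes> inv a"] a ab(2) by simp
        let ?u = "commutator (commutator b z) (z \<otimes> a \<otimes> inv z) \<otimes> commutator (commutator z a) (a \<otimes> b \<otimes> inv a)"
        have "?u \<in> gam (i + Suc j)" by (rule gam_closed(2)[OF 1 2])
        moreover have "commutator (commutator a b) x \<otimes> ?u = \<one>"
          using hall_witt[OF a ab(2) zc] xz by simp
        then have "inv ?u = commutator (commutator a b) x"
          using inv_equality a ab(2) xc zc by simp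
        ultimately have "commutator (commutator a b) x \<in> gam (i + Suc j)"
          using gam_closed(3) by metis
        then have "inv (commutator (commutator a b) x) \<in> gam (i + Suc j)" by (rule gam_closed(3))
        then show ?thesis using a ab(2) xc by (simp add: inv_commutator)
      qed
      then show ?thesis using a ab(2) by simp
    qed
    then have "gam (Suc j) \<subseteq> ?T"
      using False by (simp only: gam_Suc) (rule commutator_subgroup_minimal[OF T], blast)
    then show ?thesis using Suc.prems by blast
  qed
qed

end

text \<open>Groups of order \<open>p ^ 2\<close> are excluded by the bound on \<open>n\<close>;
  \<open>theoremB\<close> settles them separately. Hence \<open>gam 2\<close> is not trivial here,
  and it turns out to have index \<open>p ^ 2\<close>.\<close>

locale maximal_class_group = group G for G :: "('a, 'b) monoid_scheme" (structure) +
  fixes p n :: nat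
  assumes prime_p: "Factorial_Ring.prime p"
    and fin: "finite (carrier G)"
    and order_G: "order G = p ^ n"
    and n_ge: "3 \<le> n"
    and lower_central_last: "lower_central G (n - 1) = {\<one>}"
    and lower_central_prev: "lower_central G (n - 2) \<noteq> {\<one>}"
begin

lemma gam_n: "gam n = {\<one>}"
  using lower_central_last by (simp add: gam_def)

lemma gam_eq_one: "d \<ge> n \<Longrightarrow> gam d = {\<one>}"
  using gam_antimono[of n d] gam_n gam_closed(1)[of d] by blast

lemma gam_neq_one: "d < n \<Longrightarrow> gam d \<noteq> {\<one>}"
proof
  assume "d < n" "gam d = {\<one>}"
  then have "gam (n - 1) \<subseteq> {\<one>}" using gam_antimono[of d "n - 1"] by simp
  then have "gam (n - 1) = {\<one>}" using gam_closed(1)[of "n - 1"] by blast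
  then show False using lower_central_prev by (simp add: gam_def numeral_2_eq_2)
qed

text \<open>If two consecutive terms agree, the series is stationary from there on and never becomes
  trivial.\<close>

lemma gam_strict:
  assumes "0 < d" "d < n"
  shows "gam (Suc d) \<subset> gam d"
proof (rule ccontr)
  assume "\<not> gam (Suc d) \<subset> gam d"
  then have eq: "gam (Suc d) = gam d" using gam_Suc_subset[of d] by blast
  have "gam (d + k) = gam d" for k
  proof (induction k)
    case (Suc k)
    then show ?case using eq gam_Suc[of "d + k"] gam_Suc[of d] assms(1) by simp
  qed simp
  from this[of "n - d"] assms show False using gam_n gam_neq_one[OF assms(2)] by simp
qed

lemma card_carrier: "card (carrier G) = p ^ n"
  using order_G by (simp add: order_def)

lemma subgroup_card_power:
  assumes "subgroup H G"
  obtains i where "i \<le> n" "card H = p ^ i"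
  using card_subgroup_prime_power[OF prime_p assms subgroup_self subgroup.subset[OF assms] card_carrier] .

text \<open>\<open>gam 2\<close> consists of nongenerators. If \<open>G = H <#> gam (d + 2)\<close>,
  changing the arguments of a commutator by elements of weight \<open>d + 2\<close> changes its
  value only in weight \<open>d + 3\<close>, so \<open>gam 2\<close>, and with it \<open>G\<close>,
  lies in \<open>H <#> gam (d + 3)\<close>. For large \<open>d\<close> the second factor is
  trivial.\<close>

lemma subgroup_eq_if_generates_mod_gam_2:
  assumes H: "subgroup H G" and "\<And>g. g \<in> carrier G \<Longrightarrow> \<exists>h\<in>H. \<exists>c\<in>gam 2. g = h \<otimes> c"
  shows "H = carrier G"
proof -
  note Hc = subgroup.mem_carrier[OF H]
  have "\<forall>g\<in>carrier G. \<exists>h\<in>H. \<exists>c\<in>gam (d + 2). g = h \<otimes> c" for d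
  proof (induction d)
    case 0
    show ?case unfolding add_0 using assms(2) by blast
  next
    case (Suc d)
    let ?T = "H <#> gam (Suc d + 2)"
    have T: "subgroup ?T G"
      using mult_norm_subgroup[OF gam_normal H] commut_normal[OF H gam_normal] by simp
    have "commutator a b \<in> ?T" if ab: "a \<in> carrier G" "b \<in> carrier G" for a b
    proof -
      obtain h c where h: "h \<in> H" "c \<in> gam (d + 2)" "a = h \<otimes> c"
        using bspec[OF Suc ab(1)] by (elim bexE)
      obtain k e where k: "k \<in> H" "e \<in> gam (d + 2)" "b = k \<otimes> e"
        using bspec[OF Suc ab(2)] by (elim bexE)
      note car = Hc[OF h(1)] Hc[OF k(1)] gam_closed(4)[OF h(2)] gam_closed(4)[OF k(2)]
      define x where "x = h \<otimes> commutator c b \<otimes> inv h"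
      define y where "y = k \<otimes> commutator h e \<otimes> inv k"
      have x: "x \<in> gam (Suc d + 2)" unfolding x_def
        using normal_conj(1)[OF gam_normal commutator_in_gam_Suc(1)[OF h(2) ab(2)] car(1)] by simp
      have y: "y \<in> gam (Suc d + 2)" unfolding y_def
        using normal_conj(1)[OF gam_normal commutator_in_gam_Suc(2)[OF k(2) car(1)] car(2)] by simp
      note car' = gam_closed(4)[OF x] gam_closed(4)[OF y]
      let ?q = "commutator h k"
      have "commutator a b = x \<otimes> commutator h b"
        unfolding h(3) x_def using car ab(2) by (simp add: commutator_mult_left)
      also have "commutator h b = ?q \<otimes> y"
        unfolding k(3) y_def using car by (simp add: commutator_mult_right)
      also have "x \<otimes> (?q \<otimes> y) = ?q \<otimes> ((inv ?q \<otimes> x \<otimes> ?q) \<otimes> y)"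
        using car car' by (simp add: group_simps)
      finally have eq: "commutator a b = ?q \<otimes> ((inv ?q \<otimes> x \<otimes> ?q) \<otimes> y)" .
      have "?q \<in> H" unfolding commutator_def
        by (intro subgroup.m_closed[OF H] subgroup.m_inv_closed[OF H] h k)
      moreover have "(inv ?q \<otimes> x \<otimes> ?q) \<otimes> y \<in> gam (Suc d + 2)"
        using gam_closed(2)[OF normal_conj(2)[OF gam_normal x] y] car by simp
      ultimately show ?thesis unfolding eq set_mult_def by blast
    qed
    then have "gam 2 \<subseteq> ?T"
      using commutator_subgroup_minimal[OF T, of "carrier G" "carrier G"] gam_Suc[of 1]
      by (simp add: numeral_2_eq_2)
    show ?case
    proof
      fix g assume "g \<in> carrier G"
      from assms(2)[OF this] obtain h c where h: "h \<in> H" "c \<in> gam 2" "g = h \<otimes> c"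
        by (elim bexE)
      then have "c \<in> ?T" using \<open>gam 2 \<subseteq> ?T\<close> by blast
      then obtain k e where k: "k \<in> H" "e \<in> gam (Suc d + 2)" "c = k \<otimes> e"
        unfolding set_mult_def by blast
      have "g = (h \<otimes> k) \<otimes> e"
        using h(3) k(3) Hc[OF h(1)] Hc[OF k(1)] gam_closed(4)[OF k(2)] by (simp add: m_assoc)
      then show "\<exists>h\<in>H. \<exists>c\<in>gam (Suc d + 2). g = h \<otimes> c"
        using subgroup.m_closed[OF H h(1) k(1)] k(2) by blast
    qed
  qed
  from this[of n] have "carrier G \<subseteq> H" using gam_eq_one[of "n + 2"] Hc by auto
  then show ?thesis using subgroup.subset[OF H] by blast
qed

lemma subgroup_set_mult_gam: "subgroup H G \<Longrightarrow> subgroup (H <#> gam d) G"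
  using mult_norm_subgroup[OF gam_normal] commut_normal[OF _ gam_normal] by simp

lemma subset_set_mult_gam:
  assumes "subgroup H G"
  shows "H \<subseteq> H <#> gam d" "gam d \<subseteq> H <#> gam d"
proof -
  show "H \<subseteq> H <#> gam d"
  proof
    fix h assume "h \<in> H"
    then have "h = h \<otimes> \<one>" "h \<in> H" using subgroup.mem_carrier[OF assms] by simp_all
    then show "h \<in> H <#> gam d" unfolding set_mult_def using gam_closed(1) by blast
  qed
  show "gam d \<subseteq> H <#> gam d"
  proof
    fix h assume "h \<in> gam d"
    then have "h = \<one> \<otimes> h" "h \<in> gam d" using gam_closed(4) by simp_all
    then show "h \<in> H <#> gam d" unfolding set_mult_def using subgroup.one_closed[OF assms] by blast
  qed
qed

lemma frattini:
  assumes "subgroup H G" "H <#> gam 2 = carrier G"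
  shows "H = carrier G"
  using subgroup_eq_if_generates_mod_gam_2[OF assms(1)] assms(2) unfolding set_mult_def by blast

text \<open>If the factor by \<open>gam 2\<close> had order \<open>p\<close>, any element outside
  \<open>gam 2\<close> would generate \<open>G\<close>, because \<open>gam 2\<close> consists of
  nongenerators. Then \<open>G\<close> would be abelian and \<open>gam 2\<close> trivial.\<close>

lemma card_gam_2_less: "card (gam 2) < p ^ (n - 1)"
proof (rule ccontr)
  assume "\<not> card (gam 2) < p ^ (n - 1)"
  moreover obtain i where i: "i \<le> n" "card (gam 2) = p ^ i" using subgroup_card_power[OF gam_subgroup] .
  moreover have "card (gam 2) < card (carrier G)"
    using gam_strict[of 1] n_ge psubset_card_mono[OF fin] by (simp add: numeral_2_eq_2)
  ultimately have "i < n" "n - 1 \<le> i"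
    using card_carrier prime_gt_1_nat[OF prime_p] by (simp_all add: not_less power_increasing_iff)
  then have "i = n - 1" by simp
  then have index: "card (carrier G) = p * card (gam 2)"
    using i card_carrier n_ge by (cases n) simp_all
  obtain x where x: "x \<in> carrier G" "x \<notin> gam 2"
    using gam_strict[of 1] n_ge by (auto simp: numeral_2_eq_2)
  let ?H = "generate G {x}"
  have H: "subgroup ?H G" using x generate_is_subgroup by simp
  have "x \<in> ?H <#> gam 2" using subset_set_mult_gam(1)[OF H] generate.incl[of x "{x}"] by blast
  then have "?H <#> gam 2 = carrier G"
    using subgroup_between_prime_index[OF prime_p fin gam_subgroup subgroup_self subgroup_set_mult_gam[OF H]
        subset_set_mult_gam(2)[OF H] subgroup.subset[OF subgroup_set_mult_gam[OF H]] index] x by blast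
  then have gen: "carrier G = ?H" using frattini[OF H] by simp
  have "commutator a b \<in> {\<one>}" if "a \<in> carrier G" "b \<in> carrier G" for a b
  proof -
    have "a \<in> generate G {x}" "b \<in> generate G {x}" using that unfolding gen .
    then obtain i j :: int where "a = x [^] i" "b = x [^] j"
      unfolding generate_pow[OF x(1)] by blast
    then show ?thesis using x(1) by (simp add: commutator_eq_one_iff flip: int_pow_mult) (simp add: add.commute)
  qed
  then have "gam 2 \<subseteq> {\<one>}"
    using commutator_subgroup_minimal[OF triv_subgroup, of "carrier G" "carrier G"] gam_Suc[of 1]
    by (simp add: numeral_2_eq_2)
  then show False using gam_neq_one[of 2] gam_closed(1)[of 2] n_ge by auto
qed

text \<open>From \<open>gam 2\<close>, of order at most \<open>p ^ (n - 2)\<close>, to the trivial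
  term \<open>gam n\<close> there are \<open>n - 2\<close> strict inclusions, so each has index
  exactly \<open>p\<close>.\<close>

lemma card_gam: "2 \<le> d \<Longrightarrow> d \<le> n \<Longrightarrow> card (gam d) = p ^ (n - d)"
proof -
  have "\<forall>d. \<exists>i. card (gam d) = p ^ i" using subgroup_card_power[OF gam_subgroup] by metis
  then obtain k where k: "\<And>d. card (gam d) = p ^ k d" by metis
  have p1: "p > 1" using prime_gt_1_nat[OF prime_p] .
  have dec: "k (Suc d) < k d" if "0 < d" "d < n" for d
    using psubset_card_mono[OF finite_subgroup[OF fin gam_subgroup] gam_strict[OF that]] k p1 by simp
  have k2: "k 2 \<le> n - 2" using card_gam_2_less k p1 n_ge by simp
  have "p ^ k n = p ^ 0" using k[of n] gam_n by simp
  then have kn: "k n = 0" using p1 power_inject_exp by blast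
  have upper: "k (d + 2) \<le> n - (d + 2)" if "d + 2 \<le> n" for d using that
  proof (induction d)
    case (Suc d)
    then show ?case using dec[of "d + 2"] by simp
  qed (use k2 in \<open>simp add: numeral_2_eq_2\<close>)
  have lower: "e \<le> k (n - e)" if "e \<le> n - 1" for e using that
  proof (induction e)
    case (Suc e)
    then have "k (Suc (n - Suc e)) < k (n - Suc e)" using n_ge by (intro dec) auto
    moreover have "Suc (n - Suc e) = n - e" using Suc.prems n_ge by simp
    ultimately show ?case using Suc by simp
  qed simp
  assume d: "2 \<le> d" "d \<le> n"
  then have d2: "d - 2 + 2 = d" by simp
  have "k d \<le> n - d" using upper[of "d - 2"] d unfolding d2 by simp
  moreover have "n - d \<le> k d" using lower[of "n - d"] d by simp
  ultimately show "card (gam d) = p ^ (n - d)" using k[of d] by simp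
qed

lemma card_gam_Suc:
  assumes "2 \<le> d" "d < n"
  shows "card (gam d) = p * card (gam (Suc d))"
  using assms by (simp add: card_gam Suc_diff_Suc flip: power_Suc)

text \<open>For \<open>2 \<le> d < n\<close>, \<open>e\<close> induces an isomorphism from the
  factor \<open>gam d / gam (d + 1)\<close> to the integers modulo \<open>p\<close>. For
  \<open>d = 1\<close> there is no such \<open>e\<close>, because the first factor has order
  \<open>p ^ 2\<close>.\<close>

definition level_log :: "nat \<Rightarrow> ('a \<Rightarrow> int) \<Rightarrow> bool"
  where "level_log d e \<longleftrightarrow>
    (\<forall>x\<in>gam d. \<forall>y\<in>gam d. [e (x \<otimes> y) = e x + e y] (mod int p)) \<and>
    (\<forall>x\<in>gam d. int p dvd e x \<longleftrightarrow> x \<in> gam (Suc d))"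

lemma level_log_ex:
  assumes "2 \<le> d" "d < n"
  obtains e where "level_log d e"
proof -
  have "gam (Suc d) \<lhd> G\<lparr>carrier := gam d\<rparr>"
    by (rule normal_restrict_supergroup[OF gam_subgroup gam_normal gam_Suc_subset])
  then show thesis
    using prime_index_log[OF prime_p fin _ gam_subgroup card_gam_Suc[OF assms]] that
    unfolding level_log_def by metis
qed

lemma level_logD:
  assumes "level_log d e"
  shows "\<And>x y. x \<in> gam d \<Longrightarrow> y \<in> gam d \<Longrightarrow> [e (x \<otimes> y) = e x + e y] (mod int p)"
    and "\<And>x. x \<in> gam d \<Longrightarrow> int p dvd e x \<longleftrightarrow> x \<in> gam (Suc d)"
    and "\<And>g x. g \<in> carrier G \<Longrightarrow> x \<in> gam d \<Longrightarrow> [e (g \<otimes> x \<otimes> inv g) = e x] (mod int p)"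
    and "\<And>x. x \<in> gam (Suc d) \<Longrightarrow> [e x = 0] (mod int p)"
proof -
  show 1: "\<And>x y. x \<in> gam d \<Longrightarrow> y \<in> gam d \<Longrightarrow> [e (x \<otimes> y) = e x + e y] (mod int p)"
    and 2: "\<And>x. x \<in> gam d \<Longrightarrow> int p dvd e x \<longleftrightarrow> x \<in> gam (Suc d)"
    using assms by (simp_all add: level_log_def)
  show 3: "[e x = 0] (mod int p)" if "x \<in> gam (Suc d)" for x
    using 2 that gam_Suc_subset[of d] by (auto simp: cong_0_iff)
  show "[e (g \<otimes> x \<otimes> inv g) = e x] (mod int p)" if "g \<in> carrier G" "x \<in> gam d" for g x
  proof -
    have c: "commutator g x \<in> gam (Suc d)" by (rule commutator_in_gam_Suc(2)[OF that(2,1)])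
    then have "[e (commutator g x \<otimes> x) = e (commutator g x) + e x] (mod int p)"
      using 1 gam_Suc_subset that(2) by blast
    also have "[e (commutator g x) + e x = 0 + e x] (mod int p)" using 3[OF c] by (intro cong_add) simp_all
    finally show ?thesis using conj_eq_commutator[OF gam_closed(4)[OF that(2)] that(1)] by simp
  qed
qed

end

section \<open>Two-step centralizers\<close>

definition (in group) two_step :: "nat \<Rightarrow> 'a set"
  where "two_step d = {g \<in> carrier G. \<forall>x\<in>gam d. commutator x g \<in> gam (Suc (Suc d))}"

context maximal_class_group
begin

text \<open>These are the maximal subgroups of \<open>G\<close>; there are \<open>p + 1\<close> of
  them, one for each subgroup of order \<open>p\<close> of the factor by
  \<open>gam 2\<close>.\<close>

definition maximal_over :: "'a set \<Rightarrow> bool"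
  where "maximal_over H \<longleftrightarrow> subgroup H G \<and> gam 2 \<subseteq> H \<and> card H = p ^ (n - 1)"

lemma maximal_overD:
  assumes "maximal_over H"
  shows "subgroup H G" "gam 2 \<subseteq> H" "card H = p ^ (n - 1)" "H \<subseteq> carrier G"
    "card (carrier G) = p * card H" "card H = p * card (gam 2)"
proof -
  show H: "subgroup H G" "gam 2 \<subseteq> H" "card H = p ^ (n - 1)"
    using assms by (simp_all add: maximal_over_def)
  show "H \<subseteq> carrier G" by (rule subgroup.subset[OF H(1)])
  have "card (gam 2) = p ^ (n - 2)" using card_gam[of 2] n_ge by simp
  moreover have "n = Suc (n - 1)" "n - 1 = Suc (n - 2)" using n_ge by simp_all
  ultimately show "card (carrier G) = p * card H" "card H = p * card (gam 2)"
    unfolding H(3) card_carrier by (metis power_Suc)+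
qed

lemma maximal_over_neq:
  assumes "maximal_over H"
  shows "H \<noteq> carrier G" "H \<noteq> gam 2"
  using maximal_overD(5,6)[OF assms] prime_gt_1_nat[OF prime_p]
    card_subgroup_pos[OF fin maximal_overD(1)[OF assms]] card_subgroup_pos[OF fin gam_subgroup[of 2]]
  by auto

lemma maximal_over_maximal:
  assumes "maximal_over H" "subgroup K G" "H \<subseteq> K" "x \<in> K" "x \<notin> H"
  shows "K = carrier G"
  using subgroup_between_prime_index[OF prime_p fin maximal_overD(1)[OF assms(1)] subgroup_self assms(2,3)
      subgroup.subset[OF assms(2)] maximal_overD(5)[OF assms(1)]] assms(4,5) by blast

text \<open>Two different maximal subgroups meet in \<open>gam 2\<close>, which has index
  \<open>p\<close> in each.\<close>

lemma maximal_over_unique: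
  assumes A: "maximal_over A" and B: "maximal_over B" and x: "x \<in> A" "x \<in> B" "x \<notin> gam 2"
  shows "A = B"
proof -
  have "subgroup (A \<inter> B) G"
    by (rule subgroups_Inter_pair[OF maximal_overD(1)[OF A] maximal_overD(1)[OF B]])
  then have "A \<inter> B = gam 2 \<or> A \<inter> B = A"
    using subgroup_between_prime_index[OF prime_p fin gam_subgroup maximal_overD(1)[OF A], of "A \<inter> B" 2]
      maximal_overD(2)[OF A] maximal_overD(2)[OF B] maximal_overD(6)[OF A] by blast
  then have "A \<subseteq> B" using x by blast
  then show "A = B"
    using card_subset_eq[OF finite_subgroup[OF fin maximal_overD(1)[OF B]]]
      maximal_overD(3)[OF A] maximal_overD(3)[OF B] by simp
qed

lemma maximal_overI:
  assumes "subgroup H G" "gam 2 \<subseteq> H" "H \<noteq> carrier G" "card (carrier G) \<le> p * card H"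
  shows "maximal_over H"
proof -
  obtain i where i: "i \<le> n" "card H = p ^ i" using subgroup_card_power[OF assms(1)] .
  have p1: "p > 1" using prime_gt_1_nat[OF prime_p] .
  have "card H < card (carrier G)"
    using assms(3) subgroup.subset[OF assms(1)] psubset_card_mono[OF fin] by blast
  then have "i < n" using i card_carrier p1 by simp
  moreover have "p ^ n \<le> p ^ Suc i" using assms(4) i card_carrier by simp
  then have "n \<le> Suc i" using p1 power_le_imp_le_exp by blast
  ultimately have "i = n - 1" by simp
  then show ?thesis using assms i by (simp add: maximal_over_def)
qed

text \<open>For \<open>x\<close> of weight \<open>d\<close> the map taking \<open>g\<close> to
  \<open>[x, g]\<close> is a homomorphism modulo \<open>gam (d + 2)\<close> into a factor of order
  \<open>p\<close>, and \<open>S\<close> is its kernel, hence of index 1 or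
  \<open>p\<close>.\<close>

lemma commutator_kernel:
  assumes x: "x \<in> gam d" and d: "0 < d" "Suc d < n"
  defines "S \<equiv> {g \<in> carrier G. commutator x g \<in> gam (Suc (Suc d))}"
  shows "subgroup S G" "gam 2 \<subseteq> S" "S \<noteq> carrier G \<Longrightarrow> maximal_over S"
proof -
  have xc: "x \<in> carrier G" by (rule gam_closed(4)[OF x])
  show S: "subgroup S G"
    using subgroup_commutator_in[OF gam_normal, of "{x}" "Suc (Suc d)"] xc by (simp add: S_def)
  show S2: "gam 2 \<subseteq> S"
    using commutator_in_gam_add[OF x, of _ 2] gam_closed(4)[of _ 2] by (auto simp: S_def)
  assume ne: "S \<noteq> carrier G"
  obtain e where "level_log (Suc d) e" using level_log_ex[of "Suc d"] d by auto
  note e = level_logD[OF this]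
  have c: "commutator x g \<in> gam (Suc d)" if "g \<in> carrier G" for g
    by (rule commutator_in_gam_Suc(1)[OF x that])
  have "card (carrier G) \<le> p * card {g \<in> carrier G. int p dvd e (commutator x g)}"
  proof (rule card_le_log_kernel[OF prime_gt_0_nat[OF prime_p] fin subgroup_self])
    fix g h assume gh: "g \<in> carrier G" "h \<in> carrier G"
    have "[e (commutator x (g \<otimes> h)) = e (commutator x g) + e (g \<otimes> commutator x h \<otimes> inv g)] (mod int p)"
      using e(1)[OF c[OF gh(1)] normal_conj(1)[OF gam_normal c[OF gh(2)] gh(1)]] xc gh
      by (simp add: commutator_mult_right)
    also have "[e (commutator x g) + e (g \<otimes> commutator x h \<otimes> inv g) = e (commutator x g) + e (commutator x h)] (mod int p)"
      using e(3)[OF gh(1) c[OF gh(2)]] by (intro cong_add) simp_all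
    finally show "[e (commutator x (g \<otimes> h)) = e (commutator x g) + e (commutator x h)] (mod int p)" .
  qed
  also have "{g \<in> carrier G. int p dvd e (commutator x g)} = S"
    using e(2)[OF c] by (auto simp: S_def)
  finally show "maximal_over S" using maximal_overI[OF S S2 ne] by simp
qed

lemma two_step_subgroup: "subgroup (two_step d) G"
  unfolding two_step_def
  by (rule subgroup_commutator_in[OF gam_normal]) (rule subgroup.subset[OF gam_subgroup])

text \<open>The elements of \<open>gam d\<close> whose commutator with a given \<open>g\<close> has
  weight \<open>d + 2\<close> form a subgroup containing \<open>gam (d + 1)\<close>. As the index of
  the latter is \<open>p\<close>, one \<open>x\<close> outside it decides for all of
  \<open>gam d\<close>.\<close>

lemma two_step_eq:
  assumes d: "2 \<le> d" "Suc d < n" and x: "x \<in> gam d" "x \<notin> gam (Suc d)"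
  shows "two_step d = {g \<in> carrier G. commutator x g \<in> gam (Suc (Suc d))}"
proof
  show "two_step d \<subseteq> {g \<in> carrier G. commutator x g \<in> gam (Suc (Suc d))}"
    using x by (auto simp: two_step_def)
  have "commutator y g \<in> gam (Suc (Suc d))"
    if g: "g \<in> carrier G" "commutator x g \<in> gam (Suc (Suc d))" and y: "y \<in> gam d" for g y
  proof -
    let ?C = "{y \<in> carrier G. commutator g y \<in> gam (Suc (Suc d))}"
    have C: "subgroup ?C G"
      using subgroup_commutator_in[OF gam_normal, of "{g}" "Suc (Suc d)"] g(1) by simp
    have in_C: "y \<in> ?C \<longleftrightarrow> commutator y g \<in> gam (Suc (Suc d))" if "y \<in> carrier G" for y
      using inv_commutator[OF g(1) that] inv_commutator[OF that g(1)] that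
        gam_closed(3)[of "commutator g y" "Suc (Suc d)"] gam_closed(3)[of "commutator y g" "Suc (Suc d)"]
      by auto
    have "gam (Suc d) \<subseteq> ?C"
      using commutator_in_gam_Suc(2)[OF _ g(1), of _ "Suc d"] gam_closed(4)[of _ "Suc d"] by auto
    moreover have xC: "x \<in> ?C" using in_C[OF gam_closed(4)[OF x(1)]] g(2) by blast
    ultimately have "gam d \<inter> ?C = gam (Suc d) \<or> gam d \<inter> ?C = gam d"
      using subgroup_between_prime_index[OF prime_p fin gam_subgroup gam_subgroup
          subgroups_Inter_pair[OF gam_subgroup C], of "Suc d" d d] gam_Suc_subset[of d] card_gam_Suc[of d] d
      by auto
    then have "y \<in> ?C" using x xC y by blast
    then show ?thesis using in_C[OF gam_closed(4)[OF y]] by blast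
  qed
  then show "{g \<in> carrier G. commutator x g \<in> gam (Suc (Suc d))} \<subseteq> two_step d"
    by (auto simp: two_step_def)
qed

text \<open>The form in which two-step centralizers are used: commutation with an element outside
  \<open>two_step d\<close> raises the exact weight \<open>d\<close> by exactly one.\<close>

lemma not_in_two_step:
  assumes d: "2 \<le> d" "Suc d < n" and x: "x \<in> gam d" "x \<notin> gam (Suc d)"
    and s: "s \<in> carrier G" "s \<notin> two_step d"
  shows "commutator x s \<notin> gam (Suc (Suc d))" "commutator s x \<notin> gam (Suc (Suc d))"
proof -
  show 1: "commutator x s \<notin> gam (Suc (Suc d))" using two_step_eq[OF d x] s by blast
  show "commutator s x \<notin> gam (Suc (Suc d))"
    using 1 inv_commutator[OF s(1) gam_closed(4)[OF x(1)]] gam_closed(3) by metis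
qed

lemma gam_diff_ex:
  assumes "0 < d" "d < n"
  obtains x where "x \<in> gam d" "x \<notin> gam (Suc d)"
  using gam_strict[OF assms] that by blast

lemma two_step_maximal_over:
  assumes d: "2 \<le> d" "Suc d < n"
  shows "maximal_over (two_step d)"
proof -
  obtain x where x: "x \<in> gam d" "x \<notin> gam (Suc d)" using gam_diff_ex[of d] d by auto
  have "two_step d \<noteq> carrier G"
  proof
    assume eq: "two_step d = carrier G"
    have "gam (Suc d) \<subseteq> gam (Suc (Suc d))"
      using commutator_subgroup_minimal[OF gam_subgroup, of "gam d" "carrier G" "Suc (Suc d)"] gam_Suc[of d] d eq
      by (auto simp: two_step_def)
    then show False using gam_strict[of "Suc d"] d by auto
  qed
  then show ?thesis using commutator_kernel(3)[OF x(1)] two_step_eq[OF d x] d by simp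
qed

text \<open>Weight one needs its own argument, since the factor by \<open>gam 2\<close> has order
  \<open>p ^ 2\<close>: commutation is an alternating form on it with values in
  \<open>gam 2 / gam 3\<close>, and in dimension two a nonzero alternating form is
  nondegenerate.\<close>

lemma commutator_kernel_maximal_over:
  assumes x: "x \<in> carrier G" "x \<notin> gam 2"
  shows "maximal_over {y \<in> carrier G. commutator x y \<in> gam 3}"
proof -
  have [simp]: "Suc (Suc (Suc 0)) = 3" "Suc (Suc 0) = 2" by simp_all
  let ?C = "\<lambda>x. {y \<in> carrier G. commutator x y \<in> gam 3}"
  have ker: "subgroup (?C x) G" "?C x \<noteq> carrier G \<Longrightarrow> maximal_over (?C x)" if "x \<in> carrier G" for x
    using commutator_kernel[of x 1] that n_ge by simp_all
  have "?C x \<noteq> carrier G"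
  proof
    assume eq: "?C x = carrier G"
    \<comment> \<open>\<open>?W\<close> is the radical of the form. Because of \<open>x\<close> it
      is larger than \<open>gam 2\<close>, so the kernel of any \<open>y\<close> outside it contains
      both \<open>?W\<close> and \<open>y\<close> and must be everything, which puts
      \<open>y\<close> into \<open>?W\<close>.\<close>
    let ?W = "{a \<in> carrier G. \<forall>y\<in>carrier G. commutator y a \<in> gam 3}"
    have W: "subgroup ?W G" by (rule subgroup_commutator_in[OF gam_normal]) simp
    have W2: "gam 2 \<subseteq> ?W"
    proof
      fix a assume a: "a \<in> gam 2"
      have "commutator y a \<in> gam 3" if y: "y \<in> carrier G" for y
        using commutator_in_gam_Suc(2)[OF a y] by simp
      then show "a \<in> ?W" using gam_closed(4)[OF a] by blast
    qed
    have xW: "x \<in> ?W"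
    proof -
      have "commutator y x \<in> gam 3" if y: "y \<in> carrier G" for y
      proof -
        have "commutator x y \<in> gam 3" using eq y by blast
        then show ?thesis using gam_closed(3)[of "commutator x y" 3] inv_commutator[OF x(1) y] by simp
      qed
      then show ?thesis using x by blast
    qed
    have "?W \<noteq> carrier G"
    proof
      assume eqW: "?W = carrier G"
      have "gam 2 \<subseteq> gam 3"
      proof -
        have "commutator_subgroup G (carrier G) (carrier G) \<subseteq> gam 3"
          by (rule commutator_subgroup_minimal[OF gam_subgroup]) (use eqW in blast)
        then show ?thesis using gam_Suc[of 1] by simp
      qed
      moreover have "gam 3 \<subset> gam 2" using gam_strict[of 2] n_ge by simp
      ultimately show False by blast
    qed
    then obtain y where y: "y \<in> carrier G" "y \<notin> ?W" using subgroup.subset[OF W] by blast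
    have "?W \<subseteq> ?C y" using y(1) by blast
    moreover have "y \<in> ?C y" using y(1) gam_closed(1) by (simp add: commutator_self)
    ultimately have "x \<in> ?C y" "y \<in> ?C y" using xW by blast+
    have Cy: "?C y = carrier G"
    proof (rule ccontr)
      assume "?C y \<noteq> carrier G"
      then have m: "maximal_over (?C y)" by (rule ker(2)[OF y(1)])
      have "?W = gam 2 \<or> ?W = ?C y"
        using subgroup_between_prime_index[OF prime_p fin gam_subgroup ker(1)[OF y(1)] W W2 \<open>?W \<subseteq> ?C y\<close>]
          maximal_overD(6)[OF m] by blast
      then show False using x(2) xW y(2) \<open>y \<in> ?C y\<close> by blast
    qed
    have "commutator g y \<in> gam 3" if g: "g \<in> carrier G" for g
    proof -
      have "commutator y g \<in> gam 3" using Cy g by blast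
      then show ?thesis using gam_closed(3)[of "commutator y g" 3] inv_commutator[OF y(1) g] by simp
    qed
    then show False using y by blast
  qed
  then show ?thesis by (rule ker(2)[OF x(1)])
qed

lemma commutator_self_gam: "x \<in> carrier G \<Longrightarrow> commutator x x \<in> gam d"
  using gam_closed(1) by (simp add: commutator_self)

lemma maximal_over_log:
  assumes "maximal_over K"
  obtains e :: "'a \<Rightarrow> int"
  where "\<And>x y. x \<in> K \<Longrightarrow> y \<in> K \<Longrightarrow> [e (x \<otimes> y) = e x + e y] (mod int p)"
    and "\<And>x. x \<in> K \<Longrightarrow> int p dvd e x \<longleftrightarrow> x \<in> gam 2"
  using prime_index_log[OF prime_p fin normal_restrict_supergroup[OF maximal_overD(1) gam_normal maximal_overD(2)]
      maximal_overD(1) maximal_overD(6)] assms by blast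

text \<open>For \<open>x\<close> outside \<open>gam 2\<close>, the maximal subgroup \<open>K\<close>
  through \<open>x\<close> has a factor \<open>K / gam 2\<close> of order \<open>p\<close>, in which
  the \<open>p\<close>-th power of \<open>x\<close> vanishes.\<close>

lemma pow_p_in_gam_2:
  assumes "x \<in> carrier G"
  shows "x [^] p \<in> gam 2"
proof (cases "x \<in> gam 2")
  case True
  then show ?thesis using subgroup_int_pow_closed[OF gam_subgroup, of x 2 "int p"] by (simp add: int_pow_int)
next
  case False
  define K where "K = {y \<in> carrier G. commutator x y \<in> gam 3}"
  have K: "maximal_over K" unfolding K_def using commutator_kernel_maximal_over assms False by blast
  have xK: "x \<in> K" unfolding K_def using commutator_self_gam assms by blast
  obtain e :: "'a \<Rightarrow> int"
    where e: "\<And>x y. x \<in> K \<Longrightarrow> y \<in> K \<Longrightarrow> [e (x \<otimes> y) = e x + e y] (mod int p)"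
      "\<And>x. x \<in> K \<Longrightarrow> int p dvd e x \<longleftrightarrow> x \<in> gam 2"
    using maximal_over_log[OF K] by blast
  have "[e (x [^] p) = int p * e x] (mod int p)"
    by (rule log_subgroup(4)[OF maximal_overD(1)[OF K] _ xK]) (rule e(1))
  then have "int p dvd e (x [^] p)" using cong_dvd_iff by fastforce
  moreover have "x [^] p \<in> K"
    using subgroup_int_pow_closed[OF maximal_overD(1)[OF K] xK, of "int p"] by (simp add: int_pow_int)
  ultimately show ?thesis using e(2) by blast
qed

text \<open>Supplies the exact weight of \<open>y\<close>, to which \<open>not_in_two_step\<close>
  can be applied.\<close>

lemma gam_level:
  assumes "y \<in> gam a" "y \<notin> gam b"
  obtains d where "a \<le> d" "d < b" "y \<in> gam d" "y \<notin> gam (Suc d)"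
proof -
  let ?d = "LEAST d. y \<notin> gam (Suc d) \<and> a \<le> d"
  have "a < b" using assms gam_antimono[of b a] by (metis not_le subsetD)
  then obtain k where k: "b = Suc k" "a \<le> k" by (cases b) auto
  then have ex: "y \<notin> gam (Suc k) \<and> a \<le> k" using assms by simp
  have 1: "y \<notin> gam (Suc ?d) \<and> a \<le> ?d" by (rule LeastI[of _ k]) (rule ex)
  have 2: "?d \<le> k" by (rule Least_le) (rule ex)
  have 3: "y \<in> gam ?d"
  proof (cases "?d = a")
    case True
    then show ?thesis using assms(1) by metis
  next
    case False
    then have "\<not> (y \<notin> gam (Suc (?d - 1)) \<and> a \<le> ?d - 1)" "a \<le> ?d - 1" "?d > 0"
      using 1 not_less_Least[of "?d - 1" "\<lambda>d. y \<notin> gam (Suc d) \<and> a \<le> d"] by auto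
    then show ?thesis by simp
  qed
  show thesis using that[of ?d] 1 2 3 k by auto
qed

text \<open>\<open>y\<close> commutes with its own power, whereas an exact weight of
  \<open>y [^] p\<close> below \<open>m\<close> would be raised by exactly one under commutation
  with \<open>y\<close>.\<close>

lemma pow_p_in_gam:
  assumes y: "y \<in> carrier G" "y \<notin> gam 2" and m: "2 \<le> m" "m < n"
    and nt: "\<And>d. 2 \<le> d \<Longrightarrow> d < m \<Longrightarrow> y \<notin> two_step d"
  shows "y [^] p \<in> gam m"
proof (rule ccontr)
  assume "y [^] p \<notin> gam m"
  then obtain d where d: "2 \<le> d" "d < m" "y [^] p \<in> gam d" "y [^] p \<notin> gam (Suc d)"
    using gam_level[OF pow_p_in_gam_2[OF y(1)]] by blast
  have "commutator (y [^] p) y \<notin> gam (Suc (Suc d))"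
    using not_in_two_step(1)[OF d(1) _ d(3,4) y(1) nt[OF d(1,2)]] d m by simp
  moreover have "commutator (y [^] p) y = \<one>"
    using y(1) nat_pow_Suc2[OF y(1), of p] by (simp add: commutator_eq_one_iff)
  ultimately show False using gam_closed(1) by simp
qed

lemma card_centralizer_uniform:
  assumes x: "x \<in> carrier G" "x \<notin> gam 2"
    and nt: "\<And>d. 2 \<le> d \<Longrightarrow> Suc d < n \<Longrightarrow> x \<notin> two_step d"
  shows "card (centralizer G x) = p ^ 2" "centralizer G x \<inter> gam 2 = gam (n - 1)"
proof -
  let ?C = "centralizer G x"
  have C_eq: "?C = {g \<in> carrier G. commutator x g = \<one>}"
    using x(1) by (auto simp: centralizer_def commutator_eq_one_iff)
  have C: "subgroup ?C G"
    using subgroup_commutator_in[OF one_is_normal, of "{x}"] x(1) unfolding C_eq by simp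
  \<comment> \<open>Anything commuting with \<open>x\<close> lies in the maximal subgroup
    \<open>K\<close> through \<open>x\<close>; since \<open>gam 2\<close> has index \<open>p\<close>
    in \<open>K\<close>, the centralizer has at most \<open>p\<close> times the order of its part in
    \<open>gam 2\<close>.\<close>
  define K where "K = {y \<in> carrier G. commutator x y \<in> gam 3}"
  have K: "maximal_over K" unfolding K_def by (rule commutator_kernel_maximal_over[OF x])
  have CK: "?C \<subseteq> K" unfolding C_eq K_def using gam_closed(1) by auto
  show I: "?C \<inter> gam 2 = gam (n - 1)"
  proof
    show "?C \<inter> gam 2 \<subseteq> gam (n - 1)"
    proof
      fix y assume y: "y \<in> ?C \<inter> gam 2"
      show "y \<in> gam (n - 1)"
      proof (rule ccontr)
        assume "y \<notin> gam (n - 1)"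
        then obtain d where d: "2 \<le> d" "d < n - 1" "y \<in> gam d" "y \<notin> gam (Suc d)"
          using gam_level[of y 2 "n - 1"] y by blast
        then have "commutator x y \<notin> gam (Suc (Suc d))"
          using not_in_two_step(2)[OF d(1) _ d(3,4) x(1) nt[OF d(1)]] by simp
        then show False using y gam_closed(1) unfolding C_eq by auto
      qed
    qed
    show "gam (n - 1) \<subseteq> ?C \<inter> gam 2"
    proof
      fix y assume y: "y \<in> gam (n - 1)"
      then have "commutator x y \<in> gam n"
        using commutator_in_gam_Suc(2)[OF y x(1)] n_ge by simp
      moreover have "gam (n - 1) \<subseteq> gam 2" using n_ge by (intro gam_antimono) simp
      ultimately show "y \<in> ?C \<inter> gam 2"
        using gam_n gam_closed(4)[OF y] y unfolding C_eq by auto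
    qed
  qed
  obtain e :: "'a \<Rightarrow> int"
    where e: "\<And>x y. x \<in> K \<Longrightarrow> y \<in> K \<Longrightarrow> [e (x \<otimes> y) = e x + e y] (mod int p)"
      "\<And>x. x \<in> K \<Longrightarrow> int p dvd e x \<longleftrightarrow> x \<in> gam 2"
    using maximal_over_log[OF K] by blast
  have "card ?C \<le> p * card {y \<in> ?C. int p dvd e y}"
    by (rule card_le_log_kernel[OF prime_gt_0_nat[OF prime_p] fin C]) (use CK e(1) in blast)
  also have "{y \<in> ?C. int p dvd e y} = ?C \<inter> gam 2" using e(2) CK by blast
  also have "card (?C \<inter> gam 2) = p" using I card_gam[of "n - 1"] n_ge by simp
  finally have le: "card ?C \<le> p ^ 2" by (simp add: power2_eq_square)
  \<comment> \<open>\<open>x\<close> itself commutes with \<open>x\<close> and is outside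
    \<open>gam 2\<close>, so the order of the centralizer is a power of \<open>p\<close> above
    \<open>p\<close>.\<close>
  have "x \<in> ?C" using x by (simp add: C_eq commutator_self)
  then have "?C \<inter> gam 2 \<subset> ?C" using x by blast
  then have "p < card ?C"
    using psubset_card_mono[OF finite_subgroup[OF fin C]] \<open>card (?C \<inter> gam 2) = p\<close> by metis
  obtain i where i: "card ?C = p ^ i" using subgroup_card_power[OF C] by blast
  have p1: "p > 1" using prime_gt_1_nat[OF prime_p] .
  have "p ^ 1 < p ^ i" using i \<open>p < card ?C\<close> by simp
  then have "1 < i" using p1 power_less_imp_less_exp by blast
  moreover have "i \<le> 2" using le i p1 power_le_imp_le_exp by metis
  ultimately have "i = 2" by simp
  then show "card ?C = p ^ 2" using i by simp
qed

lemma avoid_maximal_subgroups: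
  assumes "finite F" "card F \<le> p" "\<And>H. H \<in> F \<Longrightarrow> maximal_over H"
  obtains x where "x \<in> carrier G" "x \<notin> \<Union>F"
proof -
  have one: "\<one> \<in> H" if "H \<in> F" for H
    using subgroup.one_closed[OF maximal_overD(1)[OF assms(3)[OF that]]] .
  have p1: "p > 1" using prime_gt_1_nat[OF prime_p] .
  have pn: "p ^ (n - 1) * p = p ^ n" using n_ge by (cases n) (simp_all add: mult.commute)
  \<comment> \<open>All members share the identity, so they cover at most
    \<open>p * (p ^ (n - 1) - 1)\<close> of the \<open>p ^ n - 1\<close> other elements.\<close>
  have "card (\<Union>H\<in>F. H - {\<one>}) \<le> (\<Sum>H\<in>F. card (H - {\<one>}))"
    by (rule card_UN_le[OF assms(1)])
  also have "\<dots> = (\<Sum>H\<in>F. p ^ (n - 1) - 1)"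
    by (rule sum.cong) (use one maximal_overD(3)[OF assms(3)] in \<open>simp_all add: card_Diff_singleton\<close>)
  also have "\<dots> \<le> p * (p ^ (n - 1) - 1)" using assms(2) by (simp add: mult_le_mono1)
  also have "\<dots> = p ^ n - p" using pn by (simp add: diff_mult_distrib2 mult.commute)
  also have "\<dots> < p ^ n - 1"
    using p1 self_le_power[of p n] n_ge by (intro diff_less_mono2) auto
  also have "\<dots> = card (carrier G - {\<one>})" using card_carrier by (simp add: card_Diff_singleton)
  finally have "card (\<Union>H\<in>F. H - {\<one>}) < card (carrier G - {\<one>})" .
  then have "\<not> carrier G - {\<one>} \<subseteq> (\<Union>H\<in>F. H - {\<one>})"
    using card_mono[of "\<Union>H\<in>F. H - {\<one>}" "carrier G - {\<one>}"] assms(1)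
      finite_subgroup[OF fin maximal_overD(1)[OF assms(3)]] by fastforce
  then obtain x where "x \<in> carrier G" "x \<noteq> \<one>" "x \<notin> (\<Union>H\<in>F. H - {\<one>})" by blast
  then show thesis using that by blast
qed

end

section \<open>Where the two-step centralizers first deviate\<close>

context maximal_class_group
begin

section \<open>Commutation as a Lie bracket on the lower central factors\<close>

lemma level_log_inv:
  assumes e: "level_log d e" and x: "x \<in> gam d"
  shows "[e (inv x) = - e x] (mod int p)"
  by (rule log_subgroup(2)[OF gam_subgroup _ x]) (rule level_logD(1)[OF e])

lemma level_log_swap:
  assumes e: "level_log d e" and x: "x \<in> gam i" and y: "y \<in> gam j" and d: "d = i + j"
  shows "[e (commutator y x) = - e (commutator x y)] (mod int p)"
  using level_log_inv[OF e, of "commutator x y"] commutator_in_gam_add[OF x y] d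
    inv_commutator[OF gam_closed(4)[OF x] gam_closed(4)[OF y]] by simp

lemma level_log_mult_left:
  assumes e: "level_log d e" and x: "x \<in> gam i" "x' \<in> gam i" and y: "y \<in> gam j" and d: "d = i + j"
  shows "[e (commutator (x \<otimes> x') y) = e (commutator x y) + e (commutator x' y)] (mod int p)"
proof -
  note c = gam_closed(4)[OF x(1)] gam_closed(4)[OF x(2)] gam_closed(4)[OF y]
  have 1: "commutator x' y \<in> gam d" "commutator x y \<in> gam d"
    unfolding d using commutator_in_gam_add x y by blast+
  have "[e (commutator (x \<otimes> x') y) = e (x \<otimes> commutator x' y \<otimes> inv x) + e (commutator x y)] (mod int p)"
    using level_logD(1)[OF e normal_conj(1)[OF gam_normal 1(1) c(1)] 1(2)] c by (simp add: commutator_mult_left)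
  also have "[e (x \<otimes> commutator x' y \<otimes> inv x) + e (commutator x y) = e (commutator x' y) + e (commutator x y)] (mod int p)"
    using level_logD(3)[OF e c(1) 1(1)] by (intro cong_add) simp_all
  finally show ?thesis by (simp add: add.commute)
qed

text \<open>Conjugation changes \<open>z\<close> only in higher weight, which \<open>e\<close> does
  not see; this removes the conjugations from Hall-Witt.\<close>

lemma level_log_commutator_conj:
  assumes e: "level_log d e" and c: "c \<in> gam i" and y: "y \<in> gam j" and z: "z \<in> gam l"
    and d: "d = i + l" "0 < j"
  shows "[e (commutator c (y \<otimes> z \<otimes> inv y)) = e (commutator c z)] (mod int p)"
proof -
  note car = gam_closed(4)[OF c] gam_closed(4)[OF y] gam_closed(4)[OF z]
  let ?w = "commutator y z"
  have "commutator c ?w \<in> gam (i + (j + l))"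
    by (intro commutator_in_gam_add c y z)
  then have w: "commutator c ?w \<in> gam (Suc d)"
    using gam_antimono[of "Suc d" "i + (j + l)"] d by auto
  have cz: "commutator c z \<in> gam d" unfolding d by (intro commutator_in_gam_add c z)
  have "commutator c (y \<otimes> z \<otimes> inv y) = commutator c ?w \<otimes> (?w \<otimes> commutator c z \<otimes> inv ?w)"
    using car by (simp add: conj_eq_commutator commutator_mult_right)
  then have "[e (commutator c (y \<otimes> z \<otimes> inv y)) = e (commutator c ?w) + e (?w \<otimes> commutator c z \<otimes> inv ?w)] (mod int p)"
    using level_logD(1)[OF e _ normal_conj(1)[OF gam_normal cz, of ?w], of "commutator c ?w"] w gam_Suc_subset[of d] car
    by auto
  also have "[e (commutator c ?w) + e (?w \<otimes> commutator c z \<otimes> inv ?w) = 0 + e (commutator c z)] (mod int p)"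
    by (intro cong_add level_logD(3)[OF e _ cz] level_logD(4)[OF e w]) (use car in simp)
  finally show ?thesis by simp
qed

text \<open>Hall-Witt read at weight \<open>d\<close>, arranged so that commutation with
  \<open>z\<close> appears as a derivation of the bracket of \<open>x\<close> and
  \<open>y\<close>.\<close>

lemma level_log_jacobi:
  assumes e: "level_log d e" and x: "x \<in> gam i" "0 < i" and y: "y \<in> gam j" "0 < j" and z: "z \<in> gam l" "0 < l"
    and d: "d = i + j + l"
  shows "[e (commutator (commutator x y) z) = e (commutator (commutator x z) y) + e (commutator x (commutator y z))] (mod int p)"
proof -
  note car = gam_closed(4)[OF x(1)] gam_closed(4)[OF y(1)] gam_closed(4)[OF z(1)]
  let ?u1 = "commutator (commutator x y) (y \<otimes> z \<otimes> inv y)"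
  let ?u2 = "commutator (commutator y z) (z \<otimes> x \<otimes> inv z)"
  let ?u3 = "commutator (commutator z x) (x \<otimes> y \<otimes> inv x)"
  have c: "commutator x y \<in> gam (i + j)" "commutator y z \<in> gam (j + l)" "commutator z x \<in> gam (l + i)"
    "commutator x z \<in> gam (i + l)"
    using commutator_in_gam_add x y z by blast+
  have u: "?u1 \<in> gam d" "?u2 \<in> gam d" "?u3 \<in> gam d"
    using commutator_in_gam_add[OF c(1) normal_conj(1)[OF gam_normal z(1) car(2)]]
      commutator_in_gam_add[OF c(2) normal_conj(1)[OF gam_normal x(1) car(3)]]
      commutator_in_gam_add[OF c(3) normal_conj(1)[OF gam_normal y(1) car(1)]] d
    by (simp_all add: ac_simps)
  have "[e (?u1 \<otimes> (?u2 \<otimes> ?u3)) = e ?u1 + (e ?u2 + e ?u3)] (mod int p)"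
    using level_logD(1)[OF e u(1) gam_closed(2)[OF u(2,3)]] level_logD(1)[OF e u(2,3)]
    by (meson cong_add cong_refl cong_trans)
  moreover have "[e ?u1 = e (commutator (commutator x y) z)] (mod int p)"
    by (rule level_log_commutator_conj[OF e c(1) y(1) z(1)]) (use d y in simp_all)
  moreover have "[e ?u2 = e (commutator (commutator y z) x)] (mod int p)"
    by (rule level_log_commutator_conj[OF e c(2) z(1) x(1)]) (use d z in simp_all)
  moreover have "[e ?u3 = e (commutator (commutator z x) y)] (mod int p)"
    by (rule level_log_commutator_conj[OF e c(3) x(1) y(1)]) (use d x in simp_all)
  ultimately have "[e (?u1 \<otimes> (?u2 \<otimes> ?u3)) = e (commutator (commutator x y) z) +
      (e (commutator (commutator y z) x) + e (commutator (commutator z x) y))] (mod int p)"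
    by (meson cong_add cong_trans)
  moreover have "?u1 \<otimes> (?u2 \<otimes> ?u3) = \<one>" by (rule hall_witt[OF car])
  moreover have "[e \<one> = 0] (mod int p)" by (rule level_logD(4)[OF e gam_closed(1)])
  ultimately have 1: "[0 = e (commutator (commutator x y) z) +
      (e (commutator (commutator y z) x) + e (commutator (commutator z x) y))] (mod int p)"
    by (metis cong_sym cong_trans)
  have 2: "[e (commutator (commutator y z) x) = - e (commutator x (commutator y z))] (mod int p)"
    by (rule level_log_swap[OF e x(1) c(2)]) (use d in simp)
  have 3: "[e (commutator (commutator z x) y) = - e (commutator (commutator x z) y)] (mod int p)"
  proof -
    have c3: "commutator z x \<in> gam (i + l)" using c(3) by (simp add: add.commute)
    have "[e (commutator (commutator z x \<otimes> commutator x z) y) =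
        e (commutator (commutator z x) y) + e (commutator (commutator x z) y)] (mod int p)"
      by (rule level_log_mult_left[OF e c3 c(4) y(1)]) (use d in simp)
    moreover have "commutator z x \<otimes> commutator x z = \<one>"
      using car inv_commutator[of x z] by (metis commutator_closed l_inv)
    moreover have "commutator \<one> y = \<one>" using car by (simp add: commutator_def)
    ultimately have "[0 = e (commutator (commutator z x) y) + e (commutator (commutator x z) y)] (mod int p)"
      using \<open>[e \<one> = 0] (mod int p)\<close> by (metis cong_sym cong_trans)
    then show ?thesis by (simp add: cong_iff_dvd_diff dvd_diff_commute add.commute)
  qed
  have "int p dvd e (commutator (commutator x y) z) +
      (e (commutator (commutator y z) x) + e (commutator (commutator z x) y))"
    using cong_dvd_iff[OF 1] by simp
  moreover have "int p dvd e (commutator (commutator y z) x) + e (commutator x (commutator y z))"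
    using 2 by (simp add: cong_iff_dvd_diff)
  moreover have "int p dvd e (commutator (commutator z x) y) + e (commutator (commutator x z) y)"
    using 3 by (simp add: cong_iff_dvd_diff)
  ultimately have "int p dvd (e (commutator (commutator x y) z) +
      (e (commutator (commutator y z) x) + e (commutator (commutator z x) y))) -
      (e (commutator (commutator y z) x) + e (commutator x (commutator y z))) -
      (e (commutator (commutator z x) y) + e (commutator (commutator x z) y))"
    by (intro dvd_diff)
  then show ?thesis by (simp add: cong_iff_dvd_diff algebra_simps)
qed

text \<open>Take \<open>s1\<close> in \<open>two_step 2\<close> but not in
  \<open>two_step m\<close>, and \<open>s\<close> outside both. The iterated commutators
  \<open>S i\<close> of \<open>s1\<close> with \<open>s\<close> span the factors of weight 2 to
  \<open>m + 1\<close>, and commutation with \<open>s\<close> is a derivation on their brackets. In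
  weight \<open>m + 1\<close> the brackets are all nonzero, so none can be a bracket of an element
  with itself, and \<open>m\<close> is even. One weight higher such a middle bracket does occur, and
  its vanishing forces \<open>p\<close> to divide \<open>m div 2\<close>.\<close>

lemma first_deviation:
  assumes m: "3 \<le> m" "Suc m < n"
    and same: "\<And>d. 2 \<le> d \<Longrightarrow> d < m \<Longrightarrow> two_step d = two_step 2"
    and dev: "two_step m \<noteq> two_step 2"
  shows "even m" "Suc (Suc m) < n \<Longrightarrow> p dvd m div 2"
proof -
  let ?P = "two_step 2" and ?M = "two_step m"
  have P: "maximal_over ?P" and M: "maximal_over ?M" using two_step_maximal_over m by simp_all
  have "\<not> ?P \<subseteq> ?M"
    using card_subset_eq[OF finite_subgroup[OF fin maximal_overD(1)[OF M]]] dev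
      maximal_overD(3)[OF P] maximal_overD(3)[OF M] by metis
  then obtain s1 where s1: "s1 \<in> ?P" "s1 \<notin> ?M" by blast
  have s1c: "s1 \<in> carrier G" using s1(1) maximal_overD(4)[OF P] by blast
  have s12: "s1 \<notin> gam 2" using s1(2) maximal_overD(2)[OF M] by blast
  have "card {?P, ?M} \<le> p" using prime_ge_2_nat[OF prime_p] dev by simp
  then obtain s where s: "s \<in> carrier G" "s \<notin> ?P" "s \<notin> ?M"
    using avoid_maximal_subgroups[of "{?P, ?M}"] P M by auto
  \<comment> \<open>Indexed by weight, so that \<open>S i\<close> lies in \<open>gam i\<close>,
    starting with \<open>S 1 = s1\<close>.\<close>
  define S where "S i = ((\<lambda>x. commutator x s) ^^ (i - 1)) s1" for i
  have S1: "S 1 = s1" "S (Suc 0) = s1" by (simp_all add: S_def)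
  have S_Suc: "S (Suc i) = commutator (S i) s" if "i > 0" for i
    using that by (cases i) (simp_all add: S_def)
  have S_gam: "S i \<in> gam i" if "i > 0" for i
    using that
  proof (induction i)
    case (Suc i)
    then show ?case using s1c S1 S_Suc commutator_in_gam_Suc(1)[OF _ s(1), of "S i" i] by (cases "i = 0") auto
  qed simp
  note Sc = gam_closed(4)[OF S_gam]
  have sg: "s \<in> gam 1" and s1g: "s1 \<in> gam 1" using s(1) s1c by simp_all
  have two_step_low: "two_step d = ?P \<or> two_step d = ?M" if "2 \<le> d" "d \<le> m" for d
    using same[of d] that by (cases "d = m") auto
  have S_exact: "S i \<notin> gam (Suc i)" if "2 \<le> i" "i \<le> Suc m" for i
    using that
  proof (induction i rule: dec_induct)
    case base
    \<comment> \<open>\<open>s1\<close> lies in only one maximal subgroup, so its centralizer modulo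
      \<open>gam 3\<close> is \<open>two_step 2\<close>, which excludes \<open>s\<close>.\<close>
    let ?K = "{y \<in> carrier G. commutator s1 y \<in> gam 3}"
    have "maximal_over ?K" by (rule commutator_kernel_maximal_over[OF s1c s12])
    moreover have "s1 \<in> ?K" using s1c commutator_self_gam by blast
    ultimately have "?K = ?P" using maximal_over_unique[OF _ P _ s1(1) s12] by blast
    then have "commutator s1 s \<notin> gam 3" using s by blast
    then show ?case using S_Suc[of 1] S1 by (simp add: numeral_2_eq_2 numeral_3_eq_3)
  next
    case (step i)
    then have "s \<notin> two_step i" using two_step_low[of i] s by auto
    then have "commutator (S i) s \<notin> gam (Suc (Suc i))"
      using not_in_two_step(1)[OF step(1) _ S_gam step.IH s(1)] step m by simp
    then show ?case using S_Suc[of i] step by simp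
  qed
  have jac: "[e (commutator (commutator (S i) (S j)) s) =
      e (commutator (S (Suc i)) (S j)) + e (commutator (S i) (S (Suc j)))] (mod int p)"
    if "level_log (i + j + 1) e" "0 < i" "0 < j" for e i j
    using level_log_jacobi[OF that(1) S_gam[OF that(2)] that(2) S_gam[OF that(3)] that(3) sg]
      S_Suc[OF that(2)] S_Suc[OF that(3)] by simp
  \<comment> \<open>Below the deviation the commutator of \<open>S i\<close> with \<open>s1\<close>
    has one weight more than expected; the derivation property carries this from \<open>j\<close> to
    \<open>j + 1\<close>.\<close>
  have low: "commutator (S i) (S j) \<in> gam (Suc (i + j))" if "0 < i" "0 < j" "i + j \<le> m" for i j
    using that
  proof (induction j arbitrary: i)
    case (Suc j)
    show ?case
    proof (cases "j = 0")
      case True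
      show ?thesis
      proof (cases "i = 1")
        case True
        then show ?thesis using \<open>j = 0\<close> S1 commutator_self_gam[OF s1c] by simp
      next
        case False
        then have "s1 \<in> two_step i" using same[of i] s1(1) Suc.prems by simp
        then show ?thesis using True S1 S_gam[OF Suc.prems(1)] by (simp add: two_step_def)
      qed
    next
      case False
      obtain e where e: "level_log (i + j + 1) e" using level_log_ex[of "i + j + 1"] Suc.prems m by auto
      have "commutator (commutator (S i) (S j)) s \<in> gam (Suc (i + j + 1))"
        using commutator_in_gam_Suc(1)[OF Suc.IH[of i] s(1)] Suc.prems False by simp
      then have 1: "[e (commutator (commutator (S i) (S j)) s) = 0] (mod int p)" by (rule level_logD(4)[OF e])
      have "commutator (S (Suc i)) (S j) \<in> gam (Suc (i + j + 1))"
        using Suc.IH[of "Suc i"] Suc.prems False by simp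
      then have 2: "[e (commutator (S (Suc i)) (S j)) = 0] (mod int p)" by (rule level_logD(4)[OF e])
      have 3: "[e (commutator (commutator (S i) (S j)) s) =
          e (commutator (S (Suc i)) (S j)) + e (commutator (S i) (S (Suc j)))] (mod int p)"
        using jac[OF e] Suc.prems False by simp
      have "int p dvd e (commutator (S (Suc i)) (S j)) + e (commutator (S i) (S (Suc j)))"
        using cong_dvd_iff[OF 3] 1 by (simp add: cong_0_iff)
      then have "int p dvd e (commutator (S i) (S (Suc j)))"
        using 2 dvd_add_right_iff by (simp add: cong_0_iff dvd_add_right_iff)
      then show ?thesis
        using level_logD(2)[OF e, of "commutator (S i) (S (Suc j))"]
          commutator_in_gam_add[OF S_gam[of i] S_gam[of "Suc j"]] Suc.prems by simp
    qed
  qed simp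
  obtain e where e: "level_log (Suc m) e" using level_log_ex[of "Suc m"] m by auto
  \<comment> \<open>\<open>F j\<close> is the coordinate of a bracket of total weight
    \<open>m + 1\<close>. Neighbours add up to zero because their sum is the derivative of a bracket
    that is already small by \<open>low\<close>; \<open>F 0\<close> does not vanish because
    \<open>s1\<close> is outside \<open>two_step m\<close>.\<close>
  define F where "F j = e (commutator (S (m - j)) (S (Suc j)))" for j
  have comm_level: "commutator (S (m - j)) (S (Suc j)) \<in> gam (Suc m)" if "j < m" for j
    using commutator_in_gam_add[OF S_gam[of "m - j"] S_gam[of "Suc j"]] that by simp
  have F_Suc: "int p dvd F j + F (Suc j)" if "Suc j < m" for j
  proof -
    let ?a = "m - Suc j"
    have eq: "?a + Suc j + 1 = Suc m" "Suc ?a = m - j" "?a + Suc j = m" using that by simp_all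
    have "commutator (commutator (S ?a) (S (Suc j))) s \<in> gam (Suc (Suc m))"
      using commutator_in_gam_Suc(1)[OF low[of ?a "Suc j"] s(1)] that eq by simp
    then have "int p dvd e (commutator (commutator (S ?a) (S (Suc j))) s)"
      using level_logD(4)[OF e] by (simp add: cong_0_iff)
    moreover have "[e (commutator (commutator (S ?a) (S (Suc j))) s) = F j + F (Suc j)] (mod int p)"
      using jac[of ?a "Suc j" e] e eq that unfolding F_def by simp
    ultimately show ?thesis using cong_dvd_iff by blast
  qed
  have F0: "\<not> int p dvd F 0"
  proof -
    have "commutator (S m) s1 \<notin> gam (Suc (Suc m))"
      using not_in_two_step(1)[OF _ m(2) S_gam[of m] S_exact[of m] s1c s1(2)] m by simp
    then show ?thesis using level_logD(2)[OF e comm_level[of 0]] S1 m by (simp add: F_def)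
  qed
  have F: "\<not> int p dvd F j" if "j < m" for j
    using that
  proof (induction j)
    case (Suc j)
    then have "\<not> int p dvd F j" "int p dvd F j + F (Suc j)" using F_Suc[of j] by simp_all
    then show ?case using dvd_add_left_iff by blast
  qed (use F0 in simp)
  show "even m"
  proof (rule ccontr)
    assume "odd m"
    then obtain k where k: "m = 2 * k + 1" by (elim oddE)
    then have "m - k = Suc k" by simp
    then have "F k = e \<one>" unfolding F_def using Sc[of "Suc k"] by (simp add: commutator_self)
    then have "int p dvd F k" using level_logD(4)[OF e gam_closed(1)] by (simp add: cong_0_iff)
    then show False using F[of k] k by simp
  qed
  assume m2: "Suc (Suc m) < n"
  obtain f where f: "level_log (Suc (Suc m)) f" using level_log_ex[of "Suc (Suc m)"] m2 by auto
  \<comment> \<open>The bracket \<open>?x\<close> spans weight \<open>m + 1\<close>. Jacobi moves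
    the commutation with \<open>s1\<close> onto its two entries, where \<open>low\<close> gains one
    weight.\<close>
  have s1_high: "s1 \<in> two_step (Suc m)"
  proof -
    let ?x = "commutator (S (m - 1)) (S 2)"
    have x: "?x \<in> gam (Suc m)" "?x \<notin> gam (Suc (Suc m))"
      using comm_level[of 1] F[of 1] level_logD(2)[OF e comm_level[of 1]] m
      by (simp_all add: F_def numeral_2_eq_2)
    have j: "[f (commutator ?x s1) = f (commutator (commutator (S (m - 1)) s1) (S 2)) +
        f (commutator (S (m - 1)) (commutator (S 2) s1))] (mod int p)"
      using level_log_jacobi[OF f S_gam[of "m - 1"] _ S_gam[of 2] _ s1g] m by simp
    have "commutator (commutator (S (m - 1)) s1) (S 2) \<in> gam (Suc (Suc (Suc m)))"
      using commutator_in_gam_add[OF low[of "m - 1" 1] S_gam[of 2]] m S1 by simp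
    moreover have "commutator (S (m - 1)) (commutator (S 2) s1) \<in> gam (Suc (Suc (Suc m)))"
    proof -
      have eq: "m - 1 + Suc (2 + 1) = Suc (Suc (Suc m))" and pos: "0 < m - 1" using m by simp_all
      have "commutator (S 2) s1 \<in> gam (Suc (2 + 1))" using low[of 2 1] m S1 by simp
      from commutator_in_gam_add[OF S_gam[OF pos] this] show ?thesis unfolding eq .
    qed
    ultimately have "[f (commutator ?x s1) = 0 + 0] (mod int p)"
      using level_logD(4)[OF f] j by (meson cong_add cong_trans)
    moreover have "commutator ?x s1 \<in> gam (Suc (Suc m))" by (rule commutator_in_gam_Suc(1)[OF x(1) s1c])
    ultimately have "commutator ?x s1 \<in> gam (Suc (Suc (Suc m)))"
      using level_logD(2)[OF f] by (simp add: cong_0_iff)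
    then show ?thesis using two_step_eq[OF _ m2 x] m s1c by simp
  qed
  have "two_step (Suc m) = ?P"
    using maximal_over_unique[OF two_step_maximal_over P s1_high s1(1) s12] m m2 by simp
  then have s_high: "s \<notin> two_step (Suc m)" using s by simp
  \<comment> \<open>The same pattern one weight higher. \<open>H j\<close> belongs to the derivative
    of the bracket behind \<open>F j\<close>, hence alternates in sign, and it is nonzero since
    \<open>s\<close> is outside \<open>two_step (Suc m)\<close>.\<close>
  define H where "H j = f (commutator (commutator (S (m - j)) (S (Suc j))) s)" for j
  have H0: "\<not> int p dvd H 0"
  proof -
    have "commutator (S m) s1 \<in> gam (Suc m)" "commutator (S m) s1 \<notin> gam (Suc (Suc m))"
      using comm_level[of 0] F0 level_logD(2)[OF e comm_level[of 0]] m S1 by (simp_all add: F_def)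
    note x = this
    have "commutator (commutator (S m) s1) s \<notin> gam (Suc (Suc (Suc m)))"
      using not_in_two_step(1)[OF _ m2 x s(1) s_high] m by simp
    then show ?thesis
      using level_logD(2)[OF f commutator_in_gam_Suc(1)[OF x(1) s(1)]] S1 by (simp add: H_def)
  qed
  have H_Suc: "int p dvd H j + H (Suc j)" if j: "Suc j < m" for j
  proof -
    let ?a = "commutator (S (m - j)) (S (Suc j))" and ?b = "commutator (S (m - Suc j)) (S (Suc (Suc j)))"
    have a: "?a \<in> gam (Suc m)" and b: "?b \<in> gam (Suc m)" using comm_level[of j] comm_level[of "Suc j"] j by simp_all
    have "[e (?a \<otimes> ?b) = F j + F (Suc j)] (mod int p)" unfolding F_def by (rule level_logD(1)[OF e a b])
    then have "?a \<otimes> ?b \<in> gam (Suc (Suc m))"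
      using F_Suc[OF j] cong_dvd_iff level_logD(2)[OF e gam_closed(2)[OF a b]] by blast
    then have "int p dvd f (commutator (?a \<otimes> ?b) s)"
      using level_logD(4)[OF f commutator_in_gam_Suc(1)[OF _ s(1)]] by (simp add: cong_0_iff)
    moreover have "[f (commutator (?a \<otimes> ?b) s) = H j + H (Suc j)] (mod int p)"
      unfolding H_def by (rule level_log_mult_left[OF f a b sg]) simp
    ultimately show ?thesis using cong_dvd_iff by blast
  qed
  have H: "[H j = (-1) ^ j * H 0] (mod int p)" if "j < m" for j
    using that
  proof (induction j)
    case (Suc j)
    have "int p dvd H j - (-1) ^ j * H 0" using Suc by (simp add: cong_iff_dvd_diff)
    from dvd_diff[OF H_Suc[OF Suc.prems] this] show ?case by (simp add: cong_iff_dvd_diff algebra_simps)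
  qed simp
  \<comment> \<open>\<open>C j\<close> stands for the brackets of total weight \<open>m + 2\<close>.
    It starts at 0 by \<open>s1_high\<close>, and the relation \<open>H j = C j + C (j + 1)\<close>
    makes it grow linearly in \<open>j\<close> up to sign.\<close>
  define C where "C j = f (commutator (S (Suc m - j)) (S (Suc j)))" for j
  have C: "[C j = - ((-1) ^ j) * int j * H 0] (mod int p)" if "j < m" for j
    using that
  proof (induction j)
    case 0
    have "commutator (S (Suc m)) s1 \<in> gam (Suc (Suc (Suc m)))"
      using s1_high S_gam[of "Suc m"] by (simp add: two_step_def)
    then show ?case using level_logD(4)[OF f] S1 by (simp add: C_def)
  next
    case (Suc j)
    have "[H j = C j + C (Suc j)] (mod int p)"
      using jac[of "m - j" "Suc j" f] f Suc.prems
      unfolding H_def C_def by (simp add: Suc_diff_le)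
    then have "int p dvd (H j - (C j + C (Suc j)))" by (simp add: cong_iff_dvd_diff)
    moreover have "int p dvd H j - (-1) ^ j * H 0" using H[of j] Suc.prems by (simp add: cong_iff_dvd_diff)
    moreover have "int p dvd C j - (- ((-1) ^ j) * int j * H 0)"
      using Suc by (simp add: cong_iff_dvd_diff)
    ultimately have "int p dvd (H j - (-1) ^ j * H 0) - (H j - (C j + C (Suc j))) - (C j - (- ((-1) ^ j) * int j * H 0))"
      by (blast intro: dvd_diff)
    then show ?case by (simp add: cong_iff_dvd_diff algebra_simps)
  qed
  \<comment> \<open>At \<open>j = h\<close> the bracket is that of \<open>S (h + 1)\<close> with
    itself, so \<open>h * H 0\<close> vanishes modulo \<open>p\<close>.\<close>
  define h where "h = m div 2"
  have h: "m = 2 * h" "h < m" using \<open>even m\<close> m by (auto simp: h_def)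
  then have "Suc m - h = Suc h" by simp
  then have "C h = f \<one>" unfolding C_def using Sc[of "Suc h"] by (simp add: commutator_self)
  then have "int p dvd C h" using level_logD(4)[OF f gam_closed(1)] by (simp add: cong_0_iff)
  then have "int p dvd - ((-1) ^ h) * int h * H 0" using C[OF h(2)] cong_dvd_iff by blast
  then have "int p dvd int h * H 0"
    by (cases "even h") (simp_all add: mult.assoc)
  then have "int p dvd int h" using H0 prime_p by (simp add: prime_dvd_mult_iff)
  then show "p dvd m div 2" by (simp add: h_def)
qed

end

section \<open>Powers and the two-step centralizers\<close>

text \<open>Pascal's rule written multiplicatively. The factor at \<open>k = r\<close> has exponent
  0 and only keeps the index range uniform.\<close>

lemma (in comm_group) pascal_recursion:
  assumes u: "\<And>k. u k \<in> carrier G"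
    and w: "\<And>j. w 0 j = \<one>" "\<And>r j. w (Suc r) j = u j \<otimes> (w r j \<otimes> w r (Suc j))"
  shows "w r j = (\<Otimes>k\<in>{..r}. u (j + k) [^] (r choose Suc k))"
proof (induction r arbitrary: j)
  case 0
  then show ?case using w by simp
next
  case (Suc r)
  let ?A = "\<Otimes>k\<in>{..r}. u (j + k) [^] (r choose Suc k)"
  let ?B = "\<Otimes>k\<in>{..r}. u (Suc j + k) [^] (r choose Suc k)"
  have A: "(\<Otimes>k\<in>{..Suc r}. u (j + k) [^] (r choose Suc k)) = ?A"
    using u by (simp add: Pi_def binomial_eq_0)
  have B: "(\<Otimes>k\<in>{..Suc r}. u (j + k) [^] (r choose k)) = ?B \<otimes> u j"
    using u by (subst finprod_Suc2) (simp_all add: Pi_def)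
  have "(\<Otimes>k\<in>{..Suc r}. u (j + k) [^] (Suc r choose Suc k)) =
      (\<Otimes>k\<in>{..Suc r}. u (j + k) [^] (r choose k) \<otimes> u (j + k) [^] (r choose Suc k))"
    using u by (intro finprod_cong') (auto simp: nat_pow_mult)
  also have "\<dots> = (?B \<otimes> u j) \<otimes> ?A"
    using u by (subst finprod_multf) (simp_all only: A B, auto)
  also have "\<dots> = u j \<otimes> (?A \<otimes> ?B)"
    using u by (simp add: m_ac Pi_def)
  also have "\<dots> = w (Suc r) j" using w(2) Suc.IH by simp
  finally show ?case by simp
qed

section \<open>Powers of a product with one factor in an abelian subgroup\<close>

context group
begin

lemma pow_subgroup_closed:
  assumes "subgroup H G" "x \<in> H"
  shows "x [^] (k::nat) \<in> H"
  using subgroup_int_pow_closed[OF assms, of "int k"] by (simp add: int_pow_int)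

text \<open>Collecting \<open>s\<close> on the right gives
  \<open>(u j \<otimes> s) [^] r = w r j \<otimes> s [^] r\<close>, where \<open>w\<close> obeys
  Pascal's rule because conjugation by \<open>s\<close> takes \<open>u k\<close> to
  \<open>u k \<otimes> u (Suc k)\<close>. For \<open>r = p\<close> the binomial coefficients
  strictly between \<open>k = 0\<close> and \<open>k = p - 1\<close> are multiples of
  \<open>p\<close>, and their factors vanish.\<close>

lemma pow_mult_abelian:
  assumes A: "subgroup A G" and comm: "\<And>a b. a \<in> A \<Longrightarrow> b \<in> A \<Longrightarrow> a \<otimes> b = b \<otimes> a"
    and s: "s \<in> carrier G" and u: "\<And>k. u k \<in> A" and su: "\<And>k. s \<otimes> u k \<otimes> inv s = u k \<otimes> u (Suc k)"
    and p: "Factorial_Ring.prime p" and triv: "\<And>k. 0 < k \<Longrightarrow> k < p - 1 \<Longrightarrow> u k [^] p = \<one>"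
  shows "(u 0 \<otimes> s) [^] p = u 0 [^] p \<otimes> u (p - 1) \<otimes> s [^] p"
proof -
  let ?H = "G\<lparr>carrier := A\<rparr>"
  interpret H: comm_group ?H
    using subgroup_imp_group[OF A] comm by (intro group.group_comm_groupI) auto
  \<comment> \<open>The starting index \<open>j\<close> is kept general in the recursion on the
    exponent, which refers to both \<open>j\<close> and \<open>Suc j\<close>.\<close>
  define w where "w = rec_nat (\<lambda>j::nat. \<one>) (\<lambda>r f j. u j \<otimes> (f j \<otimes> f (Suc j)))"
  have w: "w 0 j = \<one>" "w (Suc r) j = u j \<otimes> (w r j \<otimes> w r (Suc j))" for r j by (simp_all add: w_def)
  have wA: "w r j \<in> A" for r j
    using H.m_closed H.one_closed u by (induction r arbitrary: j) (simp_all add: w)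
  note Ac = subgroup.mem_carrier[OF A]
  have sw: "s \<otimes> w r j \<otimes> inv s = w r j \<otimes> w r (Suc j)" for r j
  proof (induction r arbitrary: j)
    case 0
    then show ?case using s by (simp add: w)
  next
    case (Suc r)
    have "s \<otimes> w (Suc r) j \<otimes> inv s =
        (s \<otimes> u j \<otimes> inv s) \<otimes> ((s \<otimes> w r j \<otimes> inv s) \<otimes> (s \<otimes> w r (Suc j) \<otimes> inv s))"
      using s Ac[OF u] Ac[OF wA] by (simp add: w conj_mult)
    also have "\<dots> = (u j \<otimes> u (Suc j)) \<otimes> ((w r j \<otimes> w r (Suc j)) \<otimes> (w r (Suc j) \<otimes> w r (Suc (Suc j))))"
      by (simp only: su Suc.IH)
    also have "\<dots> = w (Suc r) j \<otimes> w (Suc r) (Suc j)"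
      unfolding w using u wA by (simp add: H.m_ac[simplified] subgroup.m_closed[OF A])
    finally show ?case .
  qed
  have pow: "(u j \<otimes> s) [^] r = w r j \<otimes> s [^] r" for r j
  proof (induction r)
    case 0
    then show ?case by (simp add: w)
  next
    case (Suc r)
    have "(u j \<otimes> s) [^] Suc r = (u j \<otimes> s) \<otimes> (w r j \<otimes> s [^] r)"
      using Suc s Ac[OF u] by (simp only: nat_pow_Suc2 m_closed)
    also have "\<dots> = u j \<otimes> (s \<otimes> w r j \<otimes> inv s) \<otimes> (s \<otimes> s [^] r)"
      using s Ac[OF u] Ac[OF wA] by (simp add: group_simps)
    also have "\<dots> = w (Suc r) j \<otimes> s [^] Suc r"
      using s Ac[OF u] Ac[OF wA] nat_pow_Suc2[OF s, of r] by (simp add: sw w m_assoc)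
    finally show ?case .
  qed
  let ?f = "\<lambda>k. u k [^]\<^bsub>?H\<^esub> (p choose Suc k)"
  have p2: "p \<ge> 2" by (rule prime_ge_2_nat[OF p])
  have "w p 0 = finprod ?H ?f {..p}"
    using H.pascal_recursion[of u w p 0] u w by simp
  also have "\<dots> = finprod ?H ?f {0, p - 1}"
  proof (rule H.finprod_mono_neutral_cong_right)
    fix k assume k: "k \<in> {..p} - {0, p - 1}"
    show "?f k = \<one>\<^bsub>?H\<^esub>"
    proof (cases "k = p")
      case True
      then show ?thesis by (simp add: binomial_eq_0)
    next
      case False
      then have "p dvd (p choose Suc k)" "0 < k" "k < p - 1" using k p by (auto intro: dvd_choose_prime)
      then obtain c where c: "p choose Suc k = p * c" by (elim dvdE)
      have "u k [^] (p choose Suc k) = (u k [^] p) [^] c" using Ac[OF u] by (simp add: c nat_pow_pow)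
      then show ?thesis using triv \<open>0 < k\<close> \<open>k < p - 1\<close> by (simp flip: nat_pow_consistent)
    qed
  qed (use u p2 pow_subgroup_closed[OF A u] in \<open>auto simp flip: nat_pow_consistent\<close>)
  also have "\<dots> = u 0 [^] p \<otimes> u (p - 1)"
    using p2 u Ac[OF u] pow_subgroup_closed[OF A u] by (simp add: Pi_def flip: nat_pow_consistent)
  finally show ?thesis using pow[of 0 p] by simp
qed

lemma normal_coset_eq:
  assumes "K \<lhd> G" "x \<in> carrier G" "y \<in> carrier G"
  shows "K #> x = K #> y \<longleftrightarrow> x \<otimes> inv y \<in> K"
proof
  assume eq: "K #> x = K #> y"
  have "x \<in> K #> x" by (rule rcos_self[OF assms(2) normal_imp_subgroup[OF assms(1)]])
  then show "x \<otimes> inv y \<in> K"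
    using eq subgroup.rcos_module_imp[OF normal_imp_subgroup[OF assms(1)] is_group assms(3)] by simp
next
  assume "x \<otimes> inv y \<in> K"
  then have "x \<in> K #> y"
    by (rule subgroup.rcos_module_rev[OF normal_imp_subgroup[OF assms(1)] is_group assms(3,2)])
  then show "K #> x = K #> y"
    using repr_independence[OF _ assms(3) normal_imp_subgroup[OF assms(1)]] by blast
qed

lemma normal_coset_commute_iff:
  assumes "K \<lhd> G" "x \<in> carrier G" "y \<in> carrier G"
  shows "K #> (x \<otimes> y) = K #> (y \<otimes> x) \<longleftrightarrow> commutator x y \<in> K"
  using normal_coset_eq[OF assms(1), of "x \<otimes> y" "y \<otimes> x"] assms(2,3)
  by (simp add: commutator_def inv_mult_group m_assoc)

lemma normal_coset_eq_self:
  assumes "K \<lhd> G" "x \<in> carrier G"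
  shows "K #> x = K \<longleftrightarrow> x \<in> K"
  using normal_coset_eq[OF assms one_closed] assms(2) subgroup.subset[OF normal_imp_subgroup[OF assms(1)]]
  by simp

text \<open>The collection formula read in \<open>G Mod K\<close>, where the image of
  \<open>A\<close> is abelian.\<close>

lemma pow_mult_abelian_mod:
  assumes K: "K \<lhd> G" and A: "subgroup A G"
    and comm: "\<And>a b. a \<in> A \<Longrightarrow> b \<in> A \<Longrightarrow> commutator a b \<in> K"
    and s: "s \<in> carrier G" and u: "\<And>k. u k \<in> A" and u_Suc: "\<And>k. u (Suc k) = commutator s (u k)"
    and p: "Factorial_Ring.prime p" and triv: "\<And>k. 0 < k \<Longrightarrow> k < p - 1 \<Longrightarrow> u k [^] p \<in> K"
  shows "K #> ((u 0 \<otimes> s) [^] p) = K #> (u 0 [^] p \<otimes> u (p - 1) \<otimes> s [^] p)"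
proof -
  interpret K: normal K G by (rule K)
  let ?Q = "G Mod K" and ?c = "\<lambda>x. K #> x"
  interpret Q: group ?Q by (rule K.factorgroup_is_group)
  interpret c: group_hom G ?Q ?c
    using K.r_coset_hom_Mod by unfold_locales
  note Ac = subgroup.mem_carrier[OF A]
  have coset_comm: "?c (a \<otimes> b) = ?c (b \<otimes> a)" if "a \<in> A" "b \<in> A" for a b
    using comm[OF that] normal_coset_commute_iff[OF K Ac[OF that(1)] Ac[OF that(2)]] by simp
  have "(?c (u 0) \<otimes>\<^bsub>?Q\<^esub> ?c s) [^]\<^bsub>?Q\<^esub> p =
      ?c (u 0) [^]\<^bsub>?Q\<^esub> p \<otimes>\<^bsub>?Q\<^esub> ?c (u (p - 1)) \<otimes>\<^bsub>?Q\<^esub> ?c s [^]\<^bsub>?Q\<^esub> p"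
  proof (rule Q.pow_mult_abelian[where A = "?c ` A", OF _ _ _ _ _ p])
    show "subgroup (?c ` A) ?Q" by (rule c.subgroup_img_is_subgroup[OF A])
    show "a \<otimes>\<^bsub>?Q\<^esub> b = b \<otimes>\<^bsub>?Q\<^esub> a" if ab: "a \<in> ?c ` A" "b \<in> ?c ` A" for a b
    proof -
      obtain a' b' where "a' \<in> A" "b' \<in> A" "a = ?c a'" "b = ?c b'" using ab by blast
      then show ?thesis using coset_comm[of a' b'] Ac c.hom_mult by metis
    qed
    show "?c s \<in> carrier ?Q" using s by (rule c.hom_closed)
    show "?c (u k) \<in> ?c ` A" for k using u by (rule imageI)
    show "?c s \<otimes>\<^bsub>?Q\<^esub> ?c (u k) \<otimes>\<^bsub>?Q\<^esub> inv\<^bsub>?Q\<^esub> ?c s = ?c (u k) \<otimes>\<^bsub>?Q\<^esub> ?c (u (Suc k))" for k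
    proof -
      have "?c s \<otimes>\<^bsub>?Q\<^esub> ?c (u k) \<otimes>\<^bsub>?Q\<^esub> inv\<^bsub>?Q\<^esub> ?c s = ?c (s \<otimes> u k \<otimes> inv s)"
        using s Ac[OF u] by (simp only: c.hom_mult c.hom_inv m_closed inv_closed)
      also have "s \<otimes> u k \<otimes> inv s = u (Suc k) \<otimes> u k"
        using s Ac[OF u] by (simp add: u_Suc conj_eq_commutator)
      also have "?c (u (Suc k) \<otimes> u k) = ?c (u k \<otimes> u (Suc k))" by (rule coset_comm[OF u u])
      also have "\<dots> = ?c (u k) \<otimes>\<^bsub>?Q\<^esub> ?c (u (Suc k))" by (rule c.hom_mult[OF Ac[OF u] Ac[OF u]])
      finally show ?thesis .
    qed
    show "?c (u k) [^]\<^bsub>?Q\<^esub> p = \<one>\<^bsub>?Q\<^esub>" if "0 < k" "k < p - 1" for k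
      using normal_coset_eq_self[OF K, of "u k [^] p"] triv[OF that] Ac[OF u] K.FactGroup_pow[of "u k" p] by simp
  qed
  then show ?thesis
    using s Ac[OF u] by (simp only: c.hom_mult c.hom_nat_pow m_closed nat_pow_closed)
qed

lemma conj_pow:
  assumes "g \<in> carrier G" "x \<in> carrier G"
  shows "(g \<otimes> x \<otimes> inv g) [^] (k::nat) = g \<otimes> x [^] k \<otimes> inv g"
proof (induction k)
  case (Suc k)
  then show ?case using assms by (simp add: conj_mult)
qed (use assms in simp)

lemma pow_kernel_subgroup:
  assumes K: "K \<lhd> G" and A: "subgroup A G"
    and comm: "\<And>a b. a \<in> A \<Longrightarrow> b \<in> A \<Longrightarrow> commutator a b \<in> K"
  shows "subgroup {x \<in> A. x [^] (k::nat) \<in> K} G"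
    and "x \<in> A \<Longrightarrow> y \<in> A \<Longrightarrow> K #> ((x \<otimes> y) [^] k) = K #> (x [^] k \<otimes> y [^] k)"
proof -
  interpret K: normal K G by (rule K)
  let ?Q = "G Mod K" and ?c = "\<lambda>x. K #> x"
  interpret Q: group ?Q by (rule K.factorgroup_is_group)
  interpret c: group_hom G ?Q ?c
    using K.r_coset_hom_Mod by unfold_locales
  note Ac = subgroup.mem_carrier[OF A]
  have coset_comm: "?c (a \<otimes> b) = ?c (b \<otimes> a)" if "a \<in> A" "b \<in> A" for a b
    using comm[OF that] normal_coset_commute_iff[OF K Ac[OF that(1)] Ac[OF that(2)]] by simp
  show dist: "?c ((x \<otimes> y) [^] k) = ?c (x [^] k \<otimes> y [^] k)" if xy: "x \<in> A" "y \<in> A" for x y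
  proof -
    note car = Ac[OF xy(1)] Ac[OF xy(2)]
    have "?c x \<otimes>\<^bsub>?Q\<^esub> ?c y = ?c y \<otimes>\<^bsub>?Q\<^esub> ?c x"
      using coset_comm[OF xy] car by (simp only: c.hom_mult)
    then have "(?c x \<otimes>\<^bsub>?Q\<^esub> ?c y) [^]\<^bsub>?Q\<^esub> k = ?c x [^]\<^bsub>?Q\<^esub> k \<otimes>\<^bsub>?Q\<^esub> ?c y [^]\<^bsub>?Q\<^esub> k"
      using Q.pow_mult_distrib car c.hom_closed by blast
    then show ?thesis using car by (simp only: c.hom_mult c.hom_nat_pow m_closed nat_pow_closed)
  qed
  show "subgroup {x \<in> A. x [^] k \<in> K} G"
  proof (rule subgroupI)
    show "{x \<in> A. x [^] k \<in> K} \<noteq> {}"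
      using subgroup.one_closed[OF A] K.one_closed by auto
    show "inv x \<in> {x \<in> A. x [^] k \<in> K}" if "x \<in> {x \<in> A. x [^] k \<in> K}" for x
      using that subgroup.m_inv_closed[OF A] nat_pow_inv[of x k] Ac by simp
    show "x \<otimes> y \<in> {x \<in> A. x [^] k \<in> K}" if "x \<in> {x \<in> A. x [^] k \<in> K}" "y \<in> {x \<in> A. x [^] k \<in> K}" for x y
    proof -
      have "x [^] k \<otimes> y [^] k \<in> K" using that by simp
      then have "?c ((x \<otimes> y) [^] k) = K"
        using dist[of x y] that Ac normal_coset_eq_self[OF K, of "x [^] k \<otimes> y [^] k"] by simp
      then have "(x \<otimes> y) [^] k \<in> K"
        using normal_coset_eq_self[OF K, of "(x \<otimes> y) [^] k"] that Ac by simp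
      then show ?thesis using that subgroup.m_closed[OF A] by simp
    qed
  qed (use Ac in auto)
qed

end

section \<open>Powers in groups of maximal class\<close>

context maximal_class_group
begin

lemma pow_p_in_gam_Suc:
  assumes x: "x \<in> gam d" and d: "2 \<le> d" "d < n"
  shows "x [^] p \<in> gam (Suc d)"
proof -
  obtain e where e: "level_log d e" using level_log_ex[OF d] .
  have "[e (x [^] p) = int p * e x] (mod int p)"
    by (rule log_subgroup(4)[OF gam_subgroup _ x]) (rule level_logD(1)[OF e])
  then have "int p dvd e (x [^] p)" using cong_dvd_iff by fastforce
  then show ?thesis using level_logD(2)[OF e] pow_subgroup_closed[OF gam_subgroup x] by blast
qed

text \<open>If \<open>s\<close> lies in the first deviating centralizer, then powers of \<open>s\<close> times elements of
  weight \<open>i + 1\<close> are controlled by conjugation, which forces those elements to have exponent \<open>p\<close>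
  modulo \<open>gam (m + 2)\<close>. For \<open>s\<close> outside of all centralizers the \<open>p\<close>-th power maps weight \<open>i\<close>
  onto weight \<open>m = i + p - 1\<close> instead; being equivariant it would do the same to weight \<open>i + 1\<close>.\<close>

lemma no_late_deviation:
  assumes m: "2 * p \<le> m" "Suc m < n"
    and same: "\<And>d. 2 \<le> d \<Longrightarrow> d < m \<Longrightarrow> two_step d = two_step 2"
    and dev: "two_step m \<noteq> two_step 2"
  shows False
proof -
  let ?P = "two_step 2" and ?M = "two_step m"
  have p2: "2 \<le> p" by (rule prime_ge_2_nat[OF prime_p])
  have m4: "4 \<le> m" using m p2 by simp
  have P: "maximal_over ?P" and M: "maximal_over ?M" using two_step_maximal_over m m4 by simp_all
  \<comment> \<open>\<open>i\<close> is chosen with \<open>i + p - 1 = m\<close>, so that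
    \<open>p - 1\<close> commutations lead from weight \<open>i\<close> to weight \<open>m\<close>.
    The bound \<open>2 * p \<le> m\<close> enters as \<open>m + 2 \<le> i + i\<close>, which makes
    \<open>gam i\<close> abelian modulo \<open>K\<close>.\<close>
  define i where "i = m - p + 1"
  have i: "i + p = Suc m" "p < i" "3 \<le> i" "i \<le> m" "Suc (Suc m) \<le> i + i" using m p2 by (simp_all add: i_def)
  define K where "K = gam (Suc (Suc m))"
  have K: "K \<lhd> G" unfolding K_def by (rule gam_normal)
  note Kc = normal_closed[OF K]
  have comm: "commutator a b \<in> K" if "a \<in> gam i" "b \<in> gam i" for a b
    using commutator_in_gam_add[OF that] gam_antimono[OF i(5)] unfolding K_def by blast
  have distrib: "K #> ((a \<otimes> b) [^] p) = K #> (a [^] p \<otimes> b [^] p)" if "a \<in> gam i" "b \<in> gam i" for a b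
    by (rule pow_kernel_subgroup(2)[OF K gam_subgroup _ that]) (rule comm)
  have T: "subgroup {x \<in> gam i. x [^] p \<in> K} G"
    by (rule pow_kernel_subgroup(1)[OF K gam_subgroup]) (rule comm)
  define u where "u s w k = ((\<lambda>x. commutator s x) ^^ k) w" for s w and k :: nat
  have u0: "u s w 0 = w" and u_Suc: "u s w (Suc k) = commutator s (u s w k)" for s w k
    by (simp_all add: u_def)
  have u_gam: "u s w k \<in> gam (j + k)" if "s \<in> carrier G" "w \<in> gam j" for s w j k
    using that by (induction k) (simp_all add: u0 u_Suc commutator_in_gam_Suc)
  have u_gam_i: "u s w k \<in> gam i" if "s \<in> carrier G" "w \<in> gam j" "i \<le> j" for s w j k
    using u_gam[OF that(1,2), of k] gam_antimono[of i "j + k"] that(3) by auto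
  have expand: "K #> ((w \<otimes> s) [^] p) = K #> (w [^] p \<otimes> u s w (p - 1) \<otimes> s [^] p)"
    if s: "s \<in> carrier G" and w: "w \<in> gam j" "i \<le> j" and triv: "\<And>x. x \<in> gam (Suc j) \<Longrightarrow> x [^] p \<in> K" for s w j
  proof -
    have 1: "u s w k [^] p \<in> K" if "0 < k" "k < p - 1" for k
      using triv u_gam[OF s w(1), of k] gam_antimono[of "Suc j" "j + k"] that by auto
    show ?thesis
      using pow_mult_abelian_mod[where u = "u s w", OF K gam_subgroup comm s u_gam_i[OF s w] u_Suc prime_p 1]
      by (simp add: u0)
  qed
  have "\<not> ?M \<subseteq> ?P"
    using card_subset_eq[OF finite_subgroup[OF fin maximal_overD(1)[OF P]]] dev
      maximal_overD(3)[OF P] maximal_overD(3)[OF M] by metis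
  then obtain s where s: "s \<in> ?M" "s \<notin> ?P" by blast
  have sc: "s \<in> carrier G" using s(1) maximal_overD(4)[OF M] by blast
  have s2: "s \<notin> gam 2" using s(2) maximal_overD(2)[OF P] by blast
  have s_low: "s \<notin> two_step d" if "2 \<le> d" "d < m" for d using same[OF that] s by simp
  have sp: "s [^] p \<in> gam m"
    by (rule pow_p_in_gam[OF sc s2]) (use m m4 s_low in auto)
  \<comment> \<open>The induction descends from weight \<open>m + 1\<close> to weight
    \<open>i + 1\<close>. At each weight one element \<open>w\<close> suffices, since the factors
    have order \<open>p\<close>.\<close>
  have exponent: "\<forall>x\<in>gam (Suc m - k). x [^] p \<in> K" if "k < p" for k
    using that
  proof (induction k)
    case 0
    then show ?case using pow_p_in_gam_Suc[of _ "Suc m"] m m4 by (simp add: K_def)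
  next
    case (Suc k)
    define j where "j = m - k"
    have j: "Suc m - Suc k = j" "Suc m - k = Suc j" "Suc i \<le> j" "j \<le> m" "i + p - 1 \<le> j + (p - 2)" "0 < j"
      using Suc.prems i by (simp_all add: j_def)
    have triv: "x [^] p \<in> K" if "x \<in> gam (Suc j)" for x using Suc that unfolding j(2) by simp
    have "0 < j - 1" "j - 1 < n" using j(3,4) i m by simp_all
    then obtain v where v: "v \<in> gam (j - 1)" "v \<notin> gam (Suc (j - 1))"
      by (rule gam_diff_ex)
    have vc: "v \<in> carrier G" by (rule gam_closed(4)[OF v(1)])
    define w where "w = commutator v s"
    have w: "w \<in> gam j" using commutator_in_gam_Suc(1)[OF v(1) sc] j by (simp add: w_def)
    have w': "w \<notin> gam (Suc j)"
      using not_in_two_step(1)[OF _ _ v sc s_low] j i m by (simp add: w_def)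
    have wc: "w \<in> carrier G" by (rule gam_closed(4)[OF w])
    \<comment> \<open>\<open>w \<otimes> s\<close> is a conjugate of \<open>s\<close>, so its
      \<open>p\<close>-th power is that of \<open>s\<close> modulo \<open>K\<close>; the collection
      formula then isolates \<open>w [^] p\<close>.\<close>
    have "w \<otimes> s = v \<otimes> s \<otimes> inv v" using vc sc by (simp add: w_def conj_eq_commutator)
    then have ws: "(w \<otimes> s) [^] p = v \<otimes> s [^] p \<otimes> inv v" using conj_pow[OF vc sc] by simp
    have "Suc (Suc m) \<le> j - 1 + m" using j(3) i(3) by simp
    then have "commutator v (s [^] p) \<in> K"
      using commutator_in_gam_add[OF v(1) sp] gam_antimono unfolding K_def by blast
    moreover have "(w \<otimes> s) [^] p \<otimes> inv (s [^] p) = commutator v (s [^] p)"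
      unfolding ws commutator_def by simp
    ultimately have 1: "K #> ((w \<otimes> s) [^] p) = K #> (s [^] p)"
      using normal_coset_eq[OF K, of "(w \<otimes> s) [^] p" "s [^] p"] wc sc by simp
    \<comment> \<open>The last term of the formula is a commutator of \<open>s\<close> with an
      element of weight \<open>m\<close>, and \<open>s\<close> lies in
      \<open>two_step m\<close>.\<close>
    have "u s w (p - 2) \<in> gam m"
      using u_gam[OF sc w, of "p - 2"] gam_antimono[of m "j + (p - 2)"] j(5) i(1) by auto
    then have "commutator (u s w (p - 2)) s \<in> K"
      using s(1) by (simp add: two_step_def K_def)
    then have "inv (commutator (u s w (p - 2)) s) \<in> K" by (rule Kc(3))
    moreover have "u s w (p - 1) = commutator s (u s w (p - 2))"
      using u_Suc[of s w "p - 2"] p2 by (simp add: Suc_diff_Suc numeral_2_eq_2)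
    ultimately have last: "u s w (p - 1) \<in> K"
      using sc gam_closed(4)[OF \<open>u s w (p - 2) \<in> gam m\<close>] by (simp add: inv_commutator)
    have lc: "u s w (p - 1) \<in> carrier G" by (rule Kc(4)[OF last])
    have "K #> (w [^] p \<otimes> u s w (p - 1) \<otimes> s [^] p) = K #> (s [^] p)"
      using expand[OF sc w _ triv] j 1 by simp
    then have "w [^] p \<otimes> u s w (p - 1) \<in> K"
      using normal_coset_eq[OF K, of "w [^] p \<otimes> u s w (p - 1) \<otimes> s [^] p" "s [^] p"] wc lc sc
      by (simp add: m_assoc)
    then have "(w [^] p \<otimes> u s w (p - 1)) \<otimes> inv (u s w (p - 1)) \<in> K" using Kc(2,3) last by blast
    then have wp: "w [^] p \<in> K" using wc lc by (simp add: m_assoc)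
    let ?T = "gam j \<inter> {x \<in> gam i. x [^] p \<in> K}"
    have "gam (Suc j) \<subseteq> ?T"
      using triv gam_Suc_subset[of j] gam_antimono[of i "Suc j"] j by auto
    then have "?T = gam (Suc j) \<or> ?T = gam j"
      using subgroup_between_prime_index[OF prime_p fin gam_subgroup gam_subgroup subgroups_Inter_pair[OF gam_subgroup T], of "Suc j" j j]
        card_gam_Suc[of j] j i m by auto
    moreover have "w \<in> ?T" using w wp gam_antimono[of i j] j by auto
    ultimately have "?T = gam j" using w' by blast
    then show ?case unfolding j(1) by blast
  qed
  have triv: "x [^] p \<in> K" if "x \<in> gam (Suc i)" for x
  proof -
    have "Suc m - (p - 1) = Suc i" using i p2 by simp
    then show ?thesis using exponent[of "p - 1"] that p2 by simp
  qed
  have "card {?P, ?M} \<le> p" using p2 dev by simp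
  then obtain t where t: "t \<in> carrier G" "t \<notin> ?P" "t \<notin> ?M"
    using avoid_maximal_subgroups[of "{?P, ?M}"] P M by auto
  have t2: "t \<notin> gam 2" using t(2) maximal_overD(2)[OF P] by blast
  have t_low: "t \<notin> two_step d" if "2 \<le> d" "d \<le> m" for d using same[of d] t that by (cases "d = m") auto
  \<comment> \<open>Both \<open>t\<close> and \<open>x \<otimes> t\<close> avoid all centralizers up
    to index \<open>m\<close>, so their \<open>p\<close>-th powers have weight at least
    \<open>m + 1\<close>. Comparing them, \<open>x [^] p\<close> must cancel the term
    \<open>?l\<close> of exact weight \<open>m\<close>.\<close>
  have tp: "t [^] p \<in> gam (Suc m)"
    by (rule pow_p_in_gam[OF t(1) t2]) (use m m4 t_low in auto)
  obtain x where x: "x \<in> gam i" "x \<notin> gam (Suc i)" using gam_diff_ex[of i] i m by auto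
  have xc: "x \<in> carrier G" by (rule gam_closed(4)[OF x(1)])
  have x2: "x \<in> gam 2" using x(1) gam_antimono[of 2 i] i by auto
  have xt_notin: "x \<otimes> t \<notin> H" if H: "subgroup H G" "gam 2 \<subseteq> H" "t \<notin> H" for H
  proof
    assume "x \<otimes> t \<in> H"
    then have "inv x \<otimes> (x \<otimes> t) \<in> H"
      using subgroup.m_closed[OF H(1)] subgroup.m_inv_closed[OF H(1)] H(2) x2 by blast
    then show False using H(3) xc t(1) by (simp add: inv_cancel_left)
  qed
  have xtp: "(x \<otimes> t) [^] p \<in> gam (Suc m)"
  proof (rule pow_p_in_gam)
    show "x \<otimes> t \<notin> gam 2" using xt_notin[OF gam_subgroup[of 2]] t2 by blast
    show "x \<otimes> t \<notin> two_step d" if "2 \<le> d" "d < Suc m" for d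
      using xt_notin[OF two_step_subgroup[of d]] maximal_overD(2)[OF two_step_maximal_over[of d]] t_low[of d] that m
      by auto
  qed (use xc t m m4 in auto)
  have u_exact: "u t x k \<notin> gam (Suc (i + k))" if "i + k \<le> m" for k
    using that
  proof (induction k)
    case 0
    then show ?case using x by (simp add: u0)
  next
    case (Suc k)
    then have "u t x k \<notin> gam (Suc (i + k))" by simp
    then show ?case
      using not_in_two_step(2)[OF _ _ u_gam[OF t(1) x(1)] _ t(1) t_low] Suc.prems i m by (simp add: u_Suc)
  qed
  let ?l = "u t x (p - 1)"
  have l: "?l \<in> gam m" "?l \<notin> gam (Suc m)"
    using u_gam[OF t(1) x(1), of "p - 1"] u_exact[of "p - 1"] i p2 by simp_all
  have lc: "?l \<in> carrier G" by (rule gam_closed(4)[OF l(1)])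
  have KS: "K \<subseteq> gam (Suc m)" unfolding K_def by (rule gam_Suc_subset)
  have "(x \<otimes> t) [^] p \<otimes> inv (x [^] p \<otimes> ?l \<otimes> t [^] p) \<in> K"
    using expand[OF t(1) x(1) order_refl triv] normal_coset_eq[OF K, of "(x \<otimes> t) [^] p" "x [^] p \<otimes> ?l \<otimes> t [^] p"]
      xc lc t(1) by simp
  then have "inv ((x \<otimes> t) [^] p) \<otimes> ((x \<otimes> t) [^] p \<otimes> inv (x [^] p \<otimes> ?l \<otimes> t [^] p)) \<in> gam (Suc m)"
    using gam_closed(2,3) xtp KS by blast
  then have "inv (x [^] p \<otimes> ?l \<otimes> t [^] p) \<in> gam (Suc m)"
    using xc lc t(1) by (simp add: inv_cancel_left del: nat_pow_Suc)
  then have "inv (inv (x [^] p \<otimes> ?l \<otimes> t [^] p)) \<in> gam (Suc m)" by (rule gam_closed(3))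
  then have "(x [^] p \<otimes> ?l \<otimes> t [^] p) \<otimes> inv (t [^] p) \<in> gam (Suc m)"
    using gam_closed(2,3) tp xc lc t(1) by simp
  then have xl: "x [^] p \<otimes> ?l \<in> gam (Suc m)" using xc lc t(1) by (simp add: m_assoc)
  have xp: "x [^] p \<in> gam m"
  proof -
    have "(x [^] p \<otimes> ?l) \<otimes> inv ?l \<in> gam m"
      using gam_closed(2,3) l(1) xl gam_Suc_subset[of m] by blast
    then show ?thesis using xc lc by (simp add: m_assoc)
  qed
  have xp': "x [^] p \<notin> gam (Suc m)"
  proof
    assume "x [^] p \<in> gam (Suc m)"
    then have "inv (x [^] p) \<otimes> (x [^] p \<otimes> ?l) \<in> gam (Suc m)" using gam_closed(2,3) xl by blast
    then show False using l(2) xc lc by (simp add: inv_cancel_left)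
  qed
  \<comment> \<open>Commutation with \<open>t\<close> raises the exact weight \<open>m\<close> of
    \<open>x [^] p\<close> by one. By equivariance, however, the result is the \<open>p\<close>-th
    power of \<open>commutator t x\<close> modulo \<open>K\<close>, and that is trivial by
    \<open>exponent\<close>.\<close>
  have notK: "commutator t (x [^] p) \<notin> K"
    unfolding K_def by (rule not_in_two_step(2)[OF _ _ xp xp' t(1,3)]) (use m m4 in auto)
  let ?y = "commutator t x"
  have y: "?y \<in> gam (Suc i)" by (rule commutator_in_gam_Suc(2)[OF x(1) t(1)])
  then have yi: "?y \<in> gam i" and yp: "?y [^] p \<in> K" using gam_Suc_subset triv by blast+
  have "commutator t (x [^] p) \<otimes> x [^] p = (?y \<otimes> x) [^] p"
    using conj_pow[OF t(1) xc, of p] t(1) xc by (simp add: conj_eq_commutator)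
  then have "K #> (commutator t (x [^] p) \<otimes> x [^] p) = K #> (?y [^] p \<otimes> x [^] p)"
    using distrib[OF yi x(1)] by simp
  then have "commutator t (x [^] p) \<otimes> inv (?y [^] p) \<in> K"
    using normal_coset_eq[OF K, of "commutator t (x [^] p) \<otimes> x [^] p" "?y [^] p \<otimes> x [^] p"] t(1) xc
    by (simp add: inv_mult_group m_assoc inv_cancel_left)
  then have "(commutator t (x [^] p) \<otimes> inv (?y [^] p)) \<otimes> ?y [^] p \<in> K" using Kc(2) yp by blast
  then show False using notK t(1) xc by (simp add: m_assoc)
qed

end

section \<open>Elements with small centralizer\<close>

context maximal_class_group
begin

text \<open>The first index \<open>m\<close> with a new centralizer is below \<open>2 * p\<close>,
  but any \<open>m\<close> other than \<open>n - 2\<close> would satisfy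
  \<open>p \<le> m div 2\<close>. So only the last centralizer can deviate.\<close>

lemma two_step_cases:
  assumes d: "2 \<le> d" "Suc d < n"
  shows "two_step d = two_step 2 \<or> two_step d = two_step (n - 2) \<and> 3 \<le> p"
proof (cases "two_step d = two_step 2")
  case False
  let ?Q = "\<lambda>d. 2 \<le> d \<and> Suc d < n \<and> two_step d \<noteq> two_step 2"
  define m where "m = (LEAST d. ?Q d)"
  have m: "2 \<le> m" "Suc m < n" "two_step m \<noteq> two_step 2"
    using LeastI[of ?Q d] d False unfolding m_def by blast+
  have "m \<noteq> 2" using m(3) by blast
  then have m3: "3 \<le> m" using m(1) by simp
  have same: "two_step e = two_step 2" if "2 \<le> e" "e < m" for e
    using not_less_Least[of e ?Q] that m(2) unfolding m_def[symmetric] by auto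
  have late: "m < 2 * p"
    using no_late_deviation[OF _ m(2) _ m(3)] same by (meson not_le)
  have "even m" by (rule first_deviation(1)[OF m3 m(2) _ m(3)]) (rule same)
  have "\<not> Suc (Suc m) < n"
  proof
    assume *: "Suc (Suc m) < n"
    have "p dvd m div 2" by (rule first_deviation(2)[OF m3 m(2) _ m(3) *]) (rule same)
    then have "p \<le> m div 2" using m3 by (intro dvd_imp_le) auto
    then show False using late by simp
  qed
  then have "m = n - 2" using m(2) by simp
  moreover have "d = m"
  proof -
    have "d \<le> m" using d(2) \<open>m = n - 2\<close> by simp
    moreover have "\<not> d < m" using same[of d] False d(1) by blast
    ultimately show ?thesis by simp
  qed
  \<comment> \<open>As \<open>m\<close> is even and at least 4, the bound \<open>m < 2 * p\<close>
    rules out \<open>p = 2\<close>. This matters because only \<open>p\<close> maximal subgroups can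
    be avoided.\<close>
  moreover have "3 \<le> p" using late m3 \<open>even m\<close> prime_ge_2_nat[OF prime_p]
    by (cases "p = 2") (auto elim!: evenE)
  ultimately show ?thesis by simp
qed simp

definition uniform :: "'a \<Rightarrow> bool"
  where "uniform x \<longleftrightarrow> x \<in> carrier G \<and> x \<notin> gam 2 \<and> (\<forall>d. 2 \<le> d \<longrightarrow> Suc d < n \<longrightarrow> x \<notin> two_step d)"

lemma uniformD:
  assumes "uniform x"
  shows "x \<in> carrier G" "x \<notin> gam 2" "card (centralizer G x) = p ^ 2"
    "centralizer G x \<inter> gam 2 = gam (n - 1)"
  using assms card_centralizer_uniform[of x] by (auto simp: uniform_def)

text \<open>Reads the weight of \<open>y\<close> off from that of its commutator with
  \<open>x\<close>; in \<open>normal_subset_P_if_centralizer\<close> this shows that elements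
  commuting with \<open>x\<close> preserve weights.\<close>

lemma uniform_commutator:
  assumes x: "uniform x" and y: "y \<in> gam 2" and d: "2 \<le> d" "d < n" "commutator x y \<in> gam (Suc d)"
  shows "y \<in> gam d"
proof (rule ccontr)
  assume "y \<notin> gam d"
  then obtain e where e: "2 \<le> e" "e < d" "y \<in> gam e" "y \<notin> gam (Suc e)" using gam_level[OF y] by blast
  have "x \<notin> two_step e" using x e(1,2) d(2) by (simp add: uniform_def)
  then have "commutator x y \<notin> gam (Suc (Suc e))"
    using not_in_two_step(2)[OF e(1) _ e(3,4) uniformD(1)[OF x]] e(2) d(2) by simp
  then show False using gam_antimono[of "Suc (Suc e)" "Suc d"] e(2) d(3) by auto
qed

text \<open>As \<open>gam 2\<close> consists of nongenerators, \<open>D <#> gam 2\<close> is proper.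
  It meets \<open>K\<close> in more than \<open>gam 2\<close>, hence contains \<open>K\<close> and
  equals it. This is the trap that controls fusion.\<close>

lemma proper_subgroup_subset_maximal_over:
  assumes D: "subgroup D G" "D \<noteq> carrier G" and K: "maximal_over K"
    and x: "x \<in> D" "x \<in> K" "x \<notin> gam 2"
  shows "D \<subseteq> K"
proof
  fix y assume y: "y \<in> D"
  let ?E = "D <#> gam 2"
  note E = subgroup_set_mult_gam[OF D(1), of 2] and DE = subset_set_mult_gam[OF D(1), of 2]
  have I: "subgroup (?E \<inter> K) G" by (rule subgroups_Inter_pair[OF E maximal_overD(1)[OF K]])
  have "?E \<inter> K = gam 2 \<or> ?E \<inter> K = K"
    using subgroup_between_prime_index[OF prime_p fin gam_subgroup maximal_overD(1)[OF K] I _ _ maximal_overD(6)[OF K]]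
      DE(2) maximal_overD(2)[OF K] by blast
  then have KE: "K \<subseteq> ?E" using x DE(1) by blast
  show "y \<in> K"
  proof (rule ccontr)
    assume "y \<notin> K"
    then have "?E = carrier G" using maximal_over_maximal[OF K E KE, of y] y DE(1) by blast
    then show False using frattini[OF D(1)] D(2) by blast
  qed
qed

lemma maximal_over_ex:
  assumes x: "x \<in> carrier G" "x \<notin> gam 2"
  obtains K where "maximal_over K" "x \<in> K"
  using commutator_kernel_maximal_over[OF x] commutator_self_gam[OF x(1)] x(1) that by blast

lemma proper_subgroup_maximal_over_ex:
  assumes N: "subgroup N G" "gam 2 \<subseteq> N" "N \<noteq> carrier G"
  obtains K where "maximal_over K" "N \<subseteq> K"
proof (cases "N = gam 2")
  case True
  obtain x where "x \<in> carrier G" "x \<notin> gam 2" using N(3) subgroup.subset[OF N(1)] True by blast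
  then obtain K where "maximal_over K" using maximal_over_ex by blast
  then show thesis using that True maximal_overD(2) by blast
next
  case False
  then obtain x where x: "x \<in> N" "x \<notin> gam 2" using N(2) by blast
  then have "x \<in> carrier G" using subgroup.subset[OF N(1)] by blast
  then obtain K where "maximal_over K" "x \<in> K" using maximal_over_ex x(2) by blast
  then show thesis using that proper_subgroup_subset_maximal_over[OF N(1,3)] x by blast
qed

text \<open>Uniformity depends only on the maximal subgroup through an element outside
  \<open>gam 2\<close>, so it suffices to find one element avoiding \<open>N\<close> and the at most
  two different two-step centralizers.\<close>

lemma uniform_maximal_over_ex:
  assumes N: "maximal_over N"
  obtains K where "maximal_over K" "K \<noteq> N" "\<And>y. y \<in> K \<Longrightarrow> y \<notin> gam 2 \<Longrightarrow> uniform y"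
proof -
  \<comment> \<open>For \<open>n = 3\<close> there is no two-step centralizer to avoid, and
    \<open>two_step 2\<close> is not maximal. For \<open>p = 2\<close> all of them equal
    \<open>two_step 2\<close>, which keeps the number of subgroups at most \<open>p\<close>.\<close>
  define F where "F = (if n = 3 then {N} else if p = 2 then {N, two_step 2} else {N, two_step 2, two_step (n - 2)})"
  have p2: "2 \<le> p" by (rule prime_ge_2_nat[OF prime_p])
  have "finite F" by (simp add: F_def)
  moreover have "card F \<le> p"
  proof -
    have "card {N, two_step 2, two_step (n - 2)} \<le> 3"
      using card_insert_le_m1[of 3 "{two_step 2, two_step (n - 2)}" N] card_insert_le_m1[of 2 "{two_step (n - 2)}" "two_step 2"]
      by simp
    moreover have "card {N, two_step 2} \<le> 2" using card_insert_le_m1[of 2 "{two_step 2}" N] by simp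
    ultimately show ?thesis using p2 unfolding F_def by auto
  qed
  moreover have F: "maximal_over H" if H: "H \<in> F" for H
  proof (cases "n = 3")
    case True
    then show ?thesis using H N by (simp add: F_def)
  next
    case False
    then have "H = N \<or> H = two_step 2 \<or> H = two_step (n - 2)" using H by (auto simp: F_def split: if_splits)
    moreover have "maximal_over (two_step 2)" by (rule two_step_maximal_over) (use False n_ge in auto)
    moreover have "maximal_over (two_step (n - 2))" by (rule two_step_maximal_over) (use False n_ge in auto)
    ultimately show ?thesis using N by blast
  qed
  ultimately obtain x where x: "x \<in> carrier G" "x \<notin> \<Union>F" using avoid_maximal_subgroups by blast
  have NF: "N \<in> F" by (simp add: F_def)
  then have x2: "x \<notin> gam 2" using x(2) maximal_overD(2)[OF N] by blast
  obtain K where K: "maximal_over K" "x \<in> K" using maximal_over_ex[OF x(1) x2] .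
  have "uniform y" if y: "y \<in> K" "y \<notin> gam 2" for y
  proof -
    have "y \<notin> two_step d" if d: "2 \<le> d" "Suc d < n" for d
    proof
      assume "y \<in> two_step d"
      then have "two_step d = K"
        using maximal_over_unique[OF two_step_maximal_over[OF d] K(1) _ y] by blast
      then have "x \<in> two_step d" using K(2) by simp
      moreover have "two_step d \<in> F"
      proof -
        have "n \<noteq> 3" using d by simp
        moreover have "two_step d = two_step 2 \<or> two_step d = two_step (n - 2) \<and> p \<noteq> 2"
          using two_step_cases[OF d] by fastforce
        ultimately show ?thesis unfolding F_def by (elim disjE conjE) simp_all
      qed
      ultimately show False using x(2) by blast
    qed
    then show ?thesis using y maximal_overD(4)[OF K(1)] by (auto simp: uniform_def)
  qed
  then show thesis using that[OF K(1)] K(2) NF x(2) by blast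
qed

text \<open>Commutation with suitable elements produces members of \<open>L\<close> of every exact
  weight from \<open>d\<close> to \<open>n - 1\<close>; as the factors have order \<open>p\<close>,
  these fill \<open>gam d\<close> from the bottom up.\<close>

lemma normal_gam_subset:
  assumes L: "L \<lhd> G" and l: "l \<in> L" "l \<in> gam d" "l \<notin> gam (Suc d)" and d: "2 \<le> d"
  shows "gam d \<subseteq> L"
proof -
  have dn: "d < n" using l gam_eq_one[of d] gam_closed(1)[of "Suc d"] by (metis not_le singletonD)
  have ex: "\<exists>l\<in>L. l \<in> gam (d + k) \<and> l \<notin> gam (Suc (d + k))" if "d + k < n" for k
    using that
  proof (induction k)
    case (Suc k)
    then obtain l where l: "l \<in> L" "l \<in> gam (d + k)" "l \<notin> gam (Suc (d + k))" by auto
    have dk: "2 \<le> d + k" "Suc (d + k) < n" using d Suc.prems by simp_all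
    obtain h where h: "h \<in> carrier G" "h \<notin> two_step (d + k)"
      using maximal_over_neq(1)[OF two_step_maximal_over[OF dk]] subgroup.subset[OF two_step_subgroup] by blast
    have "commutator l h \<in> L" by (rule normal_commutator(1)[OF L l(1) h(1)])
    moreover have "commutator l h \<in> gam (d + Suc k)" using commutator_in_gam_Suc(1)[OF l(2) h(1)] by simp
    moreover have "commutator l h \<notin> gam (Suc (d + Suc k))" using not_in_two_step(1)[OF dk l(2,3) h] by simp
    ultimately show ?case by blast
  qed (use l in auto)
  have "gam (n - k) \<subseteq> L" if "k \<le> n - d" for k
    using that
  proof (induction k)
    case 0
    then show ?case using gam_n normal_closed(1)[OF L] by simp
  next
    case (Suc k)
    define j where "j = n - Suc k"
    have j: "2 \<le> j" "j < n" "Suc j = n - k" "d \<le> j" using Suc.prems d dn by (auto simp: j_def)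
    obtain l where l: "l \<in> L" "l \<in> gam j" "l \<notin> gam (Suc j)" using ex[of "j - d"] j by auto
    have "gam (Suc j) \<subseteq> gam j \<inter> L" using Suc j gam_Suc_subset[of j] by auto
    then have "gam j \<inter> L = gam (Suc j) \<or> gam j \<inter> L = gam j"
      using subgroup_between_prime_index[OF prime_p fin gam_subgroup gam_subgroup
          subgroups_Inter_pair[OF gam_subgroup normal_imp_subgroup[OF L]], of "Suc j" j j] card_gam_Suc[OF j(1,2)]
      by blast
    then have "gam j \<subseteq> L" using l by blast
    then show ?case by (simp add: j_def)
  qed
  from this[of "n - d"] dn show ?thesis by simp
qed

lemma normal_gam_2_subset:
  assumes L: "L \<lhd> G" and y: "y \<in> L" "y \<notin> gam 2"
  shows "gam 2 \<subseteq> L"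
proof -
  have yc: "y \<in> carrier G" by (rule normal_closed(4)[OF L y(1)])
  let ?K = "{h \<in> carrier G. commutator y h \<in> gam 3}"
  have K: "maximal_over ?K" by (rule commutator_kernel_maximal_over[OF yc y(2)])
  then obtain h where h: "h \<in> carrier G" "h \<notin> ?K" using maximal_over_neq(1)[OF K] by blast
  have "commutator y h \<in> L" by (rule normal_commutator(1)[OF L y(1) h(1)])
  moreover have "commutator y h \<in> gam 2" using commutator_in_gam_Suc(1)[of y 1 h] yc h(1) by (simp add: numeral_2_eq_2)
  moreover have "commutator y h \<notin> gam (Suc 2)" using h by simp
  ultimately show ?thesis using normal_gam_subset[OF L] by blast
qed

lemma gam_2_subset_normal:
  assumes H: "subgroup H G" "gam 2 \<subseteq> H"
  shows "H \<lhd> G"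
proof (rule normal_invI[OF H(1)])
  fix g h assume gh: "g \<in> carrier G" "h \<in> H"
  have hc: "h \<in> carrier G" by (rule subgroup.mem_carrier[OF H(1) gh(2)])
  have "commutator g h \<in> gam 2" using commutator_in_gam_Suc(1)[of g 1 h] hc gh(1) by (simp add: numeral_2_eq_2)
  then show "g \<otimes> h \<otimes> inv g \<in> H"
    using subgroup.m_closed[OF H(1) _ gh(2)] H(2) hc gh(1) by (auto simp: conj_eq_commutator)
qed

end

section \<open>Sylow subgroups of maximal class\<close>

locale sylow_maximal_class = group G for G :: "('a, 'b) monoid_scheme" (structure) +
  fixes p n :: nat and P :: "'a set"
  assumes prime_p: "Factorial_Ring.prime p"
    and fin: "finite (carrier G)"
    and P_subgroup: "subgroup P G"
    and card_P: "card P = p_part p (order G)"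
    and P_maximal_class: "maximal_class_group (G\<lparr>carrier := P\<rparr>) p n"
begin

abbreviation "GP \<equiv> G\<lparr>carrier := P\<rparr>"
abbreviation "\<Gamma> \<equiv> group.gam GP"
abbreviation "P_uniform \<equiv> maximal_class_group.uniform GP n"

lemmas P_carrier = subgroup.mem_carrier[OF P_subgroup]

lemma P_commutator:
  assumes "x \<in> P" "y \<in> P"
  shows "group.commutator GP x y = commutator x y"
proof -
  interpret P: maximal_class_group GP p n by (rule P_maximal_class)
  show ?thesis using assms P_subgroup by (simp add: P.commutator_def commutator_def m_inv_consistent)
qed

lemma P_centralizer: "centralizer GP x = centralizer G x \<inter> P"
  using P_carrier by (auto simp: centralizer_def)

lemma card_P_eq: "card P = p ^ n"
  using maximal_class_group.order_G[OF P_maximal_class] by (simp add: order_def)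

lemma centralizer_subgroup: "x \<in> carrier G \<Longrightarrow> subgroup (centralizer G x) G"
proof -
  assume x: "x \<in> carrier G"
  have "centralizer G x = {g \<in> carrier G. \<forall>a\<in>{x}. commutator a g \<in> {\<one>}}"
    using x by (auto simp: centralizer_def commutator_eq_one_iff)
  then show ?thesis using subgroup_commutator_in[OF one_is_normal, of "{x}"] x by simp
qed

lemma p_subgroup_conj_into_P:
  assumes "subgroup Q G" "card Q = p ^ k"
  obtains g where "g \<in> carrier G" "conj_set g Q \<subseteq> P"
  using sylow_conjugate[OF prime_p fin P_subgroup card_P assms] .

section \<open>Control of fusion in the Sylow subgroup\<close>

lemma subgroup_normalizer:
  assumes "D \<subseteq> carrier G"
  shows "subgroup {g \<in> carrier G. conj_set g D = D} G"
proof (rule subgroupI)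
  show "{g \<in> carrier G. conj_set g D = D} \<noteq> {}" using conj_set_one[OF assms] by auto
  show "inv g \<in> {g \<in> carrier G. conj_set g D = D}" if "g \<in> {g \<in> carrier G. conj_set g D = D}" for g
    using that conj_set_inv_swap[of g D] assms by simp
  show "g \<otimes> h \<in> {g \<in> carrier G. conj_set g D = D}"
    if "g \<in> {g \<in> carrier G. conj_set g D = D}" "h \<in> {g \<in> carrier G. conj_set g D = D}" for g h
    using that assms conj_set_conj_set[of g h D] by simp
qed auto

text \<open>\<open>A\<close> and \<open>B\<close> can be conjugated within \<open>J\<close> into one
  Sylow subgroup of \<open>J\<close>, which is then moved into \<open>P\<close>. The result is
  phrased so that the two conjugations differ by an element of \<open>J\<close> only.\<close>

lemma common_sylow_of_subgroup:
  assumes J: "subgroup J G" and A: "subgroup A G" "A \<subseteq> J" "card A = p ^ a"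
    and B: "subgroup B G" "B \<subseteq> J" "card B = p ^ b"
  obtains g j where "g \<in> carrier G" "j \<in> J" "conj_set g A \<subseteq> P" "conj_set (g \<otimes> j) B \<subseteq> P"
proof -
  interpret J: group "G\<lparr>carrier := J\<rparr>" using subgroup_imp_group[OF J] .
  have finJ: "finite J" by (rule finite_subgroup[OF fin J])
  obtain T where T: "subgroup T G" "T \<subseteq> J" "card T = p_part p (card J)"
    using sylow_exists[OF prime_p fin J] .
  have J_conj: "J.conj_set j X = conj_set j X" if "j \<in> J" for j X
    using that J by (simp add: J.conj_set_def conj_set_def m_inv_consistent)
  have in_T: "\<exists>j\<in>J. conj_set j X \<subseteq> T" if X: "subgroup X G" "X \<subseteq> J" "card X = p ^ k" for X k
  proof -
    obtain j where "j \<in> J" "J.conj_set j X \<subseteq> T"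
      using J.sylow_conjugate[OF prime_p _ subgroup_incl[OF T(1) J T(2)] _ subgroup_incl[OF X(1) J X(2)] X(3)] finJ T(3)
      by (auto simp: order_def)
    then show ?thesis using J_conj by auto
  qed
  obtain x where x: "x \<in> J" "conj_set x A \<subseteq> T" using in_T[OF A] by blast
  obtain y where y: "y \<in> J" "conj_set y B \<subseteq> T" using in_T[OF B] by blast
  obtain h where h: "h \<in> carrier G" "conj_set h T \<subseteq> P"
    using p_subgroup_conj_into_P[OF T(1)] T(3) unfolding p_part_def by blast
  note xc = subgroup.mem_carrier[OF J x(1)] and yc = subgroup.mem_carrier[OF J y(1)]
  have "conj_set (h \<otimes> x) A \<subseteq> P"
    using conj_set_mono[OF x(2), of h] h conj_set_conj_set[OF h(1) xc subgroup.subset[OF A(1)]] by blast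
  moreover have "conj_set (h \<otimes> y) B \<subseteq> P"
    using conj_set_mono[OF y(2), of h] h conj_set_conj_set[OF h(1) yc subgroup.subset[OF B(1)]] by blast
  moreover have "h \<otimes> y = (h \<otimes> x) \<otimes> (inv x \<otimes> y)" using h(1) xc yc by (simp add: m_assoc inv_cancel_left)
  moreover have "inv x \<otimes> y \<in> J" using x(1) y(1) subgroup.m_closed[OF J] subgroup.m_inv_closed[OF J] by blast
  ultimately show thesis using that[of "h \<otimes> x" "inv x \<otimes> y"] h(1) xc by auto
qed

lemma conj_into_iff:
  assumes "g \<in> carrier G" "A \<subseteq> carrier G" "B \<subseteq> carrier G"
  shows "conj_set g A \<subseteq> B \<longleftrightarrow> A \<subseteq> conj_set (inv g) B"
proof
  assume "conj_set g A \<subseteq> B"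
  from conj_set_mono[OF this, of "inv g"] show "A \<subseteq> conj_set (inv g) B"
    using conj_set_inv_swap[OF assms(1,2)] by simp
next
  assume "A \<subseteq> conj_set (inv g) B"
  from conj_set_mono[OF this, of g] show "conj_set g A \<subseteq> B"
    using conj_set_inv_swap[of "inv g" B] assms by simp
qed

text \<open>The induction in the next lemma is Alperin's: two Sylow subgroups through \<open>y\<close> are linked by Sylow
  subgroups of larger intersection, via a common Sylow subgroup of the normalizer of the
  intersection.\<close>

lemma conj_in_maximal_over:
  assumes M: "M \<lhd> G" "\<Gamma> 2 \<subseteq> M"
    and K: "maximal_class_group.maximal_over GP p n K"
    and g: "g1 \<in> carrier G" "g2 \<in> carrier G"
    and y: "y \<in> conj_set g1 K" "y \<in> conj_set g2 P" "y \<notin> M"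
  shows "\<exists>h\<in>carrier G. conj_set h P = conj_set g2 P \<and> y \<in> conj_set h K"
  using g y
proof (induction "card P - card (conj_set g1 P \<inter> conj_set g2 P)" arbitrary: g1 g2 y rule: less_induct)
  case less
  interpret P: maximal_class_group GP p n by (rule P_maximal_class)
  have KP: "K \<subseteq> P" using P.maximal_overD(4)[OF K] by simp
  note Pc = subgroup.subset[OF P_subgroup]
  have Kc: "K \<subseteq> carrier G" using KP Pc by blast
  let ?S1 = "conj_set g1 P" and ?S2 = "conj_set g2 P"
  let ?D = "?S1 \<inter> ?S2"
  have S: "subgroup ?S1 G" "subgroup ?S2 G" using conj_set_subgroup P_subgroup less.prems(1,2) by blast+
  have cS: "card ?S1 = card P" "card ?S2 = card P" using card_conj_set Pc less.prems(1,2) by blast+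
  have finS: "finite ?S1" "finite ?S2" using finite_subgroup[OF fin] S by blast+
  have D: "subgroup ?D G" by (rule subgroups_Inter_pair[OF S])
  have Dc: "?D \<subseteq> carrier G" by (rule subgroup.subset[OF D])
  have yD: "y \<in> ?D" using less.prems(3,4) conj_set_mono[OF KP] by blast
  have yc: "y \<in> carrier G" using yD Dc by blast
  show ?case
  proof (cases "?S1 = ?S2")
    case True
    then show ?thesis using less.prems by blast
  next
    case False
    have sub1: "?D \<subset> ?S1" using False card_subset_eq[OF finS(2)] cS by auto
    have sub2: "?D \<subset> ?S2" using False card_subset_eq[OF finS(1)] cS by auto
    let ?J = "{g \<in> carrier G. conj_set g ?D = ?D}"
    have J: "subgroup ?J G" by (rule subgroup_normalizer[OF Dc])
    \<comment> \<open>The normalizers of the intersection in the two Sylow subgroups; both are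
      strictly larger than it, which drives the induction.\<close>
    let ?A = "?S1 \<inter> ?J" and ?B = "?S2 \<inter> ?J"
    have A: "subgroup ?A G" "?A \<subseteq> ?J" and B: "subgroup ?B G" "?B \<subseteq> ?J"
      using subgroups_Inter_pair[OF S(1) J] subgroups_Inter_pair[OF S(2) J] by auto
    have DJ: "?D \<subseteq> ?J"
    proof
      fix d assume d: "d \<in> ?D"
      then have dc: "d \<in> carrier G" using Dc by blast
      have "d \<otimes> x \<otimes> inv d \<in> ?D" if "x \<in> ?D" for x
        using d that subgroup.m_closed[OF D] subgroup.m_inv_closed[OF D] by blast
      then have "conj_set d ?D \<subseteq> ?D" unfolding conj_set_def by blast
      then have "conj_set d ?D = ?D"
        using card_subset_eq[OF finite_subgroup[OF fin D]] card_conj_set[OF dc Dc] by blast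
      then show "d \<in> ?J" using dc by blast
    qed
    have DA: "?D \<subset> ?A"
    proof -
      obtain g where "g \<in> ?S1" "g \<notin> ?D" "conj_set g ?D = ?D"
        using normalizer_grows[OF prime_p fin D S(1) sub1] cS(1) card_P_eq by metis
      then have "g \<in> ?A" "g \<notin> ?D" using subgroup.subset[OF S(1)] by auto
      then show ?thesis using DJ by blast
    qed
    have DB: "?D \<subset> ?B"
    proof -
      obtain g where "g \<in> ?S2" "g \<notin> ?D" "conj_set g ?D = ?D"
        using normalizer_grows[OF prime_p fin D S(2) sub2] cS(2) card_P_eq by metis
      then have "g \<in> ?B" "g \<notin> ?D" using subgroup.subset[OF S(2)] by auto
      then show ?thesis using DJ by blast
    qed
    obtain a where a: "card ?A = p ^ a"
      using card_subgroup_prime_power[OF prime_p A(1) S(1) Int_lower1] cS(1) card_P_eq by metis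
    obtain b where b: "card ?B = p ^ b"
      using card_subgroup_prime_power[OF prime_p B(1) S(2) Int_lower1] cS(2) card_P_eq by metis
    obtain c j where c: "c \<in> carrier G" "j \<in> ?J" "conj_set c ?A \<subseteq> P" "conj_set (c \<otimes> j) ?B \<subseteq> P"
      using common_sylow_of_subgroup[OF J A a B b] .
    have jc: "j \<in> carrier G" using c(2) by blast
    have A0: "?A \<subseteq> conj_set (inv c) P"
      using conj_into_iff[OF c(1) subgroup.subset[OF A(1)] Pc] c(3) by blast
    have B0: "?B \<subseteq> conj_set (inv (c \<otimes> j)) P"
      using conj_into_iff[of "c \<otimes> j", OF _ subgroup.subset[OF B(1)] Pc] c jc by blast
    let ?S0 = "conj_set (inv c) P" and ?S0' = "conj_set (inv (c \<otimes> j)) P"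
    have S0: "subgroup ?S0 G" using conj_set_subgroup P_subgroup c(1) by blast
    have smaller: "card P - card X < card P - card ?D" if "?D \<subset> X" "X \<subseteq> ?S1 \<or> X \<subseteq> ?S2" for X
    proof -
      have X: "finite X \<and> card X \<le> card P"
        using that(2) finite_subset[OF _ finS(1), of X] finite_subset[OF _ finS(2), of X]
          card_mono[OF finS(1), of X] card_mono[OF finS(2), of X] cS by auto
      then have "card ?D < card X" using psubset_card_mono[OF _ that(1)] by blast
      then show ?thesis using X by linarith
    qed
    have "\<exists>h\<in>carrier G. conj_set h P = ?S0 \<and> y \<in> conj_set h K"
    proof (rule less.hyps)
      show "card P - card (?S1 \<inter> ?S0) < card P - card ?D"
      proof (rule smaller)
        have "?A \<subseteq> ?S1 \<inter> ?S0" using A0 by simp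
        then show "?D \<subset> ?S1 \<inter> ?S0" using DA by (rule psubset_subset_trans[rotated])
      qed simp
      have "y \<in> ?A" using yD psubset_imp_subset[OF DA] by (rule subsetD[rotated])
      then show "y \<in> ?S0" by (rule subsetD[OF A0])
      show "inv c \<in> carrier G" using c(1) by simp
    qed (rule less.prems)+
    then obtain h where h: "h \<in> carrier G" "conj_set h P = ?S0" "y \<in> conj_set h K" by blast
    have "?D \<subset> ?S0" using DA A0 by (rule psubset_subset_trans)
    \<comment> \<open>The core of the argument: pulled back by \<open>h\<close>, the intersection is
      a proper subgroup of \<open>P\<close> containing a conjugate of \<open>y\<close> that lies in
      \<open>K\<close> outside \<open>\<Gamma> 2\<close>, so all of it is trapped in
      \<open>K\<close>.\<close>
    have DK: "?D \<subseteq> conj_set h K"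
    proof -
      let ?D' = "conj_set (inv h) ?D"
      have D': "subgroup ?D' G" using conj_set_subgroup D h(1) by blast
      have "?D' \<subseteq> P" using conj_into_iff[of "inv h", OF _ Dc Pc] \<open>?D \<subset> ?S0\<close> h(1,2) by auto
      moreover have "?D' \<noteq> P"
      proof
        assume "?D' = P"
        then have "conj_set h P = ?D" using conj_set_inv_swap[of "inv h" ?D] h(1) Dc by simp
        then show False using h(2) \<open>?D \<subset> ?S0\<close> by blast
      qed
      moreover have y': "inv h \<otimes> y \<otimes> h \<in> ?D'"
      proof -
        have "inv h \<otimes> y \<otimes> inv (inv h) \<in> ?D'" unfolding conj_set_def[of "inv h"] using yD by (rule imageI)
        then show ?thesis using h(1) by simp
      qed
      moreover have "inv h \<otimes> y \<otimes> h \<in> K" using mem_conj_set_iff[OF h(1) Kc yc] h(3) by blast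
      moreover have "inv h \<otimes> y \<otimes> h \<notin> \<Gamma> 2"
      proof
        assume "inv h \<otimes> y \<otimes> h \<in> \<Gamma> 2"
        then have "inv h \<otimes> y \<otimes> h \<in> M" using M(2) by blast
        then have "h \<otimes> (inv h \<otimes> y \<otimes> h) \<otimes> inv h \<in> M" using normal_conj(1)[OF M(1) _ h(1)] by blast
        then show False using less.prems(5) conj_inv_cancel(2)[OF h(1) yc] by simp
      qed
      ultimately have "?D' \<subseteq> K"
        using P.proper_subgroup_subset_maximal_over[OF subgroup_incl[OF D' P_subgroup] _ K] by simp
      then show ?thesis using conj_into_iff[of "inv h", OF _ Dc Kc] h(1) by simp
    qed
    \<comment> \<open>As \<open>j\<close> normalizes the intersection, it moves \<open>y\<close>
      within the trap. This leads from \<open>?S0\<close> to the Sylow subgroup \<open>?S0'\<close>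
      containing \<open>?B\<close>, from where a second use of the induction reaches
      \<open>?S2\<close>.\<close>
    let ?z = "j \<otimes> y \<otimes> inv j"
    have zD: "?z \<in> ?D" using c(2) yD unfolding conj_set_def by blast
    then have zK: "?z \<in> conj_set h K" using DK by blast
    have eq: "inv (c \<otimes> j) = inv j \<otimes> inv c" using c(1) jc by (simp add: inv_mult_group)
    have hP: "conj_set (inv j \<otimes> h) P = ?S0'"
      using conj_set_conj_set[of "inv j" h P] conj_set_conj_set[of "inv j" "inv c" P] h c(1) jc Pc eq by simp
    have hK: "y \<in> conj_set (inv j \<otimes> h) K"
    proof -
      have "inv j \<otimes> ?z \<otimes> inv (inv j) \<in> conj_set (inv j) (conj_set h K)"
        unfolding conj_set_def[of "inv j"] using zK by blast
      moreover have "inv j \<otimes> ?z \<otimes> inv (inv j) = y" using conj_inv_cancel(1)[OF jc yc] jc by simp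
      ultimately show ?thesis using conj_set_conj_set[of "inv j" h K] h(1) jc Kc by simp
    qed
    show ?thesis
    proof (rule less.hyps[of "inv j \<otimes> h" g2 y])
      show "card P - card (conj_set (inv j \<otimes> h) P \<inter> ?S2) < card P - card ?D"
        unfolding hP
      proof (rule smaller)
        have "?B \<subseteq> ?S0' \<inter> ?S2" using B0 by simp
        then show "?D \<subset> ?S0' \<inter> ?S2" using DB by (rule psubset_subset_trans[rotated])
      qed simp
      show "inv j \<otimes> h \<in> carrier G" using h(1) jc by simp
    qed (rule less.prems hK)+
  qed
qed

text \<open>A Sylow subgroup \<open>T\<close> of the centralizer of \<open>x\<close> lies in some
  conjugate of \<open>P\<close>. There \<open>x\<close> again belongs to a conjugate of
  \<open>K\<close> and is outside \<open>M\<close>, hence corresponds to a uniform element of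
  \<open>P\<close>, and \<open>T\<close> has order at most \<open>p ^ 2\<close>.\<close>

lemma uniform_outside_normal:
  assumes M: "M \<lhd> G" "\<Gamma> 2 \<subseteq> M" "\<not> P \<subseteq> M"
  obtains x where "x \<in> P" "p_part p (card (centralizer G x)) = p ^ 2"
proof -
  interpret P: maximal_class_group GP p n by (rule P_maximal_class)
  note Pc = subgroup.subset[OF P_subgroup]
  have N: "subgroup (P \<inter> M) GP"
    using subgroup_incl[OF subgroups_Inter_pair[OF P_subgroup normal_imp_subgroup[OF M(1)]] P_subgroup] by blast
  have "\<Gamma> 2 \<subseteq> P" using subgroup.subset[OF P.gam_subgroup[of 2]] by simp
  then obtain N' where N': "P.maximal_over N'" "P \<inter> M \<subseteq> N'"
    using P.proper_subgroup_maximal_over_ex[OF N] M(2,3) by auto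
  obtain K where K: "P.maximal_over K" "K \<noteq> N'" "\<And>y. y \<in> K \<Longrightarrow> y \<notin> \<Gamma> 2 \<Longrightarrow> P.uniform y"
    using P.uniform_maximal_over_ex[OF N'(1)] by blast
  have KP: "K \<subseteq> P" using P.maximal_overD(4)[OF K(1)] by simp
  have Kc: "K \<subseteq> carrier G" using KP Pc by blast
  have "\<not> K \<subseteq> N'"
    using card_subset_eq[of N' K] P.maximal_overD(3)[OF K(1)] P.maximal_overD(3)[OF N'(1)] K(2)
      P.finite_subgroup[OF P.fin P.maximal_overD(1)[OF N'(1)]] by auto
  then obtain x where x: "x \<in> K" "x \<notin> N'" by blast
  have xP: "x \<in> P" using x(1) KP by blast
  have xM: "x \<notin> M" using x N'(2) xP by blast
  have xc: "x \<in> carrier G" using xP Pc by blast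
  have card_cent: "card (centralizer G y \<inter> P) = p ^ 2" if "y \<in> K" "y \<notin> M" for y
    using P.uniformD(3)[OF K(3)[OF that(1)]] that(2) M(2) P_centralizer by auto
  let ?C = "centralizer G x"
  have C: "subgroup ?C G" by (rule centralizer_subgroup[OF xc])
  interpret C: group "G\<lparr>carrier := ?C\<rparr>" using subgroup_imp_group[OF C] .
  obtain T where T: "subgroup T G" "T \<subseteq> ?C" "card T = p_part p (card ?C)"
    using sylow_exists[OF prime_p fin C] .
  have E: "subgroup (?C \<inter> P) G" by (rule subgroups_Inter_pair[OF C P_subgroup])
  obtain c where c: "c \<in> ?C" "C.conj_set c (?C \<inter> P) \<subseteq> T"
    using C.sylow_conjugate[OF prime_p _ subgroup_incl[OF T(1) C T(2)] _ subgroup_incl[OF E C Int_lower1], of 2]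
      finite_subgroup[OF fin C] T(3) card_cent[OF x(1) xM] by (auto simp: order_def)
  have conjC: "conj_set c (?C \<inter> P) \<subseteq> T"
    using c C by (simp add: C.conj_set_def conj_set_def m_inv_consistent)
  have cc: "c \<in> carrier G" by (rule subgroup.mem_carrier[OF C c(1)])
  have "p ^ 2 \<le> card T"
    using card_mono[OF finite_subgroup[OF fin T(1)] conjC] card_conj_set[OF cc subgroup.subset[OF E]]
      card_cent[OF x(1) xM] by simp
  moreover have xT: "x \<in> T"
  proof -
    have "x \<in> ?C \<inter> P" using xc xP by (simp add: centralizer_def)
    then have "c \<otimes> x \<otimes> inv c \<in> T" using conjC unfolding conj_set_def by blast
    moreover have "c \<otimes> x \<otimes> inv c = x" using c(1) cc xc by (simp add: centralizer_def group_simps)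
    ultimately show ?thesis by simp
  qed
  moreover have "card T \<le> p ^ 2"
  proof -
    obtain g where g: "g \<in> carrier G" "conj_set g T \<subseteq> P"
      using p_subgroup_conj_into_P[OF T(1)] T(3) unfolding p_part_def by blast
    have TS: "T \<subseteq> conj_set (inv g) P" using conj_into_iff[OF g(1) subgroup.subset[OF T(1)] Pc] g(2) by blast
    have "x \<in> conj_set \<one> K" using conj_set_one[OF Kc] x(1) by simp
    then obtain h where h: "h \<in> carrier G" "conj_set h P = conj_set (inv g) P" "x \<in> conj_set h K"
      using conj_in_maximal_over[OF M(1,2) K(1) one_closed inv_closed[OF g(1)] _ _ xM] TS xT by blast
    let ?y = "inv h \<otimes> x \<otimes> h"
    have y: "?y \<in> K" using mem_conj_set_iff[OF h(1) Kc xc] h(3) by blast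
    have "?y \<notin> M"
    proof
      assume "?y \<in> M"
      then have "h \<otimes> ?y \<otimes> inv h \<in> M" using normal_conj(1)[OF M(1) _ h(1)] by blast
      then show False using xM conj_inv_cancel(2)[OF h(1) xc] by simp
    qed
    have "conj_set (inv h) T \<subseteq> centralizer G ?y \<inter> P"
    proof
      fix z assume z: "z \<in> conj_set (inv h) T"
      then obtain t where t: "t \<in> T" "z = inv h \<otimes> t \<otimes> h" unfolding conj_set_def using h(1) by auto
      have tc: "t \<in> carrier G" "t \<otimes> x = x \<otimes> t" using t(1) T(2) by (auto simp: centralizer_def)
      have "z \<otimes> ?y = inv h \<otimes> (t \<otimes> x) \<otimes> h" using t(2) tc(1) h(1) xc by (simp add: group_simps)
      also have "\<dots> = ?y \<otimes> z" unfolding tc(2) using t(2) tc(1) h(1) xc by (simp add: group_simps)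
      finally have "z \<in> centralizer G ?y" using t(2) tc h(1) by (simp add: centralizer_def)
      moreover have "conj_set (inv h) T \<subseteq> P"
        using conj_into_iff[of "inv h" T P] h(1,2) subgroup.subset[OF T(1)] Pc TS by simp
      ultimately show "z \<in> centralizer G ?y \<inter> P" using z by blast
    qed
    then have "card (conj_set (inv h) T) \<le> card (centralizer G ?y \<inter> P)"
      using finite_subgroup[OF fin P_subgroup] by (intro card_mono) auto
    then show ?thesis
      using card_cent[OF y \<open>?y \<notin> M\<close>] card_conj_set[of "inv h" T] h(1) subgroup.subset[OF T(1)] by simp
  qed
  ultimately show thesis using that[OF xP] T(3) by simp
qed

end

section \<open>Transfer and Tate's theorem\<close>

lemma (in group) left_transversal_ex:
  assumes S: "subgroup S G" and K: "subgroup K G" and SK: "S \<subseteq> K"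
  obtains T where "T \<subseteq> K" "\<And>k. k \<in> K \<Longrightarrow> \<exists>t\<in>T. inv t \<otimes> k \<in> S"
    "\<And>t t'. t \<in> T \<Longrightarrow> t' \<in> T \<Longrightarrow> inv t \<otimes> t' \<in> S \<Longrightarrow> t = t'"
proof -
  note Kc = subgroup.mem_carrier[OF K]
  define rep where "rep k = (SOME t. t \<in> K \<and> inv t \<otimes> k \<in> S)" for k
  have rep: "rep k \<in> K" "inv (rep k) \<otimes> k \<in> S" if "k \<in> K" for k
  proof -
    have "k \<in> K \<and> inv k \<otimes> k \<in> S" using that Kc[OF that] subgroup.one_closed[OF S] by simp
    then show "rep k \<in> K" "inv (rep k) \<otimes> k \<in> S"
      unfolding rep_def by (metis (mono_tags, lifting) someI_ex)+
  qed
  have shift: "inv t \<otimes> k' \<in> S" if "t \<in> K" "k \<in> K" "k' \<in> K" "inv k \<otimes> k' \<in> S" "inv t \<otimes> k \<in> S" for t k k'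
  proof -
    have "(inv t \<otimes> k) \<otimes> (inv k \<otimes> k') \<in> S" using that(4,5) subgroup.m_closed[OF S] by blast
    then show ?thesis using Kc[OF that(1)] Kc[OF that(2)] Kc[OF that(3)] by (simp add: group_simps)
  qed
  have sym: "inv k' \<otimes> k \<in> S" if "k \<in> K" "k' \<in> K" "inv k \<otimes> k' \<in> S" for k k'
  proof -
    have "inv (inv k \<otimes> k') \<in> S" by (rule subgroup.m_inv_closed[OF S that(3)])
    then show ?thesis using Kc[OF that(1)] Kc[OF that(2)] by (simp add: inv_mult_group)
  qed
  have rep_eq: "rep k = rep k'" if "k \<in> K" "k' \<in> K" "inv k \<otimes> k' \<in> S" for k k'
  proof -
    have "(t \<in> K \<and> inv t \<otimes> k \<in> S) = (t \<in> K \<and> inv t \<otimes> k' \<in> S)" for t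
      using shift[of t k k'] shift[of t k' k] sym that by blast
    then show ?thesis by (simp add: rep_def)
  qed
  show thesis
  proof (rule that[of "rep ` K"])
    show "rep ` K \<subseteq> K" using rep(1) by blast
    show "\<exists>t\<in>rep ` K. inv t \<otimes> k \<in> S" if "k \<in> K" for k using rep(2)[OF that] that by blast
    fix t t' assume "t \<in> rep ` K" "t' \<in> rep ` K" and tt: "inv t \<otimes> t' \<in> S"
    then obtain k k' where k: "k \<in> K" "t = rep k" "k' \<in> K" "t' = rep k'" by blast
    have "inv t \<otimes> k' \<in> S"
      by (rule shift[of t t' k']) (use rep k tt in auto)
    moreover have "inv k \<otimes> t \<in> S" by (rule sym[of t k]) (use rep k in auto)
    ultimately have "inv k \<otimes> k' \<in> S" using shift[of k t k'] rep k by blast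
    then show "t = t'" using rep_eq k by blast
  qed
qed

context sylow_maximal_class
begin

lemma normal_inter_sylow:
  assumes K: "K \<lhd> G"
  shows "card (P \<inter> K) = p_part p (card K)"
proof -
  note Ks = normal_imp_subgroup[OF K]
  have S: "subgroup (P \<inter> K) G" by (rule subgroups_Inter_pair[OF P_subgroup Ks])
  obtain Q where Q: "subgroup Q G" "Q \<subseteq> K" "card Q = p_part p (card K)" using sylow_exists[OF prime_p fin Ks] .
  obtain g where g: "g \<in> carrier G" "conj_set g Q \<subseteq> P"
    using p_subgroup_conj_into_P[OF Q(1)] Q(3) unfolding p_part_def by blast
  have "conj_set g Q \<subseteq> K" using normal_conj(1)[OF K _ g(1)] Q(2) by (auto simp: conj_set_def)
  then have "card (conj_set g Q) \<le> card (P \<inter> K)"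
    using g(2) finite_subgroup[OF fin S] by (intro card_mono) auto
  then have le: "p_part p (card K) \<le> card (P \<inter> K)"
    using Q(3) card_conj_set[OF g(1) subgroup.subset[OF Q(1)]] by simp
  obtain i where i: "card (P \<inter> K) = p ^ i"
    using card_subgroup_prime_power[OF prime_p S P_subgroup Int_lower1 card_P_eq] by blast
  have "p ^ i dvd card K" using card_subgroup_dvd[OF S Ks Int_lower2] i by simp
  moreover have "card K \<noteq> 0" using card_subgroup_pos[OF fin Ks] by simp
  ultimately have "i \<le> multiplicity p (card K)"
    using prime_p prime_gt_1_nat[OF prime_p] by (intro multiplicity_geI) auto
  then have "p ^ i \<le> p_part p (card K)"
    unfolding p_part_def using prime_gt_0_nat[OF prime_p] by (intro power_increasing) auto
  then show ?thesis using le i by simp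
qed

text \<open>The transfer of \<open>e : S \<rightarrow> \<int>/p\<close> to \<open>K\<close>, where \<open>S = P \<inter> K\<close>, agrees on \<open>S\<close> with
  \<open>[K : S] e\<close>: the difference extends to a homomorphism on \<open>P\<close>, which vanishes on the
  derived subgroup of \<open>P\<close> and hence on \<open>S\<close>.\<close>

lemma transfer_nontrivial:
  assumes K: "K \<lhd> G" and S2: "P \<inter> K \<subseteq> \<Gamma> 2" and nontriv: "P \<inter> K \<noteq> {\<one>}"
  obtains V :: "'a \<Rightarrow> int" and s
  where "\<And>x y. x \<in> K \<Longrightarrow> y \<in> K \<Longrightarrow> [V (x \<otimes> y) = V x + V y] (mod int p)" "s \<in> K" "\<not> int p dvd V s"
proof -
  interpret P: maximal_class_group GP p n by (rule P_maximal_class)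
  define S where "S = P \<inter> K"
  note Ks = normal_imp_subgroup[OF K]
  note Kc = subgroup.mem_carrier[OF Ks]
  have S: "subgroup S G" unfolding S_def by (rule subgroups_Inter_pair[OF P_subgroup Ks])
  \<comment> \<open>With \<open>S\<close> inside \<open>\<Gamma> j\<close> but not inside the next
    term, the coordinate of level \<open>j\<close> restricts to a nonzero homomorphism on
    \<open>S\<close> that is invariant under \<open>P\<close>.\<close>
  have ex_j: "\<exists>j. 2 \<le> j \<and> j < n \<and> S \<subseteq> \<Gamma> j \<and> \<not> S \<subseteq> \<Gamma> (Suc j)"
  proof (rule ccontr)
    assume no: "\<not> ?thesis"
    have "S \<subseteq> \<Gamma> (2 + k)" if "2 + k \<le> n" for k
      using that
    proof (induction k)
      case 0
      show ?case using S2 by (simp add: S_def)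
    next
      case (Suc k)
      then have "S \<subseteq> \<Gamma> (2 + k)" "2 \<le> 2 + k" "2 + k < n" by simp_all
      then have "S \<subseteq> \<Gamma> (Suc (2 + k))" using no by blast
      then show ?case by simp
    qed
    moreover have eq: "2 + (n - 2) = n" using P.n_ge by simp
    ultimately have "S \<subseteq> \<Gamma> n" by (metis order_refl)
    then have "S \<subseteq> {\<one>}" using P.gam_n by simp
    then show False using nontriv subgroup.one_closed[OF S] unfolding S_def by blast
  qed
  then obtain j where j: "2 \<le> j" "j < n" "S \<subseteq> \<Gamma> j" "\<not> S \<subseteq> \<Gamma> (Suc j)" by blast
  obtain e where e: "P.level_log j e" using P.level_log_ex[OF j(1,2)] .
  have e_mult: "[e (x \<otimes> y) = e x + e y] (mod int p)" if "x \<in> S" "y \<in> S" for x y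
    using P.level_logD(1)[OF e, of x y] that j(3) by auto
  have e_conj: "[e (g \<otimes> x \<otimes> inv g) = e x] (mod int p)" if "g \<in> P" "x \<in> S" for g x
    using P.level_logD(3)[OF e, of g x] that j(3) m_inv_consistent[OF P_subgroup that(1)] by auto
  have e_inv: "[e (inv x) = - e x] (mod int p)" if "x \<in> S" for x
    by (rule log_subgroup(2)[OF S _ that]) (rule e_mult)
  obtain T where T: "T \<subseteq> K" "\<And>k. k \<in> K \<Longrightarrow> \<exists>t\<in>T. inv t \<otimes> k \<in> S"
    "\<And>t t'. t \<in> T \<Longrightarrow> t' \<in> T \<Longrightarrow> inv t \<otimes> t' \<in> S \<Longrightarrow> t = t'"
    using left_transversal_ex[OF S Ks] unfolding S_def by blast
  have finT: "finite T" using T(1) finite_subgroup[OF fin Ks] finite_subset by blast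
  have Tc: "t \<in> carrier G" if "t \<in> T" for t using that T(1) Kc by blast
  \<comment> \<open>Different left cosets of \<open>S\<close> in \<open>K\<close> generate different
    left cosets of \<open>P\<close> in \<open>G\<close>; this lets elements of \<open>P\<close>, not
    only of \<open>K\<close>, permute the representatives.\<close>
  have T_unique: "t = t'" if "t \<in> T" "t' \<in> T" "w \<in> carrier G" "inv t \<otimes> w \<in> P" "inv t' \<otimes> w \<in> P" for t t' w
  proof -
    have "(inv t \<otimes> w) \<otimes> inv (inv t' \<otimes> w) \<in> P"
      using that subgroup.m_closed[OF P_subgroup] subgroup.m_inv_closed[OF P_subgroup] by blast
    then have "inv t \<otimes> t' \<in> P"
      using Tc[OF that(1)] Tc[OF that(2)] that(3) by (simp add: group_simps)
    moreover have "inv t \<otimes> t' \<in> K"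
      using T(1) that(1,2) subgroup.m_closed[OF Ks] subgroup.m_inv_closed[OF Ks] by blast
    ultimately show ?thesis using T(3)[OF that(1,2)] by (simp add: S_def)
  qed
  have card_K: "card K = card T * card S"
  proof -
    have "bij_betw (\<lambda>(t, s). t \<otimes> s) (T \<times> S) K"
    proof (rule bij_betwI')
      fix x y assume "x \<in> T \<times> S" "y \<in> T \<times> S"
      then obtain t s t' s' where x: "x = (t, s)" "t \<in> T" "s \<in> S" and y: "y = (t', s')" "t' \<in> T" "s' \<in> S" by blast
      have car: "t \<in> carrier G" "t' \<in> carrier G" "s \<in> carrier G" "s' \<in> carrier G"
        using Tc x y subgroup.mem_carrier[OF S] by auto
      have "x = y" if eq: "t \<otimes> s = t' \<otimes> s'"
      proof -
        have "inv t \<otimes> (t \<otimes> s) \<in> P" using x car by (simp add: inv_cancel_left S_def)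
        moreover have "inv t' \<otimes> (t \<otimes> s) \<in> P"
          unfolding eq using y car by (simp add: inv_cancel_left S_def)
        ultimately have "t = t'" using T_unique[OF x(2) y(2)] car by blast
        then show ?thesis using eq car x y by simp
      qed
      then show "((case x of (t, s) \<Rightarrow> t \<otimes> s) = (case y of (t, s) \<Rightarrow> t \<otimes> s)) = (x = y)" using x y by auto
    next
      fix x assume "x \<in> T \<times> S"
      then show "(case x of (t, s) \<Rightarrow> t \<otimes> s) \<in> K"
        using T(1) subgroup.m_closed[OF Ks] by (auto simp: S_def)
    next
      fix k assume k: "k \<in> K"
      then obtain t where t: "t \<in> T" "inv t \<otimes> k \<in> S" using T(2) by blast
      have "k = t \<otimes> (inv t \<otimes> k)" using Tc[OF t(1)] Kc[OF k] by (simp add: inv_cancel_left)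
      then show "\<exists>x\<in>T \<times> S. k = (case x of (t, s) \<Rightarrow> t \<otimes> s)" using t by auto
    qed
    then have "card (T \<times> S) = card K" by (rule bij_betw_same_card)
    then show ?thesis by (simp add: card_cartesian_product)
  qed
  have "\<not> p dvd card T"
    by (rule p_part_cofactor[OF prime_p card_subgroup_pos[OF fin Ks]])
      (use card_K normal_inter_sylow[OF K] in \<open>simp add: S_def\<close>)
  define \<tau> where "\<tau> h t = (THE t'. t' \<in> T \<and> inv t' \<otimes> (h \<otimes> t) \<in> P)" for h t
  define q where "q h t = inv (\<tau> h t) \<otimes> (h \<otimes> t)" for h t
  \<comment> \<open>\<open>X\<close> consists of the elements that permute the cosets of
    \<open>P\<close> with representatives in \<open>T\<close>. It contains both \<open>K\<close> and
    \<open>P\<close>, so one cocycle identity serves \<open>V\<close> and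
    \<open>\<Theta>\<close>.\<close>
  define X where "X = {h \<in> carrier G. \<forall>t\<in>T. \<exists>t'\<in>T. inv t' \<otimes> (h \<otimes> t) \<in> P}"
  have KX: "h \<in> X" if "h \<in> K" for h
  proof -
    have "\<exists>t'\<in>T. inv t' \<otimes> (h \<otimes> t) \<in> P" if "t \<in> T" for t
      using T(2)[of "h \<otimes> t"] subgroup.m_closed[OF Ks \<open>h \<in> K\<close>] T(1) that unfolding S_def by blast
    then show ?thesis using Kc[OF that] by (simp add: X_def)
  qed
  have PX: "u \<in> X" if u: "u \<in> P" for u
  proof -
    note uc = P_carrier[OF u]
    have "\<exists>t'\<in>T. inv t' \<otimes> (u \<otimes> t) \<in> P" if t: "t \<in> T" for t
    proof -
      have "u \<otimes> t \<otimes> inv u \<in> K" using normal_conj(1)[OF K _ uc] T(1) t by blast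
      then obtain t' where t': "t' \<in> T" "inv t' \<otimes> (u \<otimes> t \<otimes> inv u) \<in> S" using T(2) by blast
      then have "(inv t' \<otimes> (u \<otimes> t \<otimes> inv u)) \<otimes> u \<in> P"
        using subgroup.m_closed[OF P_subgroup _ u] by (simp add: S_def)
      then show ?thesis using t' uc Tc[OF t] Tc[OF t'(1)] by (auto simp: group_simps)
    qed
    then show ?thesis using uc by (simp add: X_def)
  qed
  have \<tau>: "\<tau> h t \<in> T" "q h t \<in> P" if h: "h \<in> X" and t: "t \<in> T" for h t
  proof -
    obtain t' where t': "t' \<in> T" "inv t' \<otimes> (h \<otimes> t) \<in> P" using h t unfolding X_def by blast
    have ht: "h \<otimes> t \<in> carrier G" using h Tc[OF t] by (simp add: X_def)
    have "\<tau> h t = t'" unfolding \<tau>_def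
    proof (rule the_equality)
      show "r = t'" if "r \<in> T \<and> inv r \<otimes> (h \<otimes> t) \<in> P" for r
        using T_unique[OF _ t'(1) ht _ t'(2)] that by blast
    qed (use t' in blast)
    then show "\<tau> h t \<in> T" "q h t \<in> P" using t' by (simp_all add: q_def)
  qed
  have Xc: "h \<in> carrier G" if "h \<in> X" for h using that by (simp add: X_def)
  have \<tau>_eq: "\<tau> h t = t'" if "h \<in> X" "t \<in> T" "t' \<in> T" "inv t' \<otimes> (h \<otimes> t) \<in> P" for h t t'
    using T_unique[OF \<tau>(1)[OF that(1,2)] that(3) _ \<tau>(2)[OF that(1,2), unfolded q_def] that(4)]
      Xc[OF that(1)] Tc[OF that(2)] by simp
  have cocycle: "q (g \<otimes> h) t = q g (\<tau> h t) \<otimes> q h t" if "g \<in> X" "h \<in> X" "g \<otimes> h \<in> X" "t \<in> T" for g h t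
  proof -
    note car = Xc[OF that(1)] Xc[OF that(2)] Tc[OF that(4)] Tc[OF \<tau>(1)[OF that(2,4)]]
      Tc[OF \<tau>(1)[OF that(1) \<tau>(1)[OF that(2,4)]]]
    have "inv (\<tau> g (\<tau> h t)) \<otimes> ((g \<otimes> h) \<otimes> t) = q g (\<tau> h t) \<otimes> q h t"
      using car by (simp add: q_def group_simps)
    moreover have "\<dots> \<in> P"
      using subgroup.m_closed[OF P_subgroup] \<tau> that by blast
    ultimately have "\<tau> (g \<otimes> h) t = \<tau> g (\<tau> h t)"
      using \<tau>_eq[OF that(3,4) \<tau>(1)[OF that(1) \<tau>(1)[OF that(2,4)]]] by simp
    then show ?thesis using car by (simp add: q_def group_simps)
  qed
  have \<tau>_bij: "bij_betw (\<tau> h) T T" if h: "h \<in> X" for h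
  proof -
    have "inj_on (\<tau> h) T"
    proof (rule inj_onI)
      fix t t' assume t: "t \<in> T" "t' \<in> T" and eq: "\<tau> h t = \<tau> h t'"
      have "inv (q h t) \<otimes> q h t' \<in> P"
        using \<tau>(2)[OF h] t subgroup.m_closed[OF P_subgroup] subgroup.m_inv_closed[OF P_subgroup] by blast
      moreover have "inv (q h t) \<otimes> q h t' = inv t \<otimes> t'"
        using Xc[OF h] Tc[OF t(1)] Tc[OF t(2)] Tc[OF \<tau>(1)[OF h t(2)]] by (simp add: q_def eq group_simps)
      moreover have "inv t' \<otimes> t' \<in> P" using Tc[OF t(2)] subgroup.one_closed[OF P_subgroup] by simp
      ultimately show "t = t'" using T_unique[OF t Tc[OF t(2)]] by simp
    qed
    moreover have "\<tau> h ` T \<subseteq> T" using \<tau>(1)[OF h] by blast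
    ultimately show ?thesis using finT by (simp add: bij_betw_def endo_inj_surj)
  qed
  have qS: "q h t \<in> S" if h: "h \<in> K" and t: "t \<in> T" for h t
  proof -
    have "t \<in> K" "\<tau> h t \<in> K" using T(1) t \<tau>(1)[OF KX[OF h] t] by blast+
    then have "q h t \<in> K"
      unfolding q_def by (intro subgroup.m_closed[OF Ks] subgroup.m_inv_closed[OF Ks] h)
    then show ?thesis using \<tau>(2)[OF KX[OF h] t] by (simp add: S_def)
  qed
  \<comment> \<open>Normality of \<open>K\<close> puts the quotient of \<open>u\<close> by its
    cocycle value into \<open>K\<close>, so \<open>e\<close> is additive on such quotients although
    \<open>u\<close> itself may be outside \<open>S\<close>.\<close>
  have uqS: "u \<otimes> inv (q u t) \<in> S" if u: "u \<in> P" and t: "t \<in> T" for u t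
  proof -
    note uc = P_carrier[OF u]
    have \<tau>T: "\<tau> u t \<in> T" by (rule \<tau>(1)[OF PX[OF u] t])
    have "u \<otimes> inv t \<otimes> inv u \<in> K"
      using normal_conj(1)[OF K _ uc] T(1) t subgroup.m_inv_closed[OF Ks] by blast
    then have "(u \<otimes> inv t \<otimes> inv u) \<otimes> \<tau> u t \<in> K"
      using subgroup.m_closed[OF Ks] \<tau>T T(1) by blast
    moreover have "(u \<otimes> inv t \<otimes> inv u) \<otimes> \<tau> u t = u \<otimes> inv (q u t)"
      using uc Tc[OF t] Tc[OF \<tau>T] by (simp add: q_def group_simps)
    moreover have "u \<otimes> inv (q u t) \<in> P"
      using u \<tau>(2)[OF PX[OF u] t] subgroup.m_closed[OF P_subgroup] subgroup.m_inv_closed[OF P_subgroup] by blast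
    ultimately show ?thesis by (simp add: S_def)
  qed
  define V where "V h = (\<Sum>t\<in>T. e (q h t))" for h
  define \<Theta> where "\<Theta> u = (\<Sum>t\<in>T. e (u \<otimes> inv (q u t)))" for u
  have V: "[V (g \<otimes> h) = V g + V h] (mod int p)" if "g \<in> K" "h \<in> K" for g h
  proof -
    have gh: "g \<otimes> h \<in> K" by (rule subgroup.m_closed[OF Ks that])
    have "[V (g \<otimes> h) = (\<Sum>t\<in>T. e (q g (\<tau> h t)) + e (q h t))] (mod int p)"
      unfolding V_def
    proof (rule cong_sum)
      fix t assume t: "t \<in> T"
      show "[e (q (g \<otimes> h) t) = e (q g (\<tau> h t)) + e (q h t)] (mod int p)"
        using e_mult[OF qS[OF that(1) \<tau>(1)[OF KX[OF that(2)] t]] qS[OF that(2) t]]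
          cocycle[OF KX[OF that(1)] KX[OF that(2)] KX[OF gh] t] by simp
    qed
    also have "(\<Sum>t\<in>T. e (q g (\<tau> h t)) + e (q h t)) = (\<Sum>t\<in>T. e (q g (\<tau> h t))) + V h"
      by (simp add: sum.distrib V_def)
    also have "(\<Sum>t\<in>T. e (q g (\<tau> h t))) = V g"
      unfolding V_def using sum.reindex_bij_betw[OF \<tau>_bij[OF KX[OF that(2)]], of "\<lambda>t. e (q g t)"] by simp
    finally show ?thesis .
  qed
  have \<Theta>: "[\<Theta> (u \<otimes> v) = \<Theta> u + \<Theta> v] (mod int p)" if "u \<in> P" "v \<in> P" for u v
  proof -
    have uv: "u \<otimes> v \<in> P" by (rule subgroup.m_closed[OF P_subgroup that])
    note uc = P_carrier[OF that(1)] and vc = P_carrier[OF that(2)]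
    have "[\<Theta> (u \<otimes> v) = (\<Sum>t\<in>T. e (v \<otimes> inv (q v t)) + e (u \<otimes> inv (q u (\<tau> v t))))] (mod int p)"
      unfolding \<Theta>_def
    proof (rule cong_sum)
      fix t assume t: "t \<in> T"
      have \<tau>T: "\<tau> v t \<in> T" by (rule \<tau>(1)[OF PX[OF that(2)] t])
      let ?a = "v \<otimes> inv (q v t)" and ?b = "u \<otimes> inv (q u (\<tau> v t))"
      have ab: "?a \<in> S" "?b \<in> S" using uqS that t \<tau>T by blast+
      have qc: "q v t \<in> carrier G" "q u (\<tau> v t) \<in> carrier G"
        using P_carrier \<tau>(2) PX that t \<tau>T by blast+
      have uaK: "u \<otimes> ?a \<otimes> inv u \<in> S"
        using ab(1) normal_conj(1)[OF K _ uc] that(1) subgroup.m_closed[OF P_subgroup] subgroup.m_inv_closed[OF P_subgroup]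
        unfolding S_def by blast
      \<comment> \<open>The cocycle identity leaves the first quotient conjugated by
        \<open>u\<close>, which the invariance of \<open>e\<close> under \<open>P\<close>
        absorbs.\<close>
      have "(u \<otimes> v) \<otimes> inv (q (u \<otimes> v) t) = (u \<otimes> ?a \<otimes> inv u) \<otimes> ?b"
        using cocycle[OF PX[OF that(1)] PX[OF that(2)] PX[OF uv] t] uc vc qc by (simp add: group_simps)
      then have "[e ((u \<otimes> v) \<otimes> inv (q (u \<otimes> v) t)) = e (u \<otimes> ?a \<otimes> inv u) + e ?b] (mod int p)"
        using e_mult[OF uaK ab(2)] by simp
      also have "[e (u \<otimes> ?a \<otimes> inv u) + e ?b = e ?a + e ?b] (mod int p)"
        using e_conj[OF that(1) ab(1)] by (intro cong_add) simp_all
      finally show "[e (u \<otimes> v \<otimes> inv (q (u \<otimes> v) t)) = e ?a + e ?b] (mod int p)" .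
    qed
    also have "(\<Sum>t\<in>T. e (v \<otimes> inv (q v t)) + e (u \<otimes> inv (q u (\<tau> v t)))) =
        \<Theta> v + (\<Sum>t\<in>T. e (u \<otimes> inv (q u (\<tau> v t))))"
      by (simp add: sum.distrib \<Theta>_def)
    also have "(\<Sum>t\<in>T. e (u \<otimes> inv (q u (\<tau> v t)))) = \<Theta> u"
      unfolding \<Theta>_def
      using sum.reindex_bij_betw[OF \<tau>_bij[OF PX[OF that(2)]], of "\<lambda>t. e (u \<otimes> inv (q u t))"] by simp
    finally show ?thesis by (simp add: add.commute)
  qed
  have \<Theta>_S: "int p dvd \<Theta> s" if s: "s \<in> S" for s
  proof -
    have ker: "subgroup {x \<in> P. int p dvd \<Theta> x} G"
      by (rule log_subgroup(1)[OF P_subgroup]) (rule \<Theta>)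
    have "commutator x y \<in> {x \<in> P. int p dvd \<Theta> x}" if xy: "x \<in> P" "y \<in> P" for x y
    proof -
      have inv: "[\<Theta> (inv z) = - \<Theta> z] (mod int p)" if "z \<in> P" for z
        by (rule log_subgroup(2)[OF P_subgroup _ that]) (rule \<Theta>)
      note m = subgroup.m_closed[OF P_subgroup] subgroup.m_inv_closed[OF P_subgroup]
      have "[\<Theta> (commutator x y) = \<Theta> (x \<otimes> y \<otimes> inv x) + \<Theta> (inv y)] (mod int p)"
        unfolding commutator_def using xy by (intro \<Theta> m)
      also have "[\<Theta> (x \<otimes> y \<otimes> inv x) + \<Theta> (inv y) = (\<Theta> (x \<otimes> y) + \<Theta> (inv x)) + - \<Theta> y] (mod int p)"
        using xy by (intro cong_add \<Theta> inv m)
      also have "[(\<Theta> (x \<otimes> y) + \<Theta> (inv x)) + - \<Theta> y = ((\<Theta> x + \<Theta> y) + - \<Theta> x) + - \<Theta> y] (mod int p)"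
        using xy by (intro cong_add \<Theta> inv cong_refl)
      finally have "int p dvd \<Theta> (commutator x y)" by (simp add: cong_0_iff)
      moreover have "commutator x y \<in> P" unfolding commutator_def using xy by (intro m)
      ultimately show ?thesis by simp
    qed
    then have "P.commutator x y \<in> {x \<in> P. int p dvd \<Theta> x}" if "x \<in> P" "y \<in> P" for x y
      using that P_commutator by simp
    moreover have "subgroup {x \<in> P. int p dvd \<Theta> x} GP"
      by (rule subgroup_incl[OF ker P_subgroup]) blast
    ultimately have "commutator_subgroup GP P P \<subseteq> {x \<in> P. int p dvd \<Theta> x}"
      by (intro P.commutator_subgroup_minimal) auto
    moreover have "\<Gamma> 2 = commutator_subgroup GP P P" using P.gam_Suc[of 1] by (simp add: numeral_2_eq_2)
    ultimately show ?thesis using s S2 unfolding S_def by blast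
  qed
  have V_S: "[V s = int (card T) * e s] (mod int p)" if s: "s \<in> S" for s
  proof -
    have sK: "s \<in> K" and sP: "s \<in> P" using s by (simp_all add: S_def)
    have "[\<Theta> s = (\<Sum>t\<in>T. e s + - e (q s t))] (mod int p)"
      unfolding \<Theta>_def
    proof (rule cong_sum)
      fix t assume t: "t \<in> T"
      have "[e (s \<otimes> inv (q s t)) = e s + e (inv (q s t))] (mod int p)"
        using e_mult[OF s subgroup.m_inv_closed[OF S qS[OF sK t]]] .
      also have "[e s + e (inv (q s t)) = e s + - e (q s t)] (mod int p)"
        using e_inv[OF qS[OF sK t]] by (intro cong_add) simp_all
      finally show "[e (s \<otimes> inv (q s t)) = e s + - e (q s t)] (mod int p)" .
    qed
    also have "(\<Sum>t\<in>T. e s + - e (q s t)) = int (card T) * e s - V s"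
      by (simp add: sum_subtractf V_def)
    finally have "int p dvd int (card T) * e s - V s" using \<Theta>_S[OF s] cong_dvd_iff by blast
    then show ?thesis by (simp add: cong_iff_dvd_diff dvd_diff_commute)
  qed
  obtain s where s: "s \<in> S" "s \<notin> \<Gamma> (Suc j)" using j(4) by blast
  have "\<not> int p dvd e s" using P.level_logD(2)[OF e, of s] s j(3) by blast
  moreover have "\<not> int p dvd int (card T)" using \<open>\<not> p dvd card T\<close> by simp
  moreover have "Factorial_Ring.prime (int p)" using prime_p by simp
  ultimately have "\<not> int p dvd V s"
    using cong_dvd_iff[OF V_S[OF s(1)]] by (simp add: prime_dvd_mult_iff)
  moreover have "s \<in> K" using s(1) by (simp add: S_def)
  ultimately show thesis using that V by blast
qed

text \<open>\<open>K\<close>, generated by the elements of \<open>N\<close> of order prime to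
  \<open>p\<close>, has no nonzero homomorphism to a group of order \<open>p\<close>. By the
  transfer it meets \<open>P\<close> trivially, so it is a normal subgroup of order prime to
  \<open>p\<close> and hence trivial. Then \<open>N\<close> is a normal
  \<open>p\<close>-group.\<close>

lemma tate:
  assumes N: "N \<lhd> G" and S2: "P \<inter> N \<subseteq> \<Gamma> 2" and core: "p'_core p G = {\<one>}"
  shows "N \<subseteq> P"
proof -
  note Ns = normal_imp_subgroup[OF N]
  let ?R = "{x \<in> N. \<exists>k::nat. coprime k p \<and> x [^] k = \<one>}"
  define K where "K = generate G ?R"
  have RN: "?R \<subseteq> carrier G" using normal_closed(4)[OF N] by blast
  have K: "K \<lhd> G"
    unfolding K_def
  proof (rule normal_generateI[OF RN])
    fix h g assume h: "h \<in> ?R" and g: "g \<in> carrier G"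
    then obtain k :: nat where k: "coprime k p" "h [^] k = \<one>" by blast
    have "(g \<otimes> h \<otimes> inv g) [^] k = \<one>" using conj_pow[OF g, of h k] k(2) h RN g by auto
    moreover have "g \<otimes> h \<otimes> inv g \<in> N" using normal_conj(1)[OF N _ g] h by blast
    ultimately show "g \<otimes> h \<otimes> inv g \<in> ?R" using k(1) by blast
  qed
  note Ks = normal_imp_subgroup[OF K]
  have RK: "?R \<subseteq> K" unfolding K_def using generate.incl by (rule subsetI)
  have "K \<subseteq> N" unfolding K_def by (rule generate_subgroup_incl[OF _ Ns]) blast
  have triv: "P \<inter> K = {\<one>}"
  proof (rule ccontr)
    assume "P \<inter> K \<noteq> {\<one>}"
    then obtain V :: "'a \<Rightarrow> int" and s
      where V: "\<And>x y. x \<in> K \<Longrightarrow> y \<in> K \<Longrightarrow> [V (x \<otimes> y) = V x + V y] (mod int p)" "s \<in> K" "\<not> int p dvd V s"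
      using transfer_nontrivial[OF K] S2 \<open>K \<subseteq> N\<close> by blast
    have "subgroup {x \<in> K. int p dvd V x} G" by (rule log_subgroup(1)[OF Ks]) (rule V(1))
    moreover have "?R \<subseteq> {x \<in> K. int p dvd V x}"
    proof
      fix x assume x: "x \<in> ?R"
      then obtain k :: nat where k: "coprime k p" "x [^] k = \<one>" by blast
      have xK: "x \<in> K" using x RK by blast
      have "[V (x [^] k) = int k * V x] (mod int p)"
        by (rule log_subgroup(4)[OF Ks _ xK]) (rule V(1))
      moreover have "int p dvd V \<one>" by (rule log_subgroup(3)[OF Ks]) (rule V(1))
      ultimately have "int p dvd int k * V x" using k(2) cong_dvd_iff by metis
      moreover have "coprime (int p) (int k)" using k(1) by (simp add: coprime_commute)
      ultimately have "int p dvd V x" using coprime_dvd_mult_right_iff by blast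
      then show "x \<in> {x \<in> K. int p dvd V x}" using xK by blast
    qed
    ultimately have "K \<subseteq> {x \<in> K. int p dvd V x}" unfolding K_def[symmetric]
      using generate_subgroup_incl[of ?R "{x \<in> K. int p dvd V x}"] K_def by simp
    then show False using V(2,3) by blast
  qed
  then have "p_part p (card K) = 1" using normal_inter_sylow[OF K] by simp
  then have "multiplicity p (card K) = 0"
    using prime_gt_1_nat[OF prime_p] by (simp add: p_part_def)
  moreover have "card K \<noteq> 0" using card_subgroup_pos[OF fin Ks] by simp
  ultimately have "\<not> p dvd card K"
    using prime_multiplicity_gt_zero_iff[of p "card K"] prime_p by simp
  then have "coprime p (card K)" by (rule prime_imp_coprime[OF prime_p])
  then have "K \<subseteq> p'_core p G" by (rule p'_core_greatest(3)[OF fin K])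
  then have "K \<subseteq> {\<one>}" unfolding core .
  then have "x = \<one>" if "x \<in> N" "coprime k p" "x [^] (k::nat) = \<one>" for x k
    using that RK by blast
  then obtain a where a: "card N = p ^ a" using prime_power_if_no_coprime_order[OF prime_p fin Ns] by blast
  obtain g where g: "g \<in> carrier G" "conj_set g N \<subseteq> P" using p_subgroup_conj_into_P[OF Ns a] .
  have "conj_set g N \<subseteq> N" using normal_conj(1)[OF N _ g(1)] by (auto simp: conj_set_def)
  then have "conj_set g N = N"
    using card_subset_eq[OF finite_subgroup[OF fin Ns]] card_conj_set[OF g(1) subgroup.subset[OF Ns]] by blast
  then show ?thesis using g(2) by simp
qed

end

section \<open>Normal p-subgroups\<close>

lemma (in group) coprime_pow_eq_one:
  assumes "x \<in> carrier G" "x [^] (k::nat) = \<one>" "x [^] (l::nat) = \<one>" "coprime k l"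
  shows "x = \<one>"
proof -
  have "ord x dvd k" "ord x dvd l" using pow_eq_id[OF assms(1)] assms(2,3) by simp_all
  then have "ord x = 1" using assms(4) by (metis coprime_common_divisor_nat nat_dvd_1_iff_1)
  then show ?thesis using ord_eq_1[OF assms(1)] by simp
qed

context sylow_maximal_class
begin

lemma P_pow: "x \<in> P \<Longrightarrow> x [^] (p ^ n) = \<one>"
  using group.pow_order_eq_1[OF subgroup_imp_group[OF P_subgroup], of x] card_P_eq nat_pow_consistent[of x _ P]
  by (simp add: order_def)

text \<open>\<open>S\<close> stabilizes the chain \<open>A d\<close>, and \<open>S0\<close> acts
  trivially on its factors. Elements of \<open>S0\<close> of order prime to \<open>p\<close>
  centralize \<open>M\<close>, so \<open>S0\<close> is a \<open>p\<close>-group and equals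
  \<open>P\<close>; thus \<open>P\<close> is the only Sylow subgroup of \<open>S\<close>, and it
  remains to see that \<open>T\<close> stabilizes the chain.\<close>

lemma normal_subset_P_if_centralizer:
  assumes M: "M \<lhd> G" "M \<subseteq> \<Gamma> 2" and C: "\<And>g. g \<in> carrier G \<Longrightarrow> \<forall>m\<in>M. g \<otimes> m = m \<otimes> g \<Longrightarrow> g \<in> P"
    and x: "P_uniform x" and T: "subgroup T G" "T \<subseteq> centralizer G x" "card T = p ^ k"
  shows "T \<subseteq> P"
proof -
  interpret P: maximal_class_group GP p n by (rule P_maximal_class)
  note Ms = normal_imp_subgroup[OF M(1)]
  define A where "A d = M \<inter> \<Gamma> d" for d
  have \<Gamma>P: "\<Gamma> d \<subseteq> P" for d using subgroup.subset[OF P.gam_subgroup[of d]] by simp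
  have \<Gamma>s: "subgroup (\<Gamma> d) G" for d by (rule incl_subgroup[OF P_subgroup P.gam_subgroup])
  have A: "subgroup (A d) G" for d unfolding A_def by (rule subgroups_Inter_pair[OF Ms \<Gamma>s])
  have Ac: "A d \<subseteq> carrier G" for d by (rule subgroup.subset[OF A])
  have A2: "A 2 = M" using M(2) by (auto simp: A_def)
  have An: "A n = {\<one>}" using P.gam_n subgroup.one_closed[OF Ms] by (auto simp: A_def)
  have A_Suc: "A (Suc d) \<subseteq> A d" for d unfolding A_def using P.gam_Suc_subset by blast
  have conj_eq: "conj_set g (A d) = A d" if "g \<in> carrier G" "conj_set g (A d) \<subseteq> A d" for g d
    using card_subset_eq[OF finite_subgroup[OF fin A] that(2)] card_conj_set[OF that(1) Ac] by blast
  define S where "S = {g \<in> carrier G. \<forall>d\<ge>2. conj_set g (A d) = A d}"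
  have S: "subgroup S G"
  proof (rule subgroupI)
    have "\<one> \<in> S" by (simp add: S_def conj_set_one[OF Ac])
    then show "S \<noteq> {}" by blast
    show "inv g \<in> S" if "g \<in> S" for g
      using that conj_set_inv_swap[of g, OF _ Ac] by (auto simp: S_def) metis+
    show "g \<otimes> h \<in> S" if "g \<in> S" "h \<in> S" for g h
      using that conj_set_conj_set[of g h, OF _ _ Ac] by (auto simp: S_def) metis+
  qed (simp add: S_def subset_iff)
  note Sc = subgroup.mem_carrier[OF S]
  have S_conj: "g \<otimes> y \<otimes> inv g \<in> A d" "inv g \<otimes> y \<otimes> g \<in> A d" if "g \<in> S" "y \<in> A d" "2 \<le> d" for g y d
  proof -
    show "g \<otimes> y \<otimes> inv g \<in> A d"
      using that by (auto simp: S_def conj_set_def)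
    have "inv g \<in> S" by (rule subgroup.m_inv_closed[OF S that(1)])
    then have "inv g \<otimes> y \<otimes> inv (inv g) \<in> A d"
      using that by (auto simp: S_def conj_set_def)
    then show "inv g \<otimes> y \<otimes> g \<in> A d" using Sc[OF that(1)] by simp
  qed
  define S0 where "S0 = {g \<in> S. \<forall>d\<ge>2. \<forall>y\<in>A d. commutator g y \<in> A (Suc d)}"
  have S0: "subgroup S0 G"
  proof (rule subgroupI)
    have "commutator \<one> y \<in> A (Suc d)" if "y \<in> A d" for y d
      using that Ac[of d] subgroup.one_closed[OF A[of "Suc d"]] by (auto simp: commutator_def)
    then show "S0 \<noteq> {}" using subgroup.one_closed[OF S] by (auto simp: S0_def)
    show "inv g \<in> S0" if g: "g \<in> S0" for g
    proof -
      have gS: "g \<in> S" using g by (simp add: S0_def)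
      have "commutator (inv g) y \<in> A (Suc d)" if y: "y \<in> A d" "2 \<le> d" for y d
      proof -
        have yc: "y \<in> carrier G" using y Ac by blast
        have "inv (commutator g y) \<in> A (Suc d)" using g y subgroup.m_inv_closed[OF A] by (simp add: S0_def)
        then have "inv g \<otimes> inv (commutator g y) \<otimes> g \<in> A (Suc d)" using S_conj(2)[OF gS] y(2) by simp
        moreover have "commutator (inv g) y = inv g \<otimes> inv (commutator g y) \<otimes> g"
          using Sc[OF gS] yc by (simp add: commutator_def group_simps)
        ultimately show ?thesis by simp
      qed
      then show ?thesis using subgroup.m_inv_closed[OF S gS] by (simp add: S0_def)
    qed
    show "g \<otimes> h \<in> S0" if g: "g \<in> S0" and h: "h \<in> S0" for g h
    proof -
      have gS: "g \<in> S" and hS: "h \<in> S" using g h by (simp_all add: S0_def)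
      have "commutator (g \<otimes> h) y \<in> A (Suc d)" if y: "y \<in> A d" "2 \<le> d" for y d
      proof -
        have yc: "y \<in> carrier G" using y Ac by blast
        have "g \<otimes> commutator h y \<otimes> inv g \<in> A (Suc d)" using h y S_conj(1)[OF gS] by (simp add: S0_def)
        then show ?thesis
          using g y subgroup.m_closed[OF A] Sc[OF gS] Sc[OF hS] yc by (simp add: S0_def commutator_mult_left)
      qed
      then show ?thesis using subgroup.m_closed[OF S gS hS] by (simp add: S0_def)
    qed
  qed (use Sc in \<open>auto simp: S0_def\<close>)
  have PS: "u \<in> S0" if u: "u \<in> P" for u
  proof -
    note uc = P_carrier[OF u]
    have comm: "commutator u y \<in> A (Suc d)" if y: "y \<in> A d" for y d
    proof -
      have yd: "y \<in> \<Gamma> d" "y \<in> M" using y by (simp_all add: A_def)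
      then have "y \<in> P" using \<Gamma>P by blast
      then show ?thesis
        using P.commutator_in_gam_Suc(2)[OF yd(1), of u] u normal_commutator(2)[OF M(1) yd(2) uc] P_commutator[OF u]
        by (simp add: A_def)
    qed
    have "u \<otimes> y \<otimes> inv u \<in> A d" if y: "y \<in> A d" for y d
    proof -
      have yc: "y \<in> carrier G" using y Ac by blast
      have "commutator u y \<otimes> y \<in> A d"
        using subgroup.m_closed[OF A _ y] comm[OF y] A_Suc by blast
      then show ?thesis using yc uc by (simp add: conj_eq_commutator)
    qed
    then have "conj_set u (A d) \<subseteq> A d" for d by (auto simp: conj_set_def)
    then have "u \<in> S" using conj_eq[OF uc] uc by (simp add: S_def)
    then show ?thesis using comm by (simp add: S0_def)
  qed
  have triv: "g = \<one>" if g: "g \<in> S0" "coprime k p" "g [^] (k::nat) = \<one>" for g k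
  proof -
    have gS: "g \<in> S" using g by (simp add: S0_def)
    note gc = Sc[OF gS]
    have "\<forall>y\<in>A (n - i). g \<otimes> y = y \<otimes> g" if "i \<le> n - 2" for i
      using that
    proof (induction i)
      case 0
      then show ?case using An gc by simp
    next
      case (Suc i)
      define d where "d = n - Suc i"
      have d: "2 \<le> d" "Suc d = n - i" using Suc.prems P.n_ge by (simp_all add: d_def)
      have IH: "g \<otimes> y = y \<otimes> g" if "y \<in> A (Suc d)" for y using Suc that unfolding d(2) by simp
      have "g \<otimes> y = y \<otimes> g" if y: "y \<in> A d" for y
      proof -
        have yc: "y \<in> carrier G" using y Ac by blast
        define c where "c = commutator g y"
        have c: "c \<in> A (Suc d)" using g(1) y d(1) by (simp add: c_def S0_def)
        have cc: "c \<in> carrier G" using c Ac by blast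
        have cg: "g \<otimes> c = c \<otimes> g" by (rule IH[OF c])
        \<comment> \<open>Coprime action: \<open>g\<close> fixes the commutator \<open>c\<close>, so
          conjugation by \<open>g [^] j\<close> multiplies \<open>y\<close> by
          \<open>c [^] j\<close>. Hence \<open>c\<close> is killed both by \<open>k\<close> and by a
          power of \<open>p\<close>.\<close>
        have "g [^] j \<otimes> y \<otimes> inv (g [^] j) = c [^] j \<otimes> y" for j :: nat
        proof (induction j)
          case 0
          then show ?case using yc by simp
        next
          case (Suc j)
          have cj: "c [^] j \<in> A (Suc d)" by (rule pow_subgroup_closed[OF A c])
          have "g [^] Suc j \<otimes> y \<otimes> inv (g [^] Suc j) = g \<otimes> (g [^] j \<otimes> y \<otimes> inv (g [^] j)) \<otimes> inv g"
            using gc yc nat_pow_Suc2[OF gc, of j] by (simp add: group_simps del: nat_pow_Suc)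
          also have "\<dots> = (g \<otimes> c [^] j \<otimes> inv g) \<otimes> (g \<otimes> y \<otimes> inv g)"
            unfolding Suc using gc cc yc by (simp add: conj_mult)
          also have "g \<otimes> c [^] j \<otimes> inv g = c [^] j" using IH[OF cj] gc cc by (simp add: m_assoc)
          also have "g \<otimes> y \<otimes> inv g = c \<otimes> y" using gc yc by (simp add: c_def conj_eq_commutator)
          finally show ?case using cc yc by (simp add: m_assoc)
        qed
        from this[of k] have "c [^] k \<otimes> y = y" using g(3) yc by simp
        then have "c [^] k = \<one>" using cc yc by (metis nat_pow_closed r_cancel_one)
        moreover have "c \<in> P" using c \<Gamma>P by (auto simp: A_def)
        ultimately have "c = \<one>"
          using coprime_pow_eq_one[OF cc _ P_pow] g(2) by simp
        then show ?thesis using commutator_eq_one_iff[OF gc yc] by (simp add: c_def)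
      qed
      then show ?case by (simp add: d_def)
    qed
    from this[of "n - 2"] have "\<forall>y\<in>M. g \<otimes> y = y \<otimes> g" using A2 P.n_ge by simp
    then have "g \<in> P" by (rule C[OF gc])
    then show ?thesis using coprime_pow_eq_one[OF gc g(3) P_pow] g(2) by simp
  qed
  obtain a where a: "card S0 = p ^ a"
    by (rule prime_power_if_no_coprime_order[OF prime_p fin S0]) (use triv in blast)+
  have mult: "multiplicity p (order G) = n"
    using card_P card_P_eq prime_gt_1_nat[OF prime_p] by (simp add: p_part_def)
  have le_n: "multiplicity p (card H) \<le> n" if "subgroup H G" for H
    using card_subgroup_dvd[OF that subgroup_self subgroup.subset[OF that]] mult
      dvd_imp_multiplicity_le[of "card H" "order G" p] order_gt_0_iff_finite fin
    by (simp add: order_def card_gt_0_iff)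
  have "S0 = P"
  proof -
    have "multiplicity p (card S0) = a" using a prime_p by (simp add: multiplicity_same_power prime_gt_0_nat)
    then have "card S0 \<le> card P"
      using le_n[OF S0] a card_P_eq prime_gt_0_nat[OF prime_p] by (simp add: power_increasing)
    moreover have "P \<subseteq> S0" using PS by blast
    ultimately show ?thesis using card_seteq[OF finite_subgroup[OF fin S0]] by blast
  qed
  have PSsub: "P \<subseteq> S" using \<open>S0 = P\<close> by (auto simp: S0_def)
  \<comment> \<open>\<open>S0\<close> is normal in \<open>S\<close>, being defined by its action on
    a chain that \<open>S\<close> preserves.\<close>
  have S_norm: "h \<otimes> u \<otimes> inv h \<in> P" if h: "h \<in> S" and u: "u \<in> P" for h u
  proof -
    note hc = Sc[OF h]
    have uS: "u \<in> S0" using u \<open>S0 = P\<close> by simp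
    have uc: "u \<in> carrier G" by (rule P_carrier[OF u])
    have "h \<otimes> u \<otimes> inv h \<in> S"
      using h PSsub u by (intro subgroup.m_closed[OF S] subgroup.m_inv_closed[OF S]) auto
    moreover have "commutator (h \<otimes> u \<otimes> inv h) y \<in> A (Suc d)" if y: "y \<in> A d" "2 \<le> d" for y d
    proof -
      have yc: "y \<in> carrier G" using y Ac by blast
      have "commutator u (inv h \<otimes> y \<otimes> h) \<in> A (Suc d)"
        using uS S_conj(2)[OF h y] y(2) by (simp add: S0_def)
      then have "h \<otimes> commutator u (inv h \<otimes> y \<otimes> h) \<otimes> inv h \<in> A (Suc d)" using S_conj(1)[OF h] y(2) by simp
      then show ?thesis using conj_commutator[OF uc _ hc, of "inv h \<otimes> y \<otimes> h"] conj_inv_cancel(2)[OF hc yc] hc yc by simp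
    qed
    ultimately have "h \<otimes> u \<otimes> inv h \<in> S0" by (simp add: S0_def)
    then show ?thesis using \<open>S0 = P\<close> by simp
  qed
  have xP: "x \<in> P" using P.uniformD(1)[OF x] by simp
  note xc = P_carrier[OF xP]
  have TS: "q \<in> S" if q: "q \<in> T" for q
  proof -
    have qc: "q \<in> carrier G" "q \<otimes> x = x \<otimes> q" using q T(2) by (auto simp: centralizer_def)
    have qx: "q \<otimes> x \<otimes> inv q = x" using qc xc by (simp add: m_assoc)
    have high: "A d = {\<one>}" if "n \<le> d" for d
      using P.gam_eq_one[OF that] subgroup.one_closed[OF Ms] by (auto simp: A_def)
    have low: "conj_set q (A (n - i)) = A (n - i)" if "i \<le> n - 2" for i
      using that
    proof (induction i)
      case 0
      then show ?case using An qc(1) by (simp add: conj_set_def)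
    next
      case (Suc i)
      define d where "d = n - Suc i"
      have d: "2 \<le> d" "Suc d = n - i" "d < n" using Suc.prems P.n_ge by (simp_all add: d_def)
      have IH: "conj_set q (A (Suc d)) = A (Suc d)" using Suc unfolding d(2) by simp
      have "q \<otimes> y \<otimes> inv q \<in> A d" if y: "y \<in> A d" for y
      proof -
        have yM: "y \<in> M" and yP: "y \<in> P" and yd: "y \<in> \<Gamma> d" using y \<Gamma>P by (auto simp: A_def)
        note yc = P_carrier[OF yP]
        let ?z = "q \<otimes> y \<otimes> inv q"
        have zM: "?z \<in> M" by (rule normal_conj(1)[OF M(1) yM qc(1)])
        then have z2: "?z \<in> \<Gamma> 2" using M(2) by blast
        then have zP: "?z \<in> P" using \<Gamma>P by blast
        \<comment> \<open>Since \<open>q\<close> fixes \<open>x\<close>, it carries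
          \<open>[x, y]\<close> to \<open>[x, ?z]\<close>. This lies in the next term by induction,
          and uniformity of \<open>x\<close> gives back that \<open>?z\<close> has weight
          \<open>d\<close>.\<close>
        have "commutator x y \<in> A (Suc d)"
          using P.commutator_in_gam_Suc(2)[OF yd, of x] xP P_commutator[OF xP yP] normal_commutator(2)[OF M(1) yM xc]
          by (simp add: A_def)
        then have "q \<otimes> commutator x y \<otimes> inv q \<in> A (Suc d)" using IH by (auto simp: conj_set_def)
        then have "commutator x ?z \<in> A (Suc d)" using conj_commutator[OF xc yc qc(1)] qx by simp
        then have "P.commutator x ?z \<in> \<Gamma> (Suc d)" using P_commutator[OF xP zP] by (simp add: A_def)
        then have "?z \<in> \<Gamma> d" by (rule P.uniform_commutator[OF x z2 d(1,3)])
        then show ?thesis using zM by (simp add: A_def)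
      qed
      then have "conj_set q (A d) \<subseteq> A d" by (auto simp: conj_set_def)
      then show ?case using conj_eq[OF qc(1)] by (simp add: d_def)
    qed
    have "conj_set q (A d) = A d" if "2 \<le> d" for d
    proof (cases "n \<le> d")
      case True
      then show ?thesis using high qc(1) by (simp add: conj_set_def)
    next
      case False
      then show ?thesis using low[of "n - d"] that by simp
    qed
    then show ?thesis using qc(1) by (simp add: S_def)
  qed
  interpret S: group "G\<lparr>carrier := S\<rparr>" using subgroup_imp_group[OF S] .
  have cardPS: "card P = p_part p (order (G\<lparr>carrier := S\<rparr>))"
  proof -
    have "p ^ n dvd card S" using card_subgroup_dvd[OF P_subgroup S PSsub] card_P_eq by simp
    then have "n \<le> multiplicity p (card S)"
      using card_subgroup_pos[OF fin S] prime_gt_1_nat[OF prime_p] by (intro multiplicity_geI) auto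
    then show ?thesis using le_n[OF S] card_P_eq by (simp add: p_part_def order_def)
  qed
  have "T \<subseteq> S" using TS by blast
  then obtain h where h: "h \<in> S" "S.conj_set h T \<subseteq> P"
    using S.sylow_conjugate[OF prime_p _ subgroup_incl[OF P_subgroup S PSsub] cardPS subgroup_incl[OF T(1) S] T(3)]
      finite_subgroup[OF fin S] by auto
  show "T \<subseteq> P"
  proof
    fix q assume q: "q \<in> T"
    have qc: "q \<in> carrier G" by (rule subgroup.mem_carrier[OF T(1) q])
    have "h \<otimes> q \<otimes> inv h \<in> P"
      using h q S by (auto simp: S.conj_set_def m_inv_consistent)
    then have "inv h \<otimes> (h \<otimes> q \<otimes> inv h) \<otimes> inv (inv h) \<in> P"
      by (rule S_norm[OF subgroup.m_inv_closed[OF S h(1)]])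
    then show "q \<in> P" using conj_inv_cancel(1)[OF Sc[OF h(1)] qc] Sc[OF h(1)] by simp
  qed
qed

lemma uniform_normal_p_subgroup:
  assumes M: "M \<lhd> G" "M \<subseteq> \<Gamma> 2" and C: "\<And>g. g \<in> carrier G \<Longrightarrow> \<forall>m\<in>M. g \<otimes> m = m \<otimes> g \<Longrightarrow> g \<in> P"
    and x: "P_uniform x"
  shows "p_part p (card (centralizer G x)) = p ^ 2"
proof -
  interpret P: maximal_class_group GP p n by (rule P_maximal_class)
  have xP: "x \<in> P" using P.uniformD(1)[OF x] by simp
  let ?C = "centralizer G x"
  have Cs: "subgroup ?C G" by (rule centralizer_subgroup[OF P_carrier[OF xP]])
  have card: "card (?C \<inter> P) = p ^ 2" using P.uniformD(3)[OF x] P_centralizer by simp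
  obtain T where T: "subgroup T G" "T \<subseteq> ?C" "card T = p_part p (card ?C)"
    using sylow_exists[OF prime_p fin Cs] .
  have "T \<subseteq> P"
    by (rule normal_subset_P_if_centralizer[OF M _ x T(1,2)]) (use C T(3) in \<open>auto simp: p_part_def\<close>)
  then have "card T \<le> card (?C \<inter> P)"
    using T(2) finite_subgroup[OF fin P_subgroup] by (intro card_mono) auto
  moreover have "p ^ 2 dvd card ?C"
    using card_subgroup_dvd[OF subgroups_Inter_pair[OF Cs P_subgroup] Cs Int_lower1] card by simp
  then have "2 \<le> multiplicity p (card ?C)"
    using card_subgroup_pos[OF fin Cs] prime_gt_1_nat[OF prime_p] by (intro multiplicity_geI) auto
  then have "p ^ 2 \<le> p_part p (card ?C)"
    unfolding p_part_def using prime_gt_0_nat[OF prime_p] by (intro power_increasing) auto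
  ultimately show ?thesis using card T(3) by simp
qed

end

section \<open>The quasisimple case\<close>

lemma maximal_class_cases:
  assumes "Factorial_Ring.prime p" "group H" "finite (carrier H)" "maximal_class p H"
  obtains "order H = p ^ 2" | n where "maximal_class_group H p n"
proof -
  interpret H: group H by (rule assms(2))
  obtain n where nil: "nilpotent H" and n: "order H = p ^ n" "n = nilpotency_class H + 1"
    using assms(4) unfolding maximal_class_def by blast
  define c where "c = nilpotency_class H"
  obtain c0 where c0: "lower_central H c0 = {\<one>\<^bsub>H\<^esub>}" using nil unfolding nilpotent_def by blast
  have c: "lower_central H c = {\<one>\<^bsub>H\<^esub>}"
    unfolding c_def nilpotency_class_def by (rule LeastI[of _ c0]) (rule c0)
  have less: "lower_central H d \<noteq> {\<one>\<^bsub>H\<^esub>}" if "d < c" for d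
    using not_less_Least[OF that[unfolded c_def nilpotency_class_def]] .
  have n_c: "n = Suc c" using n(2) by (simp add: c_def)
  \<comment> \<open>Class 0 would mean a trivial group, but \<open>n = c + 1\<close> makes its order
    \<open>p\<close>.\<close>
  have "c \<noteq> 0"
  proof
    assume "c = 0"
    then have "order H = 1" using c by (simp add: order_def)
    moreover have "order H = p" using n(1) n_c \<open>c = 0\<close> by simp
    ultimately show False using assms(1) by simp
  qed
  show thesis
  proof (cases "c = 1")
    case True
    then show thesis using that(1) n(1) n_c by (simp add: numeral_2_eq_2)
  next
    case False
    have "maximal_class_group H p n"
    proof
      show "3 \<le> n" using n_c False \<open>c \<noteq> 0\<close> by simp
      show "lower_central H (n - 1) = {\<one>\<^bsub>H\<^esub>}" using c n_c by simp
      show "lower_central H (n - 2) \<noteq> {\<one>\<^bsub>H\<^esub>}" using less[of "n - 2"] n_c \<open>c \<noteq> 0\<close> by simp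
    qed (use assms n in auto)
    then show thesis by (rule that(2))
  qed
qed

lemma (in group) center_normal: "center G \<lhd> G"
proof -
  have eq: "center G = {z \<in> carrier G. \<forall>g\<in>carrier G. commutator g z \<in> {\<one>}}"
    by (auto simp: center_def commutator_eq_one_iff)
  have "subgroup (center G) G"
    unfolding eq by (rule subgroup_commutator_in[OF one_is_normal]) simp
  then show ?thesis
  proof (rule normal_invI)
    fix g z assume "g \<in> carrier G" "z \<in> center G"
    then have "g \<otimes> z = z \<otimes> g" "z \<in> carrier G" unfolding center_def by blast+
    then have "g \<otimes> z \<otimes> inv g = z" using \<open>g \<in> carrier G\<close> by (simp add: m_assoc)
    then show "g \<otimes> z \<otimes> inv g \<in> center G" using \<open>z \<in> center G\<close> by simp
  qed
qed

section \<open>No normal subgroup contains \<open>\<Gamma> 2\<close> without containing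
  \<open>P\<close>\<close>

context sylow_maximal_class
begin

context
  assumes core: "p'_core p G = {\<one>}" and residual: "p'_residual p G = carrier G"
    and no_index_p: "\<not> (\<exists>M. M \<lhd> G \<and> \<Gamma> 2 \<subseteq> M \<and> \<not> P \<subseteq> M)"
begin

text \<open>A normal subgroup containing \<open>P\<close> has index prime to \<open>p\<close> and is
  all of \<open>G\<close> by the residual. An element of \<open>P \<inter> M\<close> outside
  \<open>\<Gamma> 2\<close> would bring all of \<open>\<Gamma> 2\<close> into \<open>M\<close>, so
  \<open>tate\<close> applies.\<close>

lemma proper_normal_subset:
  assumes M: "M \<lhd> G" "M \<noteq> carrier G"
  shows "M \<subset> P" "M \<subseteq> \<Gamma> 2"
proof -
  interpret P: maximal_class_group GP p n by (rule P_maximal_class)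
  note Ms = normal_imp_subgroup[OF M(1)]
  have nP: "\<not> P \<subseteq> M"
  proof
    assume PM: "P \<subseteq> M"
    obtain k where k: "card M = card P * k" using card_subgroup_dvd[OF P_subgroup Ms PM] by (elim dvdE)
    have "order G = (card (rcosets M) * k) * p_part p (order G)"
      using lagrange[OF Ms] k card_P by (simp add: ac_simps)
    moreover have "order G > 0" using fin order_gt_0_iff_finite by blast
    ultimately have "\<not> p dvd card (rcosets M) * k" using p_part_cofactor[OF prime_p] by blast
    then have "coprime p (card (rcosets M))" using prime_p by (meson dvd_mult2 prime_imp_coprime)
    then have "p'_residual p G \<subseteq> M" by (rule p'_residual_least(3)[OF fin M(1)])
    then show False using residual M(2) subgroup.subset[OF Ms] by blast
  qed
  have PM: "P \<inter> M \<lhd> GP"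
    using normal_Int_subgroup[OF P_subgroup M(1)] by (simp add: Int_commute)
  have S2: "P \<inter> M \<subseteq> \<Gamma> 2"
  proof
    fix y assume y: "y \<in> P \<inter> M"
    show "y \<in> \<Gamma> 2"
    proof (rule ccontr)
      assume "y \<notin> \<Gamma> 2"
      then have "\<Gamma> 2 \<subseteq> P \<inter> M" by (rule P.normal_gam_2_subset[OF PM y])
      then show False using no_index_p M(1) nP by blast
    qed
  qed
  then have "M \<subseteq> P" by (rule tate[OF M(1) _ core])
  then show "M \<subset> P" "M \<subseteq> \<Gamma> 2" using S2 nP by auto
qed

lemma P_neq_carrier: "P \<noteq> carrier G"
proof
  assume eq: "P = carrier G"
  interpret P: maximal_class_group GP p n by (rule P_maximal_class)
  have GP: "GP = G" using eq by simp
  obtain x where "x \<in> carrier GP" "x \<notin> \<Gamma> 2" using P.gam_diff_ex[of 1] P.n_ge by (auto simp: numeral_2_eq_2)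
  then obtain K where K: "P.maximal_over K" using P.maximal_over_ex by blast
  have "K \<lhd> GP" by (rule P.gam_2_subset_normal[OF P.maximal_overD(1,2)[OF K]])
  moreover have "K \<subset> P" using P.maximal_over_neq(1)[OF K] P.maximal_overD(4)[OF K] by auto
  ultimately show False using no_index_p P.maximal_overD(2)[OF K] unfolding GP by blast
qed

text \<open>A proper derived subgroup lies in \<open>P\<close>, which makes \<open>P\<close> normal;
  but proper normal subgroups are strictly smaller than \<open>P\<close>.\<close>

lemma perfect_G: "perfect G"
proof (rule ccontr)
  assume "\<not> perfect G"
  then have ne: "derived G (carrier G) \<noteq> carrier G" by (simp add: perfect_def)
  have sub: "derived G (carrier G) \<subseteq> P"
    using proper_normal_subset(1)[OF derived_is_normal[OF normal_self] ne] by blast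
  have "P \<lhd> G"
  proof (rule normal_invI[OF P_subgroup])
    fix g h assume gh: "g \<in> carrier G" "h \<in> P"
    have hc: "h \<in> carrier G" by (rule P_carrier[OF gh(2)])
    have "commutator g h \<in> derived G (carrier G)"
      unfolding derived_def commutator_def using gh(1) hc by (intro generate.incl) blast
    then show "g \<otimes> h \<otimes> inv g \<in> P"
      using sub subgroup.m_closed[OF P_subgroup _ gh(2)] gh(1) hc by (auto simp: conj_eq_commutator)
  qed
  then show False using proper_normal_subset(1)[OF _ P_neq_carrier] by blast
qed

lemma center_neq_carrier: "center G \<noteq> carrier G"
proof
  assume eq: "center G = carrier G"
  have "derived G (carrier G) \<subseteq> {\<one>}"
    unfolding derived_def
  proof (rule generate_subgroup_incl[OF _ triv_subgroup], safe)
    fix a b assume "a \<in> carrier G" "b \<in> carrier G"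
    moreover from this have "a \<otimes> b = b \<otimes> a" using eq unfolding center_def by blast
    ultimately show "a \<otimes> b \<otimes> inv a \<otimes> inv b = \<one>"
      using commutator_eq_one_iff[of a b] by (simp add: commutator_def)
  qed
  then have "carrier G \<subseteq> {\<one>}" using perfect_G by (simp add: perfect_def)
  then have "P = carrier G" using subgroup.one_closed[OF P_subgroup] subgroup.subset[OF P_subgroup] by blast
  then show False using P_neq_carrier by blast
qed

text \<open>The bound on the center comes from \<open>x\<close>: central elements lie in
  \<open>\<Gamma> 2\<close> and commute with \<open>x\<close>, so they lie in
  \<open>\<Gamma> (n - 1)\<close>, which has order \<open>p\<close>.\<close>

lemma quasisimple_or_uniform:
  assumes x: "P_uniform x"
  shows "p_part p (card (centralizer G x)) = p ^ 2 \<or> quasisimple G \<and> card (center G) \<le> p"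
proof (cases "p_part p (card (centralizer G x)) = p ^ 2")
  case False
  interpret P: maximal_class_group GP p n by (rule P_maximal_class)
  let ?Z = "center G" and ?Q = "G Mod center G"
  interpret Z: normal ?Z G by (rule center_normal)
  interpret Q: group ?Q by (rule Z.factorgroup_is_group)
  have Z2: "?Z \<subset> P" "?Z \<subseteq> \<Gamma> 2" using proper_normal_subset[OF center_normal center_neq_carrier] by blast+
  have xP: "x \<in> P" using P.uniformD(1)[OF x] by simp
  have "?Z \<subseteq> centralizer GP x \<inter> \<Gamma> 2"
  proof
    fix z assume z: "z \<in> ?Z"
    then have "x \<otimes> z = z \<otimes> x" "z \<in> carrier G" using P_carrier[OF xP] unfolding center_def by blast+
    then have "z \<in> centralizer G x" unfolding centralizer_def by simp
    then show "z \<in> centralizer GP x \<inter> \<Gamma> 2" using z Z2 P_centralizer by blast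
  qed
  then have "?Z \<subseteq> \<Gamma> (n - 1)" using P.uniformD(4)[OF x] by simp
  moreover have "finite (\<Gamma> (n - 1))" using P.finite_subgroup[OF P.fin P.gam_subgroup] .
  ultimately have "card ?Z \<le> card (\<Gamma> (n - 1))" by (intro card_mono)
  also have "\<dots> = p" using P.card_gam[of "n - 1"] P.n_ge by simp
  finally have card_Z: "card ?Z \<le> p" .
  \<comment> \<open>A noncentral proper \<open>M\<close> has a proper centralizer, itself normal and
    hence inside \<open>P\<close>; then \<open>uniform_normal_p_subgroup\<close> gives the
    alternative excluded in this case.\<close>
  have small: "M \<subseteq> ?Z" if M: "M \<lhd> G" "M \<noteq> carrier G" for M
  proof (rule ccontr)
    assume nZ: "\<not> M \<subseteq> ?Z"
    let ?C = "{g \<in> carrier G. \<forall>m\<in>M. commutator m g \<in> {\<one>}}"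
    have Mc: "m \<in> carrier G" if "m \<in> M" for m by (rule normal_closed(4)[OF M(1) that])
    have C_iff: "g \<in> ?C \<longleftrightarrow> g \<in> carrier G \<and> (\<forall>m\<in>M. g \<otimes> m = m \<otimes> g)" for g
      using Mc by (auto simp: commutator_eq_one_iff)
    have C: "subgroup ?C G" by (rule subgroup_commutator_in[OF one_is_normal]) (use Mc in blast)
    have "?C \<lhd> G"
    proof (rule normal_invI[OF C])
      fix g c assume g: "g \<in> carrier G" and c: "c \<in> ?C"
      have cc: "c \<in> carrier G" using c by blast
      have "commutator m (g \<otimes> c \<otimes> inv g) = \<one>" if m: "m \<in> M" for m
      proof -
        have "commutator (inv g \<otimes> m \<otimes> g) c = \<one>" using c normal_conj(2)[OF M(1) m g] by blast
        then have "g \<otimes> commutator (inv g \<otimes> m \<otimes> g) c \<otimes> inv g = \<one>" using g by simp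
        then show ?thesis
          using conj_commutator[of "inv g \<otimes> m \<otimes> g" c g] conj_inv_cancel(2)[OF g Mc[OF m]] g cc Mc[OF m] by simp
      qed
      then show "g \<otimes> c \<otimes> inv g \<in> ?C" using g cc by simp
    qed
    moreover have "?C \<noteq> carrier G"
    proof
      assume eq: "?C = carrier G"
      have "m \<in> ?Z" if m: "m \<in> M" for m
      proof -
        have "g \<otimes> m = m \<otimes> g" if "g \<in> carrier G" for g using C_iff[of g] that m unfolding eq by blast
        then show ?thesis unfolding center_def using Mc[OF m] by blast
      qed
      then show False using nZ by blast
    qed
    ultimately have "?C \<subset> P" by (rule proper_normal_subset(1))
    then have "p_part p (card (centralizer G x)) = p ^ 2"
      by (intro uniform_normal_p_subgroup[OF M(1) proper_normal_subset(2)[OF M] _ x]) (use C_iff in blast)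
    then show False using False by blast
  qed
  have "simple_group ?Q"
  proof
    have "carrier ?Q \<noteq> {\<one>\<^bsub>?Q\<^esub>}"
      using Z.fact_group_trivial_iff[OF fin] center_neq_carrier by blast
    moreover have "finite (carrier ?Q)" using fin by (simp add: carrier_FactGroup)
    ultimately show "1 < order ?Q"
      using Q.one_closed by (metis (no_types) Q.order_one_triv_iff Q.order_gt_0_iff_finite One_nat_def Suc_lessI)
  next
    fix H assume H: "H \<lhd> ?Q"
    note Hs = normal_imp_subgroup[OF H]
    have U: "\<Union>H \<lhd> G" by (rule Z.factgroup_subgroup_union_normal[OF H])
    have H_eq: "H = rcosets\<^bsub>G\<lparr>carrier := \<Union>H\<rparr>\<^esub> ?Z" by (rule Z.factgroup_subgroup_union_factor[OF Hs])
    show "H = carrier ?Q \<or> H = {\<one>\<^bsub>?Q\<^esub>}"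
    \<comment> \<open>A subgroup of the quotient is recovered from its preimage
      \<open>\<Union>H\<close>, which is either everything or central by
      \<open>small\<close>.\<close>
    proof (cases "\<Union>H = carrier G")
      case True
      then have "H = carrier ?Q" using H_eq by (simp add: FactGroup_def RCOSETS_def r_coset_def)
      then show ?thesis ..
    next
      case False
      then have UZ: "\<Union>H \<subseteq> ?Z" using small[OF U] by blast
      have "X = ?Z" if X: "X \<in> H" for X
      proof -
        obtain a where a: "a \<in> carrier G" "X = ?Z #> a"
          using X subgroup.subset[OF Hs] by (auto simp: carrier_FactGroup)
        have "a \<in> X" unfolding a(2) by (rule rcos_self[OF a(1) Z.is_subgroup])
        then have "a \<in> ?Z" using UZ X by blast
        then show ?thesis using a coset_join2[OF a(1) Z.is_subgroup] by simp
      qed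
      moreover have "?Z \<in> H" using subgroup.one_closed[OF Hs] by simp
      ultimately have "H = {?Z}" by blast
      then show ?thesis by simp
    qed
  qed
  moreover have "\<not> comm_group ?Q"
  proof
    assume "comm_group ?Q"
    then interpret Q: comm_group ?Q .
    have "commutator a b \<in> ?Z" if ab: "a \<in> carrier G" "b \<in> carrier G" for a b
    proof -
      have "(?Z #> a) \<otimes>\<^bsub>?Q\<^esub> (?Z #> b) = (?Z #> b) \<otimes>\<^bsub>?Q\<^esub> (?Z #> a)"
        using ab by (intro Q.m_comm) (auto simp: carrier_FactGroup)
      then have "?Z #> (a \<otimes> b) = ?Z #> (b \<otimes> a)" using ab by (simp add: Z.rcos_sum)
      then show ?thesis using normal_coset_commute_iff[OF center_normal ab] by simp
    qed
    then have "derived G (carrier G) \<subseteq> ?Z"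
      unfolding derived_def commutator_def
      by (intro generate_subgroup_incl[OF _ Z.is_subgroup]) blast
    then show False using perfect_G center_neq_carrier Z.subset by (auto simp: perfect_def)
  qed
  ultimately show ?thesis using perfect_G card_Z by (simp add: quasisimple_def)
qed simp

end

end

theorem theoremB:
  fixes G :: "('a, 'b) monoid_scheme" and p :: nat and P :: "'a set"
  assumes "Factorial_Ring.prime p"
    and "group G" and "finite (carrier G)"
    and "sylow_subgroup p P G"
    and "maximal_class p (G\<lparr>carrier := P\<rparr>)"
    and "p'_core p G = {\<one>\<^bsub>G\<^esub>}"
    and "p'_residual p G = carrier G"
  shows "(\<exists>x\<in>P. p_part p (card (centralizer G x)) = p ^ 2) \<or>
    (quasisimple G \<and> card (center G) \<le> p)"
proof -
  interpret group G by (rule assms(2))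
  have P: "subgroup P G" "card P = p_part p (order G)" using assms(4) by (simp_all add: sylow_subgroup_def)
  interpret GP: group "G\<lparr>carrier := P\<rparr>" by (rule subgroup_imp_group[OF P(1)])
  have "finite (carrier (G\<lparr>carrier := P\<rparr>))" using finite_subgroup[OF assms(3) P(1)] by simp
  from maximal_class_cases[OF assms(1) GP.is_group this assms(5)] show ?thesis
  proof cases
    case 1
    have "centralizer G \<one>\<^bsub>G\<^esub> = carrier G" by (auto simp: centralizer_def)
    then have "p_part p (card (centralizer G \<one>\<^bsub>G\<^esub>)) = p ^ 2" using 1 P(2) by (simp add: order_def)
    then show ?thesis using subgroup.one_closed[OF P(1)] by blast
  next
    case (2 n)
    interpret sylow_maximal_class G p n P
      by (intro sylow_maximal_class.intro sylow_maximal_class_axioms.intro is_group assms P 2)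
    interpret P: maximal_class_group "G\<lparr>carrier := P\<rparr>" p n by (rule 2)
    show ?thesis
    proof (cases "\<exists>M. M \<lhd> G \<and> \<Gamma> 2 \<subseteq> M \<and> \<not> P \<subseteq> M")
      case True
      then show ?thesis using uniform_outside_normal by blast
    next
      case False
      obtain y where "y \<in> carrier (G\<lparr>carrier := P\<rparr>)" "y \<notin> \<Gamma> 2"
        using P.gam_diff_ex[of 1] P.n_ge by (auto simp: numeral_2_eq_2)
      \<comment> \<open>Nothing has to be avoided here, so \<open>N\<close> is an arbitrary maximal
        subgroup.\<close>
      then obtain N where "P.maximal_over N" using P.maximal_over_ex by blast
      then obtain K where K: "P.maximal_over K" "\<And>y. y \<in> K \<Longrightarrow> y \<notin> \<Gamma> 2 \<Longrightarrow> P.uniform y"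
        using P.uniform_maximal_over_ex by blast
      obtain x where "x \<in> K" "x \<notin> \<Gamma> 2" using P.maximal_over_neq(2)[OF K(1)] P.maximal_overD(2)[OF K(1)] by blast
      then have x: "P.uniform x" by (rule K(2))
      then have "x \<in> P" using P.uniformD(1) by auto
      then show ?thesis using quasisimple_or_uniform[OF assms(6,7) False x] by blast
    qed
  qed
qed

end
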